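(* Let $X$ be a compact Hausdorff space and let $\{\mu_x\}_{x\in X}$ be a weakly continuous family of Borel probability measures on $[0,1)$. Then the sequence $\{e^{2\pi i ny}\}_{n=0}^{\infty}\subseteq WC(X,L^2(\mu_x))$ is effective if and only if for every $x\in X$, $\mu_x$ is singular or Lebesgue measure.
   Context: Weakly continuous means that for every $g\in C_b([0,1))$ the function $x\mapsto\int_0^1 g\,d\mu_x$ is continuous on $X$. Singular means singular with respect to Lebesgue measure on $[0,1)$. The Hilbert $C(X)$-module $WC(X,L^2(\mu_x))$ is defined as follows: let $V$ be the space of all finite $C(X)$-linear combinations $\sum_n c_n e^{2\pi i ny}$ ($n\ge0$, $c_n\in C(X)$), viewed as functions $f$ on $X$ with $f(x)=\sum_n c_n(x)e^{2\pi i ny}\in L^2(\mu_x)$ for each $x$, with $C(X)$-valued inner product $\langle\sum_nc_ne^{2\pi i ny},\sum_kd_ke^{2\pi i ky}\rangle(x)=\sum_n\sum_kc_n(x)\overline{d_k(x)}\int_0^1e^{2\pi i(n-k)y}\,d\mu_x(y)$; then $WC(X,L^2(\mu_x))$ is the completion of $V$ in the norm $\|f\|=\sqrt{\|\langle f,f\rangle\|_{C(X)}}$. A sequence $\{e_n\}_{n=0}^\infty$ in a Hilbert $C(X)$-module $H$ with $\langle e_n,e_n\rangle=1$ for all $n$ is called effective if for every $f\in H$ the sequence defined by $f_0=\langle f,e_0\rangle e_0$ and $f_n=f_{n-1}+\langle f-f_{n-1},e_n\rangle e_n$ for $n\ge1$ converges to $f$ in norm. *)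

theory Defs
  imports "HOL-Probability.Probability" "HOL-Library.Poly_Mapping"
begin

text \<open>For a compact space, \<open>C(X)\<close> is the library type of bounded continuous functions, which
  carries the supremum norm.\<close>

type_synonym 'x CX = "'x \<Rightarrow>\<^sub>C complex"

definition CX_mult :: "'x::topological_space CX \<Rightarrow> 'x CX \<Rightarrow> 'x CX" where
  "CX_mult u v = Bcontfun (\<lambda>x. apply_bcontfun u x * apply_bcontfun v x)"

lemma apply_CX_mult:
  "apply_bcontfun (CX_mult u v) x = apply_bcontfun u x * apply_bcontfun v x"
proof -
  have "norm (apply_bcontfun u x * apply_bcontfun v x) \<le> norm u * norm v" for x
    by (simp add: norm_mult norm_bounded mult_mono')
  then have "(\<lambda>x. apply_bcontfun u x * apply_bcontfun v x) \<in> bcontfun"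
    by (intro bcontfun_normI continuous_intros) auto
  then show ?thesis
    unfolding CX_mult_def by (simp add: Bcontfun_inverse)
qed


section \<open>Effective sequences in Hilbert \<open>C(X)\<close>-modules\<close>

text \<open>The operations of a Hilbert \<open>C(X)\<close>-module.  The inner product is linear in its first
  argument.\<close>

record (overloaded) ('h, 'x) CX_module =
  hcarrier :: "'h set"
  hadd :: "'h \<Rightarrow> 'h \<Rightarrow> 'h"
  hsmult :: "'x::topological_space CX \<Rightarrow> 'h \<Rightarrow> 'h"
  hinner :: "'h \<Rightarrow> 'h \<Rightarrow> 'x CX"

definition hminus :: "('h, 'x::topological_space) CX_module \<Rightarrow> 'h \<Rightarrow> 'h \<Rightarrow> 'h" where
  "hminus H f g = hadd H f (hsmult H (const_bcontfun (- 1)) g)"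

definition hnorm :: "('h, 'x::topological_space) CX_module \<Rightarrow> 'h \<Rightarrow> real" where
  "hnorm H f = sqrt (norm (hinner H f f))"

primrec eff_approx ::
  "('h, 'x::topological_space) CX_module \<Rightarrow> (nat \<Rightarrow> 'h) \<Rightarrow> 'h \<Rightarrow> nat \<Rightarrow> 'h" where
  "eff_approx H e f 0 = hsmult H (hinner H f (e 0)) (e 0)"
| "eff_approx H e f (Suc n) =
     hadd H (eff_approx H e f n)
       (hsmult H (hinner H (hminus H f (eff_approx H e f n)) (e (Suc n))) (e (Suc n)))"

definition effective :: "('h, 'x::topological_space) CX_module \<Rightarrow> (nat \<Rightarrow> 'h) \<Rightarrow> bool" where
  "effective H e \<longleftrightarrow>
     (\<forall>n. e n \<in> hcarrier H \<and> hinner H (e n) (e n) = const_bcontfun 1) \<and>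
     (\<forall>f\<in>hcarrier H. (\<lambda>n. hnorm H (hminus H (eff_approx H e f n) f)) \<longlonglongrightarrow> 0)"


section \<open>Families of measures on \<open>[0,1)\<close>\<close>

definition borel_prob_family :: "('x \<Rightarrow> real measure) \<Rightarrow> bool" where
  "borel_prob_family \<mu> \<longleftrightarrow>
     (\<forall>x. prob_space (\<mu> x) \<and> sets (\<mu> x) = sets (restrict_space borel {0..<1}))"

definition weakly_continuous :: "('x::topological_space \<Rightarrow> real measure) \<Rightarrow> bool" where
  "weakly_continuous \<mu> \<longleftrightarrow>
     (\<forall>g :: real \<Rightarrow> complex. continuous_on {0..<1} g \<and> bounded (g ` {0..<1}) \<longrightarrow>
        continuous_on UNIV (\<lambda>x. \<integral>y. g y \<partial>\<mu> x))"

definition lebesgue01 :: "real measure" where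
  "lebesgue01 = restrict_space lborel {0..<1}"

definition mutually_singular :: "'a measure \<Rightarrow> 'a measure \<Rightarrow> bool" where
  "mutually_singular M N \<longleftrightarrow>
     (\<exists>A\<in>sets M \<inter> sets N. emeasure M A = 0 \<and> emeasure N (space N - A) = 0)"


section \<open>The module \<open>WC(X, L\<^sup>2(\<mu>\<^sub>x))\<close>\<close>

text \<open>An element \<open>c\<close> of the following type stands for the finite \<open>C(X)\<close>-linear combination
  \<open>\<Sum>n. c n * e\<^bsup>2\<pi>iny\<^esup>\<close>.  Combinations that define the same element of \<open>L\<^sup>2(\<mu> x)\<close> for every \<open>x\<close>
  differ by an element of seminorm 0, so they are identified by the completion below.\<close>

type_synonym 'x trig = "nat \<Rightarrow>\<^sub>0 'x CX"

definition trig_smult :: "'x::topological_space CX \<Rightarrow> 'x trig \<Rightarrow> 'x trig" where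
  "trig_smult u c = Poly_Mapping.map (CX_mult u) c"

definition trig_inner_fun ::
  "('x::topological_space \<Rightarrow> real measure) \<Rightarrow> 'x trig \<Rightarrow> 'x trig \<Rightarrow> 'x \<Rightarrow> complex" where
  "trig_inner_fun \<mu> c d x =
     (\<Sum>n\<in>Poly_Mapping.keys c. \<Sum>k\<in>Poly_Mapping.keys d.
        apply_bcontfun (Poly_Mapping.lookup c n) x * cnj (apply_bcontfun (Poly_Mapping.lookup d k) x) *
        (\<integral>y. cis (2 * pi * (real n - real k) * y) \<partial>\<mu> x))"

text \<open>\<open>Bcontfun\<close> is meaningful here only if its argument is bounded and continuous; see
  \<open>apply_trig_inner\<close> below.\<close>

definition trig_inner ::
  "('x::topological_space \<Rightarrow> real measure) \<Rightarrow> 'x trig \<Rightarrow> 'x trig \<Rightarrow> 'x CX" where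
  "trig_inner \<mu> c d = Bcontfun (trig_inner_fun \<mu> c d)"

lemma apply_trig_inner:
  fixes \<mu> :: "'x::topological_space \<Rightarrow> real measure"
  assumes "compact (UNIV :: 'x set)" "weakly_continuous \<mu>"
  shows "apply_bcontfun (trig_inner \<mu> c d) x = trig_inner_fun \<mu> c d x"
proof -
  have "continuous_on UNIV (\<lambda>x. \<integral>y. cis (2 * pi * (real n - real k) * y) \<partial>\<mu> x)" for n k
  proof -
    have "continuous_on {0..<1} (\<lambda>y::real. cis (2 * pi * (real n - real k) * y))"
      by (intro continuous_intros)
    moreover have "bounded ((\<lambda>y::real. cis (2 * pi * (real n - real k) * y)) ` {0..<1})"
      by (auto simp: bounded_iff intro: exI[of _ 1])
    ultimately show ?thesis
      using assms(2) unfolding weakly_continuous_def by blast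
  qed
  then have cont: "continuous_on UNIV (trig_inner_fun \<mu> c d)"
    unfolding trig_inner_fun_def by (intro continuous_intros) auto
  moreover have "bounded (range (trig_inner_fun \<mu> c d))"
    using compact_continuous_image[OF cont assms(1)] by (rule compact_imp_bounded)
  ultimately have "trig_inner_fun \<mu> c d \<in> bcontfun"
    by (simp add: bcontfun_def)
  then show ?thesis
    unfolding trig_inner_def by (simp add: Bcontfun_inverse)
qed

definition trig_norm :: "('x::topological_space \<Rightarrow> real measure) \<Rightarrow> 'x trig \<Rightarrow> real" where
  "trig_norm \<mu> c = sqrt (norm (trig_inner \<mu> c c))"

definition trig_Cauchy :: "('x::topological_space \<Rightarrow> real measure) \<Rightarrow> (nat \<Rightarrow> 'x trig) set" where
  "trig_Cauchy \<mu> =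
     {a. \<forall>\<epsilon>>0. \<exists>N. \<forall>m\<ge>N. \<forall>n\<ge>N. trig_norm \<mu> (a m - a n) < \<epsilon>}"

definition trig_equiv ::
  "('x::topological_space \<Rightarrow> real measure) \<Rightarrow> ((nat \<Rightarrow> 'x trig) \<times> (nat \<Rightarrow> 'x trig)) set" where
  "trig_equiv \<mu> =
     {(a, b). a \<in> trig_Cauchy \<mu> \<and> b \<in> trig_Cauchy \<mu> \<and> (\<lambda>k. trig_norm \<mu> (a k - b k)) \<longlonglongrightarrow> 0}"

text \<open>The completion: Cauchy sequences modulo null sequences, with the operations induced by
  the termwise operations on representatives.\<close>

definition WC ::
  "('x::topological_space \<Rightarrow> real measure) \<Rightarrow> ((nat \<Rightarrow> 'x trig) set, 'x) CX_module" where
  "WC \<mu> = \<lparr>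
     hcarrier = trig_Cauchy \<mu> // trig_equiv \<mu>,
     hadd = (\<lambda>A B. \<Union>a\<in>A. \<Union>b\<in>B. trig_equiv \<mu> `` {\<lambda>k. a k + b k}),
     hsmult = (\<lambda>u A. \<Union>a\<in>A. trig_equiv \<mu> `` {\<lambda>k. trig_smult u (a k)}),
     hinner = (\<lambda>A B. THE z. \<forall>a\<in>A. \<forall>b\<in>B. (\<lambda>k. trig_inner \<mu> (a k) (b k)) \<longlonglongrightarrow> z)\<rparr>"

definition WC_embed ::
  "('x::topological_space \<Rightarrow> real measure) \<Rightarrow> 'x trig \<Rightarrow> (nat \<Rightarrow> 'x trig) set" where
  "WC_embed \<mu> c = trig_equiv \<mu> `` {\<lambda>k. c}"

definition WC_exp :: "('x::topological_space \<Rightarrow> real measure) \<Rightarrow> nat \<Rightarrow> (nat \<Rightarrow> 'x trig) set" where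
  "WC_exp \<mu> n = WC_embed \<mu> (Poly_Mapping.single n (const_bcontfun 1))"

end

theory Submission
  imports Defs "HOL-Complex_Analysis.Complex_Analysis"
begin

text \<open>
  The statement is, fibre by fibre, the theorem of Kwapien and Mycielski on the Kaczmarz algorithm
  for stationary sequences; compactness of \<open>X\<close> glues the fibres together.

  Reduction to the fibres.  Write \<open>e\<^sub>n\<close> for the \<open>n\<close>-th exponential.  Each step of the algorithm removes
  from the current error its component along \<open>e\<^sub>n\<close>.  So the map from \<open>f\<close> to the error after \<open>n\<close> steps
  is linear over \<open>C(X)\<close> and a contraction, and it suffices to test the vectors \<open>e\<^sub>m\<close>
  (\<open>effective_iff_residual\<close>).  The squared error of \<open>e\<^sub>m\<close> in the fibre over \<open>x\<close> depends continuously on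
  \<open>x\<close> and decreases with \<open>n\<close>; by Dini's theorem it tends to 0 uniformly if it does so pointwise
  (\<open>residual_tendsto_iff\<close>).

  A single measure.  Let \<open>\<mu>\<close> be a probability measure on the circle with Fourier coefficients \<open>b\<^sub>j\<close>, and
  let \<open>d\<^sub>n\<close> be the coefficients that the algorithm produces from \<open>e\<^sub>m\<close>.  They satisfy
  \<open>(\<Sum>k\<le>n. d\<^sub>k * b\<^bsub>n-k\<^esub>) = b\<^bsub>n-m\<^esub>\<close>.  In terms of the power series \<open>h = (\<Sum>n. d\<^sub>n w\<^sup>n)\<close>, the Cauchy
  transform \<open>C = (\<Sum>n. b\<^sub>n w\<^sup>n)\<close> and the polynomial \<open>p = (\<Sum>n<m. b\<^bsub>n-m\<^esub> w\<^sup>n)\<close> this reads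
  \<open>h C = w\<^sup>m C + p\<close>.  A comparison of coefficients shows that the limiting squared error of \<open>e\<^sub>m\<close> is
  the difference of the squared Hardy norms of \<open>p\<close> and of \<open>p + w\<^sup>m - h = p (1 - 1/C)\<close>, which is the
  limit, as \<open>r\<close> tends to 1, of the integral of \<open>\<bar>p\<bar>\<^sup>2 (2 Re C - 1) / \<bar>C\<bar>\<^sup>2\<close> over the circle of radius
  \<open>r\<close> (\<open>tendsto_integral_defect\<close>).  Here \<open>2 Re C - 1\<close> is the Poisson integral of \<open>\<mu>\<close>.

  For Lebesgue measure \<open>p = 0\<close>.  If \<open>\<mu>\<close> is singular, its Poisson integral concentrates near a null
  set, while the integrand stays bounded, so the limit is 0 (\<open>singular_imp_coeff_sum\<close>).  Conversely,
  if \<open>\<mu>\<close> is not singular, it dominates a positive multiple of Lebesgue measure on some set \<open>E\<close> of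
  positive Lebesgue measure.  The factor \<open>1 / \<bar>C\<bar>\<^sup>2\<close> is small only on a small set
  (\<open>measure_large_cauchy_transform\<close>), so if the limit is 0, then \<open>\<bar>p\<bar>\<^sup>2\<close> has integral 0 over \<open>E\<close> and the
  polynomial \<open>p\<close> vanishes (\<open>coeff_sum_imp_singular\<close>).  If this happens for every \<open>m\<close>, all Fourier
  coefficients but \<open>b\<^sub>0\<close> are 0 and \<open>\<mu>\<close> is Lebesgue measure (\<open>eq_lebesgue_if_fourier_0\<close>).  In
  both cases the Poisson integrals near the boundary are controlled by one estimate: smoothing a Lipschitz function on the circle with the Poisson
  kernel changes it by an explicit small amount (\<open>poisson_integral_lipschitz\<close>).
\<close>

section \<open>The circle and its trigonometric series\<close>

lemma borel_measurable_cnj [measurable (raw)]: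
  assumes "f \<in> borel_measurable M"
  shows "(\<lambda>x. cnj (f x)) \<in> borel_measurable M"
  using assms by (intro borel_measurable_continuous_on[where f = cnj]) (auto intro: continuous_intros)

definition circ :: "real \<Rightarrow> complex" where
  "circ y = cis (2 * pi * y)"

lemma norm_circ [simp]: "norm (circ y) = 1"
  by (simp add: circ_def)

lemma circ_nonzero [simp]: "circ y \<noteq> 0"
  by (simp add: circ_def)

lemma circ_mult_cnj [simp]: "circ y * cnj (circ y) = 1" "cnj (circ y) * circ y = 1"
  by (simp_all add: circ_def cis_cnj cis_mult)

lemma inverse_circ: "inverse (circ y) = cnj (circ y)"
  by (simp add: circ_def cis_cnj)

lemma circ_powi_minus: "circ y powi (- int n) = cnj (circ y) ^ n"
  by (simp add: power_int_minus inverse_circ flip: power_inverse)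

lemma circ_powi: "circ y powi k = cis (2 * pi * of_int k * y)"
  by (simp add: circ_def cis_power_int mult_ac)

lemma continuous_on_circ [continuous_intros]: "continuous_on S circ"
  unfolding circ_def[abs_def] by (intro continuous_intros)

lemma measurable_circ [measurable]: "circ \<in> borel_measurable borel"
  by (intro borel_measurable_continuous_onI continuous_intros)

lemma measurable_circ_powi [measurable]: "(\<lambda>y. circ y powi k) \<in> borel_measurable borel"
  unfolding circ_powi by (intro borel_measurable_continuous_onI continuous_intros)

lemma inj_on_circ: "inj_on circ {0..<1}"
proof (rule inj_onI)
  fix x y :: real
  assume xy: "x \<in> {0..<1}" "y \<in> {0..<1}" "circ x = circ y"
  then have "exp (\<i> * complex_of_real (2 * pi * x)) = exp (\<i> * complex_of_real (2 * pi * y))"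
    by (simp add: circ_def cis_conv_exp)
  then obtain n :: int where "\<i> * complex_of_real (2 * pi * x)
      = \<i> * complex_of_real (2 * pi * y) + (2 * of_int n * pi) * \<i>"
    by (auto simp: exp_eq)
  then have "complex_of_real (2 * pi * x) = complex_of_real (2 * pi * y + 2 * of_int n * pi)"
    by (auto simp: complex_eq_iff)
  then have "2 * pi * x = 2 * pi * (y + of_int n)"
    by (simp only: of_real_eq_iff) (simp add: algebra_simps)
  then have *: "x = y + of_int n"
    by simp
  then have "real_of_int n < 1" "real_of_int n > -1"
    using xy by auto
  then have "n = 0" by linarith
  with * show "x = y" by simp
qed

text \<open>The interval \<open>[0,1)\<close> only parametrises the circle: every estimate below is made in terms of
  the points \<open>circ y\<close>, so that arguments near 0 and near 1 count as close.\<close>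

locale circle_prob = prob_space \<mu> for \<mu> :: "real measure" +
  assumes sets_circle: "sets \<mu> = sets (restrict_space borel {0..<1})"
begin

lemma space_circle [simp]: "space \<mu> = {0..<1}"
  using sets_eq_imp_space_eq[OF sets_circle] by (simp add: space_restrict_space)

lemma measurable_id_circle [measurable]: "(\<lambda>y. y) \<in> borel_measurable \<mu>"
  by (subst measurable_cong_sets[OF sets_circle refl]) (auto intro: measurable_restrict_space1)

lemma measurable_circ_circle [measurable]: "circ \<in> borel_measurable \<mu>"
  using measurable_compose[OF measurable_id_circle measurable_circ] by simp

lemma integrable_bounded:
  fixes f :: "real \<Rightarrow> 'b::{banach, second_countable_topology}"
  assumes "f \<in> borel_measurable \<mu>" "\<And>y. y \<in> {0..<1} \<Longrightarrow> norm (f y) \<le> B"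
  shows "integrable \<mu> f"
  by (rule integrable_const_bound[where B = B]) (use assms in auto)

lemma sets_circle_iff: "A \<in> sets \<mu> \<longleftrightarrow> A \<in> sets borel \<and> A \<subseteq> {0..<1}"
  by (auto simp: sets_circle sets_restrict_space_iff)

end

interpretation leb: circle_prob lebesgue01
proof (intro circle_prob.intro prob_spaceI circle_prob_axioms.intro)
  show "emeasure lebesgue01 (space lebesgue01) = 1"
    by (simp add: lebesgue01_def emeasure_restrict_space space_restrict_space)
  show "sets lebesgue01 = sets (restrict_space borel {0..<1})"
    by (auto simp: lebesgue01_def sets_restrict_space)
qed

lemma integral_circ_powi: "(\<integral>t. circ t powi k \<partial>lebesgue01) = (if k = 0 then 1 else 0)"
proof (cases "k = 0")
  case True
  then show ?thesis using leb.prob_space by simp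
next
  case False
  define c where "c = 2 * pi * \<i> * of_int k"
  define F where "F t = exp (c * complex_of_real t) / c" for t
  have c: "c \<noteq> 0" using False by (simp add: c_def)
  have eq: "circ t powi k = exp (c * complex_of_real t)" for t
    by (simp add: circ_powi cis_conv_exp c_def mult_ac)
  have "((\<lambda>z. exp (c * z) / c) has_field_derivative exp (c * z)) (at z)" for z
    using c by (auto intro!: derivative_eq_intros)
  then have der: "(F has_vector_derivative circ t powi k) (at t within {0..1})" for t
    unfolding F_def eq by (rule has_vector_derivative_real_field)
  have cont: "continuous_on {0..1} (\<lambda>t. circ t powi k)"
    by (intro continuous_intros) auto
  have "integral\<^sup>L lborel (\<lambda>t. indicator {0..1} t *\<^sub>R circ t powi k) = F 1 - F 0"
    by (rule integral_FTC_Icc) (use der cont in auto)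
  also have "F 1 = F 0"
    using eq[of 0] eq[of 1] by (simp add: F_def circ_def flip: cis_conv_exp)
  finally have "integral\<^sup>L lborel (\<lambda>t. indicator {0..1} t *\<^sub>R circ t powi k) = 0" by simp
  moreover have "integral\<^sup>L lborel (\<lambda>t. indicator {0..<1} t *\<^sub>R circ t powi k)
      = integral\<^sup>L lborel (\<lambda>t. indicator {0..1} t *\<^sub>R circ t powi k)"
  proof (rule integral_cong_AE)
    show "AE t in lborel. indicator {0..<1} t *\<^sub>R circ t powi k = indicator {0..1} t *\<^sub>R circ t powi k"
      using AE_lborel_singleton[of 1] by eventually_elim (auto simp: indicator_def)
    show "(\<lambda>t. indicator {0..<1} t *\<^sub>R circ t powi k) \<in> borel_measurable lborel"
      "(\<lambda>t. indicator {0..1} t *\<^sub>R circ t powi k) \<in> borel_measurable lborel"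
      by (simp_all, measurable)
  qed
  ultimately show ?thesis
    using False by (simp add: lebesgue01_def integral_restrict_space)
qed

lemma integral_circ_power: "(\<integral>t. circ t ^ n \<partial>lebesgue01) = (if n = 0 then 1 else 0)"
  using integral_circ_powi[of "int n"] by (simp add: power_int_of_nat)

lemma integral_circ_power_cnj:
  "(\<integral>t. circ t ^ n * cnj (circ t ^ k) \<partial>lebesgue01) = (if n = k then 1 else 0)"
proof -
  have "circ t ^ n * cnj (circ t ^ k) = circ t powi (int n - int k)" for t
  proof -
    have "circ t powi (int n - int k) = circ t ^ n / circ t ^ k"
      by (simp add: power_int_diff)
    also have "\<dots> = circ t ^ n * cnj (circ t ^ k)"
      by (simp add: divide_inverse inverse_circ flip: power_inverse)
    finally show ?thesis by simp
  qed
  then show ?thesis by (simp add: integral_circ_powi)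
qed

text \<open>An absolutely convergent trigonometric series may be integrated termwise against a bounded
  function; Parseval's identity and the mean value property are two instances.\<close>

lemma
  fixes a :: "nat \<Rightarrow> complex"
  assumes summ: "summable (\<lambda>n. norm (a n))" and f: "\<And>t. (\<lambda>n. a n * circ t ^ n) sums f t"
    and g: "g \<in> borel_measurable lebesgue01" "\<And>t. norm (g t) \<le> B"
  shows measurable_trig_series: "f \<in> borel_measurable lebesgue01"
    and sums_integral_trig_series:
      "(\<lambda>n. a n * (\<integral>t. circ t ^ n * g t \<partial>lebesgue01)) sums (\<integral>t. f t * g t \<partial>lebesgue01)"
proof -
  have f': "f = (\<lambda>t. suminf (\<lambda>n. a n * circ t ^ n))"
    using f by (auto simp: sums_iff)
  show "f \<in> borel_measurable lebesgue01"
    unfolding f' by measurable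
  have B: "B \<ge> 0"
    using g(2)[of 0] norm_ge_zero order_trans by blast
  have int: "integrable lebesgue01 (\<lambda>t. a n * circ t ^ n * g t)" for n
    by (rule leb.integrable_bounded[where B = "norm (a n) * B"])
       (use g in \<open>auto simp: norm_mult norm_power intro: mult_left_mono\<close>)
  have "(\<lambda>n. \<integral>t. a n * circ t ^ n * g t \<partial>lebesgue01) sums (\<integral>t. suminf (\<lambda>n. a n * circ t ^ n * g t) \<partial>lebesgue01)"
  proof (rule sums_integral[OF int])
    show "AE t in lebesgue01. summable (\<lambda>n. norm (a n * circ t ^ n * g t))"
      by (intro AE_I2) (auto simp: norm_mult norm_power intro: summable_mult2 summ)
    show "summable (\<lambda>n. \<integral>t. norm (a n * circ t ^ n * g t) \<partial>lebesgue01)"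
    proof (rule summable_comparison_test'[where N = 0])
      show "summable (\<lambda>n. norm (a n) * B)"
        by (intro summable_mult2 summ)
      show "norm (\<integral>t. norm (a n * circ t ^ n * g t) \<partial>lebesgue01) \<le> norm (a n) * B" for n
      proof -
        have "(\<integral>t. norm (a n * circ t ^ n * g t) \<partial>lebesgue01) \<le> (\<integral>t. norm (a n) * B \<partial>lebesgue01)"
          by (rule integral_mono[OF integrable_norm[OF int]])
             (use g in \<open>auto simp: norm_mult norm_power intro: mult_left_mono\<close>)
        then show ?thesis using leb.prob_space by simp
      qed
    qed
  qed
  moreover have "suminf (\<lambda>n. a n * circ t ^ n * g t) = f t * g t" for t
    using sums_mult2[OF f[of t], of "g t"] by (simp add: sums_iff)
  moreover have "(\<integral>t. a n * circ t ^ n * g t \<partial>lebesgue01) = a n * (\<integral>t. circ t ^ n * g t \<partial>lebesgue01)" for n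
    by (simp add: mult.assoc)
  ultimately show "(\<lambda>n. a n * (\<integral>t. circ t ^ n * g t \<partial>lebesgue01)) sums (\<integral>t. f t * g t \<partial>lebesgue01)"
    by simp
qed

text \<open>Integrating the series termwise twice proves the identity: against \<open>cnj (circ t ^ n)\<close> it
  returns the coefficient \<open>a n\<close>, and against \<open>cnj (f t)\<close> it then returns \<open>\<Sum>n. a n * cnj (a n)\<close>.\<close>

lemma parseval_circle:
  fixes a :: "nat \<Rightarrow> complex"
  assumes summ: "summable (\<lambda>n. norm (a n))" and f: "\<And>t. (\<lambda>n. a n * circ t ^ n) sums f t"
  shows "(\<lambda>n. (norm (a n))\<^sup>2) sums (\<integral>t. (norm (f t))\<^sup>2 \<partial>lebesgue01)"
proof -
  have meas[measurable]: "f \<in> borel_measurable lebesgue01"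
    by (rule measurable_trig_series[OF summ f, of "\<lambda>_. 0" 0]) auto
  have bd: "norm (f t) \<le> suminf (\<lambda>n. norm (a n))" for t
  proof -
    have "summable (\<lambda>n. norm (a n * circ t ^ n))"
      using summ by (simp add: norm_mult norm_power)
    from summable_norm[OF this] show ?thesis
      using f[of t] by (simp add: norm_mult norm_power sums_iff)
  qed
  have coeff: "(\<integral>t. f t * cnj (circ t ^ n) \<partial>lebesgue01) = a n" for n
  proof -
    have "(\<lambda>k. a k * (\<integral>t. circ t ^ k * cnj (circ t ^ n) \<partial>lebesgue01)) sums
        (\<integral>t. f t * cnj (circ t ^ n) \<partial>lebesgue01)"
      by (rule sums_integral_trig_series[OF summ f, where B = 1]) (auto simp: norm_power)
    moreover have "(\<lambda>k. a k * (\<integral>t. circ t ^ k * cnj (circ t ^ n) \<partial>lebesgue01)) sums a n"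
      unfolding integral_circ_power_cnj using sums_single[of n a] by (simp add: mult_delta_right eq_commute if_distrib cong: if_cong)
    ultimately show ?thesis by (rule sums_unique2)
  qed
  have "(\<lambda>n. a n * (\<integral>t. circ t ^ n * cnj (f t) \<partial>lebesgue01)) sums (\<integral>t. f t * cnj (f t) \<partial>lebesgue01)"
    by (rule sums_integral_trig_series[OF summ f]) (use bd in \<open>auto\<close>)
  moreover have "(\<integral>t. circ t ^ n * cnj (f t) \<partial>lebesgue01) = cnj (a n)" for n
    unfolding coeff[of n, symmetric] Bochner_Integration.integral_cnj[symmetric] by (simp add: mult_ac)
  ultimately have "(\<lambda>n. complex_of_real ((norm (a n))\<^sup>2)) sums (\<integral>t. complex_of_real ((norm (f t))\<^sup>2) \<partial>lebesgue01)"
    by (simp flip: complex_norm_square)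
  then show ?thesis
    by (simp only: integral_complex_of_real sums_of_real_iff)
qed

text \<open>Of the Taylor series of \<open>f\<close> only the constant term has a nonzero integral over a circle.\<close>

lemma mean_value_circle:
  assumes f: "f holomorphic_on ball 0 1" and r: "0 \<le> r" "r < 1"
  shows "(\<integral>t. f (complex_of_real r * circ t) \<partial>lebesgue01) = f 0"
proof -
  define a where "a n = (deriv ^^ n) f 0 / fact n" for n
  have s: "(\<lambda>n. a n * w ^ n) sums f w" if "norm w < 1" for w
    using holomorphic_power_series[OF f, of w] that by (simp add: a_def)
  \<comment> \<open>any radius strictly between \<open>r\<close> and 1 gives absolute convergence at \<open>r\<close>\<close>
  define q where "q = (1 + r) / 2"
  have q: "r < q" "q < 1" "0 < q" using r by (auto simp: q_def)
  have summ: "summable (\<lambda>n. norm (a n * of_real r ^ n))"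
    by (rule powser_insidea[where x = "of_real q"]) (use q r s[of "of_real q"] in \<open>auto simp: sums_iff\<close>)
  have "(\<lambda>n. (a n * of_real r ^ n) * (\<integral>t. circ t ^ n * 1 \<partial>lebesgue01)) sums
      (\<integral>t. f (of_real r * circ t) * 1 \<partial>lebesgue01)"
    by (rule sums_integral_trig_series[OF summ, where B = 1])
       (use s[of "of_real r * circ t" for t] r in
         \<open>auto simp: norm_mult power_mult_distrib mult.assoc\<close>)
  then have "(\<lambda>n. if n = 0 then a n else 0) sums (\<integral>t. f (of_real r * circ t) \<partial>lebesgue01)"
    by (simp add: integral_circ_power if_distrib cong: if_cong)
  then have "(\<integral>t. f (of_real r * circ t) \<partial>lebesgue01) = a 0"
    using sums_single[of 0 a] sums_unique2 by fastforce
  then show ?thesis by (simp add: a_def)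
qed

section \<open>Cauchy transforms and Poisson integrals\<close>

definition fourier :: "real measure \<Rightarrow> int \<Rightarrow> complex" where
  "fourier \<mu> j = (\<integral>y. circ y powi (- j) \<partial>\<mu>)"

text \<open>The Taylor coefficients of this function at 0 are the Fourier coefficients of \<open>\<mu>\<close> with index
  \<open>\<ge> 0\<close>, and \<open>2 * cauchy_transform \<mu> w - 1\<close> is the Herglotz function of \<open>\<mu>\<close>, whose real part is
  the Poisson integral of \<open>\<mu>\<close>.\<close>

definition cauchy_transform :: "real measure \<Rightarrow> complex \<Rightarrow> complex" where
  "cauchy_transform \<mu> w = (\<integral>y. 1 / (1 - cnj (circ y) * w) \<partial>\<mu>)"

text \<open>The Poisson kernel of the unit disc with pole at \<open>circ y\<close>.\<close>

definition poisson :: "real \<Rightarrow> complex \<Rightarrow> real" where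
  "poisson y w = (1 - (norm w)\<^sup>2) / (norm (1 - cnj (circ y) * w))\<^sup>2"

lemma poisson_nonneg: "norm w < 1 \<Longrightarrow> poisson y w \<ge> 0"
  by (simp add: poisson_def power_le_one)

lemma norm_one_minus_circ:
  assumes "norm w < 1"
  shows "1 - norm w \<le> norm (1 - cnj (circ y) * w)" "1 - cnj (circ y) * w \<noteq> 0"
proof -
  have "norm (1::complex) - norm (cnj (circ y) * w) \<le> norm (1 - cnj (circ y) * w)"
    by (rule norm_triangle_ineq2)
  then show *: "1 - norm w \<le> norm (1 - cnj (circ y) * w)" by (simp add: norm_mult)
  show "1 - cnj (circ y) * w \<noteq> 0"
    using * assms by auto
qed

lemma Re_inverse_one_minus:
  assumes "norm u < 1"
  shows "2 * Re (1 / (1 - u)) - 1 = (1 - (norm u)\<^sup>2) / (norm (1 - u))\<^sup>2"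
proof -
  have "u \<noteq> 1" using assms by auto
  then have nz: "(norm (1 - u))\<^sup>2 \<noteq> 0" by simp
  have "Re (1 / (1 - u)) = (1 - Re u) / (norm (1 - u))\<^sup>2"
    by (simp add: Re_divide cmod_power2)
  then have "2 * Re (1 / (1 - u)) - 1 = (2 * (1 - Re u) - (norm (1 - u))\<^sup>2) / (norm (1 - u))\<^sup>2"
    using nz by (simp add: field_simps)
  also have "2 * (1 - Re u) - (norm (1 - u))\<^sup>2 = 1 - (norm u)\<^sup>2"
    unfolding cmod_power2 by (simp add: power2_eq_square algebra_simps)
  finally show ?thesis .
qed

lemma poisson_eq_Re:
  assumes "norm w < 1"
  shows "poisson y w = 2 * Re (1 / (1 - cnj (circ y) * w)) - 1"
  using Re_inverse_one_minus[of "cnj (circ y) * w"] assms by (simp add: poisson_def norm_mult)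

lemma poisson_le: "norm w < 1 \<Longrightarrow> poisson y w \<le> 2 / (1 - norm w)"
proof -
  assume w: "norm w < 1"
  have "Re (1 / (1 - cnj (circ y) * w)) \<le> norm (1 / (1 - cnj (circ y) * w))"
    by (rule complex_Re_le_cmod)
  also have "\<dots> \<le> 1 / (1 - norm w)"
    using norm_one_minus_circ[OF w, of y] w by (simp add: norm_divide frac_le)
  finally show ?thesis
    unfolding poisson_eq_Re[OF w] by linarith
qed

lemma poisson_measurable [measurable]: "(\<lambda>y. poisson y w) \<in> borel_measurable borel"
  unfolding poisson_def by measurable

context circle_prob begin

lemma fourier_0 [simp]: "fourier \<mu> 0 = 1"
  using prob_space by (simp add: fourier_def)

lemma fourier_minus: "fourier \<mu> (- j) = cnj (fourier \<mu> j)"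
proof -
  have "cnj (circ y powi k) = circ y powi (- k)" for y k
    by (simp add: circ_powi cis_cnj)
  then show ?thesis
    unfolding fourier_def by (simp flip: Bochner_Integration.integral_cnj)
qed

lemma norm_fourier_le_1: "norm (fourier \<mu> j) \<le> 1"
proof -
  have "norm (fourier \<mu> j) \<le> (\<integral>y. norm (circ y powi (- j)) \<partial>\<mu>)"
    unfolding fourier_def by (rule integral_norm_bound)
  then show ?thesis using prob_space by (simp add: norm_power_int)
qed

lemma integrable_cauchy_kernel:
  assumes "norm w < 1"
  shows "integrable \<mu> (\<lambda>y. 1 / (1 - cnj (circ y) * w))"
proof (rule integrable_bounded[where B = "1 / (1 - norm w)"])
  show "norm (1 / (1 - cnj (circ y) * w)) \<le> 1 / (1 - norm w)" for y
    using norm_one_minus_circ[OF assms, of y] assms by (simp add: norm_divide frac_le)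
qed measurable

lemma cauchy_transform_sums:
  assumes "norm w < 1"
  shows "(\<lambda>n. fourier \<mu> (int n) * w ^ n) sums cauchy_transform \<mu> w"
proof -
  have int: "integrable \<mu> (\<lambda>y. (cnj (circ y) * w) ^ n)" for n
    by (rule integrable_bounded[where B = "norm w ^ n"]) (auto simp: norm_mult norm_power)
  have summ: "summable (\<lambda>n. norm w ^ n)"
    using assms by (simp add: summable_geometric)
  have "(\<lambda>n. \<integral>y. (cnj (circ y) * w) ^ n \<partial>\<mu>) sums (\<integral>y. suminf (\<lambda>n. (cnj (circ y) * w) ^ n) \<partial>\<mu>)"
    by (rule sums_integral[OF int]) (use summ prob_space in \<open>auto simp: norm_mult norm_power\<close>)
  moreover have "suminf (\<lambda>n. (cnj (circ y) * w) ^ n) = 1 / (1 - cnj (circ y) * w)" for y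
    using assms by (intro suminf_geometric) (simp add: norm_mult)
  moreover have "(\<integral>y. (cnj (circ y) * w) ^ n \<partial>\<mu>) = fourier \<mu> (int n) * w ^ n" for n
  proof -
    have "(cnj (circ y) * w) ^ n = circ y powi (- int n) * w ^ n" for y
      by (simp add: power_mult_distrib circ_powi_minus)
    then show ?thesis by (simp add: fourier_def)
  qed
  ultimately show ?thesis by (simp add: cauchy_transform_def)
qed

lemma cauchy_transform_0: "cauchy_transform \<mu> 0 = 1"
  using prob_space by (simp add: cauchy_transform_def)

lemma holomorphic_cauchy_transform: "cauchy_transform \<mu> holomorphic_on ball 0 1"
  by (rule power_series_holomorphic[where a = "\<lambda>n. fourier \<mu> (int n)"])
     (use cauchy_transform_sums in auto)

lemma poisson_measurable_circle [measurable]: "(\<lambda>y. poisson y w) \<in> borel_measurable \<mu>"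
  unfolding poisson_def by measurable

lemma integrable_poisson: "norm w < 1 \<Longrightarrow> integrable \<mu> (\<lambda>y. poisson y w)"
  by (rule integrable_bounded[where B = "2 / (1 - norm w)"]) (auto simp: poisson_nonneg poisson_le)

lemma integral_poisson:
  assumes "norm w < 1"
  shows "(\<integral>y. poisson y w \<partial>\<mu>) = 2 * Re (cauchy_transform \<mu> w) - 1"
proof -
  have "(\<integral>y. Re (1 / (1 - cnj (circ y) * w)) \<partial>\<mu>) = Re (cauchy_transform \<mu> w)"
    unfolding cauchy_transform_def by (rule integral_Re[OF integrable_cauchy_kernel[OF assms]])
  then show ?thesis
    using prob_space integrable_Re[OF integrable_cauchy_kernel[OF assms]]
    unfolding poisson_eq_Re[OF assms] by simp
qed

text \<open>Since the Poisson integral of \<open>\<mu>\<close> is nonnegative, the Cauchy transform keeps away from 0, and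
  its reciprocal is a bounded function on the disc.\<close>

lemma Re_cauchy_transform_ge:
  assumes "norm w < 1" shows "Re (cauchy_transform \<mu> w) \<ge> 1 / 2"
proof -
  have "0 \<le> (\<integral>y. poisson y w \<partial>\<mu>)"
    by (intro integral_nonneg_AE AE_I2) (use assms in \<open>simp add: poisson_nonneg\<close>)
  then show ?thesis using integral_poisson[OF assms] by simp
qed

lemma cauchy_transform_nonzero: "norm w < 1 \<Longrightarrow> cauchy_transform \<mu> w \<noteq> 0"
  using Re_cauchy_transform_ge[of w] by auto

end

text \<open>The kernel is a real part of a holomorphic function of \<open>w\<close>, so this is the mean value
  property.\<close>

lemma integral_poisson_circle:
  assumes "0 \<le> r" "r < 1"
  shows "(\<integral>t. poisson y (of_real r * circ t) \<partial>lebesgue01) = 1"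
proof -
  define f where "f w = 1 / (1 - cnj (circ y) * w)" for w
  have "f holomorphic_on ball 0 1"
    unfolding f_def using norm_one_minus_circ(2) by (intro holomorphic_intros) auto
  from mean_value_circle[OF this assms] have f: "(\<integral>t. f (of_real r * circ t) \<partial>lebesgue01) = 1"
    by (simp add: f_def)
  have meas: "(\<lambda>t. f (of_real r * circ t)) \<in> borel_measurable lebesgue01"
    unfolding f_def by measurable
  have int: "integrable lebesgue01 (\<lambda>t. f (of_real r * circ t))"
  proof (rule leb.integrable_bounded[OF meas, where B = "1 / (1 - r)"])
    show "norm (f (of_real r * circ t)) \<le> 1 / (1 - r)" for t
      using norm_one_minus_circ[of "of_real r * circ t" y] assms
      by (simp add: f_def norm_divide frac_le norm_mult)
  qed
  have "poisson y (of_real r * circ t) = 2 * Re (f (of_real r * circ t)) - 1" for t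
    unfolding f_def using assms by (intro poisson_eq_Re) (simp add: norm_mult)
  then have "(\<integral>t. poisson y (of_real r * circ t) \<partial>lebesgue01)
      = 2 * (\<integral>t. Re (f (of_real r * circ t)) \<partial>lebesgue01) - 1"
    using integrable_Re[OF int] leb.prob_space by simp
  then show ?thesis
    using f integral_Re[OF int] by simp
qed

text \<open>With \<open>v = cnj (circ y) * circ t\<close>, a point of modulus 1, one has
  \<open>r * \<bar>1 - v\<bar>\<^sup>2 = \<bar>1 - r * v\<bar>\<^sup>2 - (1 - r)\<^sup>2\<close>; hence the denominator of the kernel absorbs the squared
  distance.  This is the only localisation property of the Poisson kernel that is used.\<close>

lemma poisson_times_dist_sq_le:
  assumes "0 < r" "r < 1"
  shows "poisson y (of_real r * circ t) * (norm (circ t - circ y))\<^sup>2 \<le> (1 - r\<^sup>2) / r"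
proof -
  define v where "v = cnj (circ y) * circ t"
  have v: "norm v = 1" by (simp add: v_def norm_mult)
  have sq: "(Re v)\<^sup>2 + (Im v)\<^sup>2 = 1"
    using v by (simp flip: cmod_power2)
  have d: "norm (circ t - circ y) = norm (1 - v)"
  proof -
    have "cnj (circ y) * (circ t - circ y) = v - 1"
      by (simp add: v_def right_diff_distrib)
    then have "norm (cnj (circ y) * (circ t - circ y)) = norm (v - 1)" by simp
    then show ?thesis by (simp add: norm_mult norm_minus_commute)
  qed
  have "r * (norm (1 - v))\<^sup>2 = (norm (1 - of_real r * v))\<^sup>2 - (1 - r)\<^sup>2"
  proof -
    have "r * (norm (1 - v))\<^sup>2 = r * (1 + ((Re v)\<^sup>2 + (Im v)\<^sup>2) - 2 * Re v)"
      unfolding cmod_power2 by (simp add: power2_eq_square algebra_simps)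
    moreover have "(norm (1 - of_real r * v))\<^sup>2 = 1 + r\<^sup>2 * ((Re v)\<^sup>2 + (Im v)\<^sup>2) - 2 * r * Re v"
      unfolding cmod_power2 by (simp add: power2_eq_square algebra_simps)
    ultimately show ?thesis unfolding sq by (simp add: power2_eq_square algebra_simps)
  qed
  then have le: "r * (norm (1 - v))\<^sup>2 \<le> (norm (1 - of_real r * v))\<^sup>2" by simp
  have nz: "norm (1 - of_real r * v) > 0"
    using norm_one_minus_circ[of "of_real r * circ t" y] assms
    by (simp add: v_def norm_mult mult_ac)
  have "(norm (1 - v))\<^sup>2 / (norm (1 - of_real r * v))\<^sup>2 \<le> 1 / r"
    using le nz assms by (simp add: field_simps)
  then have "(1 - r\<^sup>2) * ((norm (1 - v))\<^sup>2 / (norm (1 - of_real r * v))\<^sup>2) \<le> (1 - r\<^sup>2) * (1 / r)"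
    using assms by (intro mult_left_mono) (auto simp: power_le_one)
  moreover have "poisson y (of_real r * circ t) = (1 - r\<^sup>2) / (norm (1 - of_real r * v))\<^sup>2"
    using assms by (simp add: poisson_def v_def norm_mult mult_ac)
  ultimately show ?thesis unfolding d by simp
qed

lemma poisson_measurable_pt [measurable]:
  "(\<lambda>t. poisson y (of_real r * circ t)) \<in> borel_measurable lebesgue01"
  unfolding poisson_def by measurable

lemma integrable_poisson_circle:
  assumes "0 \<le> r" "r < 1" "g \<in> borel_measurable lebesgue01" "\<And>t. \<bar>g t\<bar> \<le> B"
  shows "integrable lebesgue01 (\<lambda>t. poisson y (of_real r * circ t) * g t)"
proof (rule leb.integrable_bounded[where B = "2 / (1 - r) * B"])
  show "norm (poisson y (of_real r * circ t) * g t) \<le> 2 / (1 - r) * B" for t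
  proof -
    have "norm (of_real r * circ t) = r" using assms by (simp add: norm_mult)
    then have "0 \<le> poisson y (of_real r * circ t)" "poisson y (of_real r * circ t) \<le> 2 / (1 - r)"
      using poisson_le[of "of_real r * circ t" y] poisson_nonneg[of "of_real r * circ t" y] assms by auto
    then show ?thesis
      using assms(2) assms(4)[of t] unfolding real_norm_def abs_mult by (intro mult_mono) auto
  qed
qed (use assms in measurable)

text \<open>The pointwise bound on the second moment of the kernel gives, through the inequality of the
  arithmetic and geometric means, a bound on its first moment that is uniform in \<open>y\<close>.  With an
  explicit rate, limits \<open>r \<longlongrightarrow> 1\<close> become elementary estimates.\<close>

lemma poisson_integral_lipschitz:
  assumes r: "0 < r" "r < 1" and L: "L \<ge> 0"
    and g: "g \<in> borel_measurable lebesgue01" "\<And>t. \<bar>g t\<bar> \<le> B"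
    and lip: "\<And>s t. \<bar>g t - g s\<bar> \<le> L * norm (circ t - circ s)"
  shows "\<bar>(\<integral>t. poisson y (of_real r * circ t) * g t \<partial>lebesgue01) - g y\<bar> \<le> L * sqrt ((1 - r\<^sup>2) / r)"
proof -
  \<comment> \<open>the value that balances the two terms of \<open>2 * \<eta> * d \<le> \<eta>\<^sup>2 + d\<^sup>2\<close> below\<close>
  define \<eta> where "\<eta> = sqrt ((1 - r\<^sup>2) / r)"
  have r2: "r\<^sup>2 < 1" using r by (simp add: power_less_one_iff)
  have \<eta>: "\<eta> > 0" "\<eta>\<^sup>2 = (1 - r\<^sup>2) / r" using r r2 by (auto simp: \<eta>_def)
  let ?P = "\<lambda>t. poisson y (of_real r * circ t)"
  have Pint: "integrable lebesgue01 ?P"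
    using integrable_poisson_circle[of r "\<lambda>_. 1" 1 y] r by simp
  have P0: "?P t \<ge> 0" for t using r by (intro poisson_nonneg) (simp add: norm_mult)
  have "(\<integral>t. ?P t * g t \<partial>lebesgue01) - g y = (\<integral>t. ?P t * (g t - g y) \<partial>lebesgue01)"
    using integrable_poisson_circle[OF _ _ g, of r y] r Pint integral_poisson_circle[of r y]
    by (simp add: right_diff_distrib)
  also have "\<bar>\<dots>\<bar> \<le> (\<integral>t. L * (\<eta> * ?P t / 2 + \<eta> / 2) \<partial>lebesgue01)"
  proof (rule integral_abs_bound[THEN order_trans], rule integral_mono)
    show "integrable lebesgue01 (\<lambda>t. \<bar>?P t * (g t - g y)\<bar>)"
    proof (intro integrable_abs integrable_poisson_circle[where B = "2 * B"])
      show "\<bar>g t - g y\<bar> \<le> 2 * B" for t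
        using g(2)[of t] g(2)[of y] by linarith
    qed (use r g(1) in auto)
    show "integrable lebesgue01 (\<lambda>t. L * (\<eta> * ?P t / 2 + \<eta> / 2))"
      using Pint by simp
    show "\<bar>?P t * (g t - g y)\<bar> \<le> L * (\<eta> * ?P t / 2 + \<eta> / 2)" for t
    proof -
      define d where "d = norm (circ t - circ y)"
      have "2 * \<eta> * d \<le> \<eta>\<^sup>2 + d\<^sup>2"
        using sum_squares_bound[of \<eta> d] by simp
      then have "?P t * (2 * \<eta> * d) \<le> ?P t * (\<eta>\<^sup>2 + d\<^sup>2)"
        using P0 by (rule mult_left_mono)
      also have "\<dots> \<le> ?P t * \<eta>\<^sup>2 + \<eta>\<^sup>2"
        using poisson_times_dist_sq_le[OF r, of y t] by (simp add: \<eta>(2) d_def distrib_left)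
      finally have "2 * \<eta> * (?P t * d) \<le> 2 * \<eta> * (\<eta> * ?P t / 2 + \<eta> / 2)"
        by (simp add: power2_eq_square algebra_simps)
      then have Pd: "?P t * d \<le> \<eta> * ?P t / 2 + \<eta> / 2"
        using \<eta> by simp
      have "\<bar>?P t * (g t - g y)\<bar> \<le> ?P t * (L * d)"
        using lip[of t y] P0[of t] by (simp add: abs_mult d_def mult_left_mono)
      also have "\<dots> \<le> L * (\<eta> * ?P t / 2 + \<eta> / 2)"
        using mult_left_mono[OF Pd L] by (simp add: algebra_simps)
      finally show ?thesis .
    qed
  qed
  also have "\<dots> = L * \<eta>"
    using Pint integral_poisson_circle[of r y] r leb.prob_space by simp
  finally show ?thesis by (simp add: \<eta>_def)
qed

section \<open>Kaczmarz coefficients of a single measure\<close>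

text \<open>The coefficient \<open>\<langle>e\<^sub>m - f\<^bsub>n-1\<^esub>, e\<^sub>n\<rangle>\<close> of the algorithm applied to \<open>e\<^sub>m\<close> in \<open>L\<^sup>2(\<mu>)\<close>; the inner
  product \<open>\<langle>e\<^sub>k, e\<^sub>n\<rangle>\<close> is \<open>fourier \<mu> (n - k)\<close>.\<close>

fun kaczmarz_coeff :: "real measure \<Rightarrow> nat \<Rightarrow> nat \<Rightarrow> complex" where
  "kaczmarz_coeff \<mu> m n = fourier \<mu> (int n - int m)
     - (\<Sum>k<n. kaczmarz_coeff \<mu> m k * fourier \<mu> (int n - int k))"

declare kaczmarz_coeff.simps [simp del]

text \<open>The error \<open>e\<^sub>m - f\<^bsub>N-1\<^esub>\<close>, shifted by one so that \<open>N = 0\<close> gives \<open>e\<^sub>m\<close> itself.\<close>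

definition kaczmarz_residual :: "real measure \<Rightarrow> nat \<Rightarrow> nat \<Rightarrow> real \<Rightarrow> complex" where
  "kaczmarz_residual \<mu> m N y = circ y ^ m - (\<Sum>k<N. kaczmarz_coeff \<mu> m k * circ y ^ k)"

text \<open>The Taylor coefficients of \<open>p * (1 - 1/C)\<close>, where \<open>p\<close> is the polynomial \<open>neg_fourier_poly\<close> and
  \<open>C\<close> the Cauchy transform, see \<open>schur_sums\<close>.  In terms of the Herglotz function \<open>F = 2 * C - 1\<close>
  the factor \<open>1 - 1/C\<close> is \<open>(F - 1) / (F + 1)\<close>, which maps the disc into itself.\<close>

definition schur_coeff :: "real measure \<Rightarrow> nat \<Rightarrow> nat \<Rightarrow> complex" where
  "schur_coeff \<mu> m n = (if n \<le> m then fourier \<mu> (int n - int m) else 0) - kaczmarz_coeff \<mu> m n"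

text \<open>The Fourier coefficients of \<open>\<mu>\<close> with index from \<open>-m\<close> to \<open>-1\<close>, moved to the exponents
  \<open>0, \<dots>, m - 1\<close>.\<close>

definition neg_fourier_poly :: "real measure \<Rightarrow> nat \<Rightarrow> complex \<Rightarrow> complex" where
  "neg_fourier_poly \<mu> m w = (\<Sum>n<m. fourier \<mu> (int n - int m) * w ^ n)"

text \<open>This is \<open>\<bar>p\<bar>\<^sup>2 - \<bar>p * (1 - 1/C)\<bar>\<^sup>2\<close>, see \<open>defect_eq\<close>, written so that the Poisson integral
  \<open>2 * Re C - 1\<close> of \<open>\<mu>\<close> appears as a factor.\<close>

definition defect :: "real measure \<Rightarrow> nat \<Rightarrow> complex \<Rightarrow> real" where
  "defect \<mu> m w = (norm (neg_fourier_poly \<mu> m w))\<^sup>2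
     * (2 * Re (cauchy_transform \<mu> w) - 1) / (norm (cauchy_transform \<mu> w))\<^sup>2"

lemma sum_lessThan_if_less:
  fixes f :: "nat \<Rightarrow> 'b::comm_monoid_add"
  assumes "m \<le> N"
  shows "(\<Sum>n<N. if n < m then f n else 0) = (\<Sum>n<m. f n)"
proof -
  have "{..<N} \<inter> {n. n < m} = {..<m}" using assms by auto
  then show ?thesis by (simp add: sum.If_cases)
qed

context circle_prob begin

lemma kaczmarz_convolution:
  "(\<Sum>k\<le>n. kaczmarz_coeff \<mu> m k * fourier \<mu> (int n - int k)) = fourier \<mu> (int n - int m)"
proof -
  have "{..n} = insert n {..<n}" by auto
  then show ?thesis
    using kaczmarz_coeff.simps[of \<mu> m n] by simp
qed

lemma integral_circ_power_mult_cnj: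
  "(\<integral>y. circ y ^ k * cnj (circ y ^ n) \<partial>\<mu>) = fourier \<mu> (int n - int k)"
proof -
  have "circ y ^ k * cnj (circ y ^ n) = circ y powi (- (int n - int k))" for y
    by (simp add: power_int_diff divide_inverse inverse_circ flip: power_inverse)
  then show ?thesis by (simp add: fourier_def)
qed

lemma residual_measurable [measurable]: "kaczmarz_residual \<mu> m N \<in> borel_measurable \<mu>"
  unfolding kaczmarz_residual_def[abs_def] by measurable

lemma residual_bounded: "norm (kaczmarz_residual \<mu> m N y) \<le> 1 + (\<Sum>k<N. norm (kaczmarz_coeff \<mu> m k))"
proof -
  have "norm (\<Sum>k<N. kaczmarz_coeff \<mu> m k * circ y ^ k) \<le> (\<Sum>k<N. norm (kaczmarz_coeff \<mu> m k))"
    by (rule order_trans[OF norm_sum]) (simp add: norm_mult norm_power)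
  then show ?thesis
    unfolding kaczmarz_residual_def
    by (intro order_trans[OF norm_triangle_ineq4]) (simp add: norm_power)
qed

lemma residual_Suc:
  "kaczmarz_residual \<mu> m (Suc N) y = kaczmarz_residual \<mu> m N y - kaczmarz_coeff \<mu> m N * circ y ^ N"
  by (simp add: kaczmarz_residual_def)

lemma integral_residual_cnj:
  "(\<integral>y. kaczmarz_residual \<mu> m N y * cnj (circ y ^ N) \<partial>\<mu>) = kaczmarz_coeff \<mu> m N"
proof -
  have int: "integrable \<mu> (\<lambda>y. circ y ^ k * cnj (circ y ^ N))" for k
    by (rule integrable_bounded[where B = 1]) (auto simp: norm_mult norm_power)
  have "(\<integral>y. kaczmarz_residual \<mu> m N y * cnj (circ y ^ N) \<partial>\<mu>)
      = (\<integral>y. circ y ^ m * cnj (circ y ^ N)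
           - (\<Sum>k<N. kaczmarz_coeff \<mu> m k * (circ y ^ k * cnj (circ y ^ N))) \<partial>\<mu>)"
    by (simp add: kaczmarz_residual_def left_diff_distrib sum_distrib_right mult.assoc)
  also have "\<dots> = (\<integral>y. circ y ^ m * cnj (circ y ^ N) \<partial>\<mu>)
      - (\<Sum>k<N. kaczmarz_coeff \<mu> m k * (\<integral>y. circ y ^ k * cnj (circ y ^ N) \<partial>\<mu>))"
    using int by (subst Bochner_Integration.integral_diff) (auto simp del: complex_cnj_power)
  also have "\<dots> = kaczmarz_coeff \<mu> m N"
    unfolding integral_circ_power_mult_cnj by (simp add: kaczmarz_coeff.simps[of \<mu> m N])
  finally show ?thesis .
qed

text \<open>Step \<open>N\<close> removes from the error its component along the unit vector \<open>e\<^sub>N\<close>, so the squared norm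
  drops by the square of the coefficient.\<close>

lemma integral_residual_sq:
  "(\<integral>y. (norm (kaczmarz_residual \<mu> m N y))\<^sup>2 \<partial>\<mu>) = 1 - (\<Sum>k<N. (norm (kaczmarz_coeff \<mu> m k))\<^sup>2)"
proof (induction N)
  case 0
  show ?case using prob_space by (simp add: kaczmarz_residual_def norm_power)
next
  case (Suc N)
  let ?R = "kaczmarz_residual \<mu> m N" and ?d = "kaczmarz_coeff \<mu> m N"
  define B where "B = 1 + (\<Sum>k<N. norm (kaczmarz_coeff \<mu> m k))"
  have intR: "integrable \<mu> (\<lambda>y. (norm (?R y))\<^sup>2)"
    by (rule integrable_bounded[where B = "B\<^sup>2"])
       (use residual_bounded in \<open>auto simp: B_def intro: power_mono\<close>)
  have intc: "integrable \<mu> (\<lambda>y. ?R y * cnj (circ y ^ N))"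
    by (rule integrable_bounded[where B = B])
       (use residual_bounded in \<open>auto simp: B_def norm_mult norm_power\<close>)
  have pt: "(norm (kaczmarz_residual \<mu> m (Suc N) y))\<^sup>2
      = (norm (?R y))\<^sup>2 - 2 * Re (cnj ?d * (?R y * cnj (circ y ^ N))) + (norm ?d)\<^sup>2" for y
  proof -
    have "(norm (a - b))\<^sup>2 = (norm a)\<^sup>2 - 2 * Re (a * cnj b) + (norm b)\<^sup>2" for a b :: complex
      unfolding cmod_power2 by (simp add: power2_eq_square algebra_simps)
    from this[of "?R y" "?d * circ y ^ N"] show ?thesis
      by (simp add: residual_Suc norm_mult norm_power mult_ac)
  qed
  have "(\<integral>y. (norm (kaczmarz_residual \<mu> m (Suc N) y))\<^sup>2 \<partial>\<mu>)
      = (\<integral>y. (norm (?R y))\<^sup>2 \<partial>\<mu>) - 2 * (\<integral>y. Re (cnj ?d * (?R y * cnj (circ y ^ N))) \<partial>\<mu>) + (norm ?d)\<^sup>2"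
  proof -
    have "integrable \<mu> (\<lambda>y. 2 * Re (cnj ?d * (?R y * cnj (circ y ^ N))))"
      by (intro integrable_mult_right integrable_Re intc)
    then show ?thesis
      unfolding pt using intR prob_space
      by (subst Bochner_Integration.integral_add Bochner_Integration.integral_diff;
          simp del: complex_cnj_power times_complex.sel)+
  qed
  also have "(\<integral>y. Re (cnj ?d * (?R y * cnj (circ y ^ N))) \<partial>\<mu>) = Re (cnj ?d * ?d)"
    by (subst integral_Re) (use intc integral_residual_cnj in \<open>auto simp del: complex_cnj_power\<close>)
  also have "Re (cnj ?d * ?d) = (norm ?d)\<^sup>2"
    unfolding cmod_power2 by (simp add: power2_eq_square)
  finally show ?case using Suc by simp
qed

lemma sum_norm_coeff_le_1: "(\<Sum>k<N. (norm (kaczmarz_coeff \<mu> m k))\<^sup>2) \<le> 1"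
proof -
  have "0 \<le> (\<integral>y. (norm (kaczmarz_residual \<mu> m N y))\<^sup>2 \<partial>\<mu>)" by simp
  then show ?thesis unfolding integral_residual_sq by simp
qed

lemma norm_coeff_le_1: "norm (kaczmarz_coeff \<mu> m k) \<le> 1"
proof -
  have "(norm (kaczmarz_coeff \<mu> m k))\<^sup>2 \<le> (\<Sum>j<Suc k. (norm (kaczmarz_coeff \<mu> m j))\<^sup>2)"
    by (rule member_le_sum) auto
  then have "(norm (kaczmarz_coeff \<mu> m k))\<^sup>2 \<le> 1"
    using sum_norm_coeff_le_1[of m "Suc k"] by linarith
  then show ?thesis by (simp add: power_le_one_iff abs_square_le_1)
qed

text \<open>With \<open>q\<^sub>n = fourier \<mu> (n - m)\<close> for \<open>n \<le> m\<close>, expand \<open>\<bar>q\<^sub>n - d\<^sub>n\<bar>\<^sup>2\<close> and sum.  The cross term is the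
  value at \<open>n = m\<close> of the convolution that defines the coefficients \<open>d\<^sub>n\<close>, hence equals
  \<open>fourier \<mu> 0 = 1\<close>.\<close>

lemma residual_eq_schur:
  assumes "m < N"
  shows "1 - (\<Sum>k<N. (norm (kaczmarz_coeff \<mu> m k))\<^sup>2)
    = (\<Sum>n<m. (norm (fourier \<mu> (int n - int m)))\<^sup>2) - (\<Sum>n<N. (norm (schur_coeff \<mu> m n))\<^sup>2)"
proof -
  let ?d = "kaczmarz_coeff \<mu> m" and ?b = "\<lambda>n. fourier \<mu> (int n - int m)"
  let ?q = "\<lambda>n. if n < Suc m then ?b n else 0"
  have pt: "(norm (?q n - ?d n))\<^sup>2
      = (if n < Suc m then (norm (?b n))\<^sup>2 else 0) + (norm (?d n))\<^sup>2
        - 2 * (if n < Suc m then Re (?d n * cnj (?b n)) else 0)" for n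
    unfolding cmod_power2 by (simp add: power2_eq_square algebra_simps)
  have "(\<Sum>n<Suc m. Re (?d n * cnj (?b n))) = Re (\<Sum>n\<le>m. ?d n * fourier \<mu> (int m - int n))"
    by (simp add: lessThan_Suc_atMost fourier_minus[symmetric])
  also have "\<dots> = 1"
    unfolding kaczmarz_convolution by simp
  finally have cross: "(\<Sum>n<Suc m. Re (?d n * cnj (?b n))) = 1" .
  have "(\<Sum>n<N. (norm (?q n - ?d n))\<^sup>2)
      = (\<Sum>n<Suc m. (norm (?b n))\<^sup>2) + (\<Sum>n<N. (norm (?d n))\<^sup>2) - 2 * (\<Sum>n<Suc m. Re (?d n * cnj (?b n)))"
    unfolding pt using assms
    by (simp only: sum.distrib sum_subtractf sum_distrib_left[symmetric])
       (simp only: sum_lessThan_if_less Suc_leI)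
  then have "(\<Sum>n<N. (norm (?q n - ?d n))\<^sup>2)
      = (\<Sum>n<m. (norm (?b n))\<^sup>2) + (\<Sum>n<N. (norm (?d n))\<^sup>2) - 1"
    unfolding cross by simp
  then show ?thesis by (simp only: schur_coeff_def less_Suc_eq_le)
qed

lemma norm_schur_coeff_le: "norm (schur_coeff \<mu> m n) \<le> 2"
proof -
  have "norm (schur_coeff \<mu> m n) \<le> norm (if n \<le> m then fourier \<mu> (int n - int m) else 0) + norm (kaczmarz_coeff \<mu> m n)"
    unfolding schur_coeff_def by (rule norm_triangle_ineq4)
  also have "\<dots> \<le> 1 + 1"
    using norm_fourier_le_1 norm_coeff_le_1 by (intro add_mono) auto
  finally show ?thesis by simp
qed

lemma summable_bounded_coeffs:
  fixes a :: "nat \<Rightarrow> complex"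
  assumes "\<And>n. norm (a n) \<le> B" "norm w < 1"
  shows "summable (\<lambda>n. norm (a n * w ^ n))"
proof (rule summable_comparison_test'[where N = 0])
  show "summable (\<lambda>n. B * norm w ^ n)"
    using assms by (intro summable_mult summable_geometric) auto
  show "norm (norm (a n * w ^ n)) \<le> B * norm w ^ n" for n
    using assms(1)[of n] by (simp add: norm_mult norm_power mult_right_mono)
qed

text \<open>Let \<open>h\<close> be the power series with coefficients \<open>d\<^sub>n\<close>.  The convolution identity says that
  \<open>h * C\<close> has the coefficients \<open>fourier \<mu> (n - m)\<close>, that is \<open>h * C = w ^ m * C + p\<close>.  Dividing by
  \<open>C\<close> gives \<open>p + w ^ m - h = p * (1 - 1/C)\<close>.\<close>

lemma schur_sums:
  assumes w: "norm w < 1"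
  shows "(\<lambda>n. schur_coeff \<mu> m n * w ^ n) sums
    (neg_fourier_poly \<mu> m w * (1 - 1 / cauchy_transform \<mu> w))"
proof -
  let ?d = "kaczmarz_coeff \<mu> m" and ?b = "\<lambda>n. fourier \<mu> (int n)"
  let ?C = "cauchy_transform \<mu> w" and ?p = "neg_fourier_poly \<mu> m w"
  have Cs: "(\<lambda>n. ?b n * w ^ n) sums ?C" by (rule cauchy_transform_sums[OF w])
  have nd: "summable (\<lambda>n. norm (?d n * w ^ n))"
    by (rule summable_bounded_coeffs[OF norm_coeff_le_1 w])
  have nb: "summable (\<lambda>n. norm (?b n * w ^ n))"
    by (rule summable_bounded_coeffs[OF norm_fourier_le_1 w])
  define h where "h = suminf (\<lambda>n. ?d n * w ^ n)"
  have hs: "(\<lambda>n. ?d n * w ^ n) sums h"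
    using summable_norm_cancel[OF nd] unfolding h_def by (rule summable_sums)
  have "(\<lambda>n. \<Sum>k\<le>n. (?d k * w ^ k) * (?b (n - k) * w ^ (n - k))) sums (h * ?C)"
    using Cauchy_product_sums[OF nd nb] Cs unfolding h_def by (simp add: sums_iff)
  moreover have "(\<Sum>k\<le>n. (?d k * w ^ k) * (?b (n - k) * w ^ (n - k))) = fourier \<mu> (int n - int m) * w ^ n" for n
  proof -
    have "(\<Sum>k\<le>n. (?d k * w ^ k) * (?b (n - k) * w ^ (n - k)))
        = (\<Sum>k\<le>n. ?d k * fourier \<mu> (int n - int k) * w ^ n)"
      by (rule sum.cong) (auto simp: of_nat_diff mult_ac simp flip: power_add)
    then show ?thesis by (simp add: kaczmarz_convolution flip: sum_distrib_right)
  qed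
  ultimately have hC: "(\<lambda>n. fourier \<mu> (int n - int m) * w ^ n) sums (h * ?C)" by simp
  have "(\<lambda>n. fourier \<mu> (int (n + m) - int m) * w ^ (n + m)) sums (w ^ m * ?C)"
    using sums_mult[OF Cs, of "w ^ m"] by (simp add: power_add mult_ac)
  then have "(\<lambda>n. fourier \<mu> (int n - int m) * w ^ n) sums (w ^ m * ?C + ?p)"
    unfolding neg_fourier_poly_def
    using sums_iff_shift[of "\<lambda>n. fourier \<mu> (int n - int m) * w ^ n" m "w ^ m * ?C"] by simp
  with hC have "h * ?C = w ^ m * ?C + ?p" by (rule sums_unique2)
  then have h: "h = w ^ m + ?p / ?C"
    using cauchy_transform_nonzero[OF w] by (simp add: field_simps)
  have "(\<lambda>n. (if n < Suc m then fourier \<mu> (int n - int m) * w ^ n else 0)) sums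
      (\<Sum>n<Suc m. fourier \<mu> (int n - int m) * w ^ n)"
    using sums_If_finite_set[of "{..<Suc m}" "\<lambda>n. fourier \<mu> (int n - int m) * w ^ n"] by simp
  from sums_diff[OF this hs]
  have "(\<lambda>n. schur_coeff \<mu> m n * w ^ n) sums (?p + w ^ m - h)"
    by (simp add: schur_coeff_def neg_fourier_poly_def less_Suc_eq_le left_diff_distrib if_distrib[of "\<lambda>x. x * _"] cong: if_cong)
  also have "?p + w ^ m - h = ?p * (1 - 1 / ?C)"
    by (simp add: h algebra_simps)
  finally show ?thesis .
qed

lemma defect_eq:
  assumes w: "norm w < 1"
  shows "defect \<mu> m w = (norm (neg_fourier_poly \<mu> m w))\<^sup>2
     - (norm (neg_fourier_poly \<mu> m w * (1 - 1 / cauchy_transform \<mu> w)))\<^sup>2"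
proof -
  let ?C = "cauchy_transform \<mu> w"
  have nz: "?C \<noteq> 0" by (rule cauchy_transform_nonzero[OF w])
  have "(norm (1 - 1 / ?C))\<^sup>2 * (norm ?C)\<^sup>2 = (norm (?C - 1))\<^sup>2"
  proof -
    have "(1 - 1 / ?C) * ?C = ?C - 1" using nz by (simp add: left_diff_distrib)
    then show ?thesis by (simp flip: norm_mult power_mult_distrib)
  qed
  also have "\<dots> = (norm ?C)\<^sup>2 - (2 * Re ?C - 1)"
    unfolding cmod_power2 by (simp add: power2_eq_square algebra_simps)
  finally have "(2 * Re ?C - 1) / (norm ?C)\<^sup>2 = 1 - (norm (1 - 1 / ?C))\<^sup>2"
    using nz by (simp add: field_simps)
  then have "defect \<mu> m w = (norm (neg_fourier_poly \<mu> m w))\<^sup>2 * (1 - (norm (1 - 1 / ?C))\<^sup>2)"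
    by (simp only: defect_def times_divide_eq_right[symmetric])
  then show ?thesis
    unfolding norm_mult[of "neg_fourier_poly \<mu> m w"] power_mult_distrib by (simp add: algebra_simps)
qed

text \<open>Parseval's identity on the circle of radius \<open>r\<close>, for \<open>p\<close> and for \<open>p * (1 - 1/C)\<close>.\<close>

lemma integral_defect:
  assumes r: "0 \<le> r" "r < 1"
  shows "(\<lambda>n. ((if n < m then (norm (fourier \<mu> (int n - int m)))\<^sup>2 else 0) - (norm (schur_coeff \<mu> m n))\<^sup>2) * r ^ (2 * n))
    sums (\<integral>t. defect \<mu> m (of_real r * circ t) \<partial>lebesgue01)"
proof -
  let ?w = "\<lambda>t. of_real r * circ t"
  let ?s = "\<lambda>n. schur_coeff \<mu> m n * of_real r ^ n"
  let ?p = "\<lambda>n. (if n < m then fourier \<mu> (int n - int m) else 0) * of_real r ^ n"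
  let ?S = "\<lambda>t. neg_fourier_poly \<mu> m (?w t) * (1 - 1 / cauchy_transform \<mu> (?w t))"
  let ?P = "\<lambda>t. neg_fourier_poly \<mu> m (?w t)"
  have w: "norm (?w t) < 1" for t using r by (simp add: norm_mult)
  have rr: "norm (of_real r :: complex) < 1" using r by simp
  have s1: "summable (\<lambda>n. norm (?s n))"
    by (rule summable_bounded_coeffs[OF norm_schur_coeff_le rr])
  have s2: "(\<lambda>n. ?s n * circ t ^ n) sums ?S t" for t
    using schur_sums[OF w, of m t] by (simp add: power_mult_distrib mult.assoc)
  have p1: "summable (\<lambda>n. norm (?p n))"
    by (rule summable_bounded_coeffs[OF _ rr, where B = 1]) (simp add: norm_fourier_le_1)
  have p2: "(\<lambda>n. ?p n * circ t ^ n) sums ?P t" for t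
    using sums_If_finite_set[of "{..<m}" "\<lambda>n. fourier \<mu> (int n - int m) * ?w t ^ n"]
    by (simp add: neg_fourier_poly_def power_mult_distrib mult.assoc if_distrib[of "\<lambda>x. x * _"] cong: if_cong)
  have bnd: "norm (f t) \<le> suminf (\<lambda>n. norm (a n))"
    if "summable (\<lambda>n. norm (a n))" "\<And>t. (\<lambda>n. a n * circ t ^ n) sums f t" for a f and t :: real
  proof -
    have "summable (\<lambda>n. norm (a n * circ t ^ n))" using that(1) by (simp add: norm_mult norm_power)
    from summable_norm[OF this] show ?thesis
      using that(2)[of t] by (simp add: norm_mult norm_power sums_iff)
  qed
  have int: "integrable lebesgue01 (\<lambda>t. (norm (f t))\<^sup>2)"
    if "summable (\<lambda>n. norm (a n))" "\<And>t. (\<lambda>n. a n * circ t ^ n) sums f t" for a f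
  proof (rule leb.integrable_bounded)
    show "(\<lambda>t. (norm (f t))\<^sup>2) \<in> borel_measurable lebesgue01"
      using measurable_trig_series[OF that, of "\<lambda>_. 0" 0] by simp
    show "norm ((norm (f t))\<^sup>2) \<le> (suminf (\<lambda>n. norm (a n)))\<^sup>2" for t
      using bnd[OF that, of t] by (auto intro: power_mono)
  qed
  have "(\<integral>t. defect \<mu> m (?w t) \<partial>lebesgue01) = (\<integral>t. (norm (?P t))\<^sup>2 - (norm (?S t))\<^sup>2 \<partial>lebesgue01)"
    using defect_eq[OF w] by simp
  also have "\<dots> = (\<integral>t. (norm (?P t))\<^sup>2 \<partial>lebesgue01) - (\<integral>t. (norm (?S t))\<^sup>2 \<partial>lebesgue01)"
    by (rule Bochner_Integration.integral_diff[OF int[OF p1 p2] int[OF s1 s2]])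
  finally have eq: "(\<integral>t. defect \<mu> m (?w t) \<partial>lebesgue01)
      = (\<integral>t. (norm (?P t))\<^sup>2 \<partial>lebesgue01) - (\<integral>t. (norm (?S t))\<^sup>2 \<partial>lebesgue01)" .
  have "(\<lambda>n. (norm (?p n))\<^sup>2 - (norm (?s n))\<^sup>2) sums (\<integral>t. defect \<mu> m (?w t) \<partial>lebesgue01)"
    unfolding eq by (rule sums_diff[OF parseval_circle[OF p1 p2] parseval_circle[OF s1 s2]])
  moreover have "(norm (?p n))\<^sup>2 - (norm (?s n))\<^sup>2
     = ((if n < m then (norm (fourier \<mu> (int n - int m)))\<^sup>2 else 0) - (norm (schur_coeff \<mu> m n))\<^sup>2) * r ^ (2 * n)" for n
  proof -
    have "r ^ (2 * n) = (r ^ n)\<^sup>2" by (simp add: power_even_eq)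
    then show ?thesis
      using r by (simp add: norm_mult norm_power power_mult_distrib left_diff_distrib)
  qed
  ultimately show ?thesis by simp
qed

text \<open>At \<open>r = 1\<close> the series of \<open>integral_defect\<close> sums to the limiting squared error of \<open>e\<^sub>m\<close> by
  \<open>residual_eq_schur\<close>; it converges absolutely there, hence is continuous up to 1.  This turns the
  question about the algorithm into one about boundary values of the Poisson integral of \<open>\<mu>\<close>.\<close>

lemma tendsto_integral_defect:
  "((\<lambda>r. \<integral>t. defect \<mu> m (of_real r * circ t) \<partial>lebesgue01) \<longlongrightarrow>
     1 - suminf (\<lambda>k. (norm (kaczmarz_coeff \<mu> m k))\<^sup>2)) (at_left 1)"
    and summable_coeff_sq: "summable (\<lambda>k. (norm (kaczmarz_coeff \<mu> m k))\<^sup>2)"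
proof -
  show sd: "summable (\<lambda>k. (norm (kaczmarz_coeff \<mu> m k))\<^sup>2)"
    by (rule summableI_nonneg_bounded[OF _ sum_norm_coeff_le_1]) simp
  define a where "a n = (if n < m then (norm (fourier \<mu> (int n - int m)))\<^sup>2 else 0) - (norm (schur_coeff \<mu> m n))\<^sup>2" for n
  have part: "(\<Sum>n<N. a n) = 1 - (\<Sum>k<N. (norm (kaczmarz_coeff \<mu> m k))\<^sup>2)" if "m < N" for N
    using that unfolding residual_eq_schur[OF that] a_def sum_subtractf
    by (simp only: sum_lessThan_if_less less_imp_le)
  have "(\<lambda>N. 1 - (\<Sum>k<N. (norm (kaczmarz_coeff \<mu> m k))\<^sup>2)) \<longlonglongrightarrow> 1 - suminf (\<lambda>k. (norm (kaczmarz_coeff \<mu> m k))\<^sup>2)"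
    by (intro tendsto_intros summable_LIMSEQ sd)
  then have "(\<lambda>N. \<Sum>n<N. a n) \<longlonglongrightarrow> 1 - suminf (\<lambda>k. (norm (kaczmarz_coeff \<mu> m k))\<^sup>2)"
    by (rule Lim_transform_eventually) (auto intro!: eventually_mono[OF eventually_gt_at_top[of m]] simp: part)
  then have as: "a sums (1 - suminf (\<lambda>k. (norm (kaczmarz_coeff \<mu> m k))\<^sup>2))"
    by (simp add: sums_def)
  have an: "summable (\<lambda>n. norm (a n))"
  proof (rule summable_comparison_test_ev)
    have "summable (\<lambda>n. - a n)" using as by (intro summable_minus) (auto simp: sums_iff)
    then show "summable (\<lambda>n. - a n)" .
    show "\<forall>\<^sub>F n in sequentially. norm (norm (a n)) \<le> - a n"
      using eventually_ge_at_top[of m] by eventually_elim (simp add: a_def)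
  qed
  have "uniform_limit {0..1} (\<lambda>N r. \<Sum>n<N. a n * r ^ (2 * n)) (\<lambda>r. suminf (\<lambda>n. a n * r ^ (2 * n))) sequentially"
    by (rule Weierstrass_m_test[OF _ an]) (auto simp: abs_mult intro!: mult_left_le power_le_one)
  then have "continuous_on {0..1} (\<lambda>r. suminf (\<lambda>n. a n * r ^ (2 * n)))"
    by (rule uniform_limit_theorem[rotated]) (auto intro!: always_eventually continuous_intros)
  then have "((\<lambda>r. suminf (\<lambda>n. a n * r ^ (2 * n))) \<longlongrightarrow> suminf (\<lambda>n. a n * 1 ^ (2 * n))) (at 1 within {0..1})"
    unfolding continuous_on_def by (rule bspec) simp
  then have "((\<lambda>r. suminf (\<lambda>n. a n * r ^ (2 * n))) \<longlongrightarrow> suminf a) (at 1 within {0..<1})"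
    using tendsto_within_subset[of _ _ 1 "{0..1}" "{0..<1}"] by fastforce
  moreover have "at 1 within {0..<1::real} = at_left 1"
    by (rule at_within_nhd[of _ "{0<..}"]) auto
  ultimately have lim: "((\<lambda>r. suminf (\<lambda>n. a n * r ^ (2 * n))) \<longlongrightarrow> suminf a) (at_left 1)"
    by simp
  have eq: "suminf (\<lambda>n. a n * r ^ (2 * n)) = (\<integral>t. defect \<mu> m (of_real r * circ t) \<partial>lebesgue01)"
    if "0 \<le> r" "r < 1" for r
    using integral_defect[OF that, of m] unfolding a_def by (simp only: sums_iff)
  have "\<forall>\<^sub>F r in at_left 1. suminf (\<lambda>n. a n * r ^ (2 * n)) = (\<integral>t. defect \<mu> m (of_real r * circ t) \<partial>lebesgue01)"
    using eventually_at_left_real[of 0 "1::real"] by (rule eventually_mono) (auto intro: eq)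
  from Lim_transform_eventually[OF lim this]
  show "((\<lambda>r. \<integral>t. defect \<mu> m (of_real r * circ t) \<partial>lebesgue01) \<longlongrightarrow>
     1 - suminf (\<lambda>k. (norm (kaczmarz_coeff \<mu> m k))\<^sup>2)) (at_left 1)"
    using as by (simp add: sums_iff)
qed

end

section \<open>Poisson averages of Lipschitz functions\<close>

lemma fourier_lebesgue: "fourier lebesgue01 j = (if j = 0 then 1 else 0)"
  unfolding fourier_def integral_circ_powi by simp

lemma (in circle_prob) cauchy_transform_eq_1:
  assumes "\<And>j. j > 0 \<Longrightarrow> fourier \<mu> (int j) = 0" and w: "norm w < 1"
  shows "cauchy_transform \<mu> w = 1"
proof -
  have "(\<lambda>n. fourier \<mu> (int n) * w ^ n) = (\<lambda>n. if n = 0 then 1 else 0)"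
    using assms(1) by (auto simp: fun_eq_iff)
  then have "(\<lambda>n. if n = 0 then 1 else 0) sums cauchy_transform \<mu> w"
    using cauchy_transform_sums[OF w] by simp
  then show ?thesis
    using sums_single[of 0 "\<lambda>_. 1::complex"] sums_unique2 by fastforce
qed

lemma cauchy_transform_lebesgue: "norm w < 1 \<Longrightarrow> cauchy_transform lebesgue01 w = 1"
  by (rule leb.cauchy_transform_eq_1) (simp_all add: fourier_lebesgue)

text \<open>The weight \<open>u\<close> allows for the restriction of the measure to a subset.\<close>

lemma (in circle_prob) poisson_fubini:
  assumes r: "0 \<le> r" "r < 1"
    and g: "g \<in> borel_measurable lebesgue01" "\<And>t. \<bar>g t\<bar> \<le> B"
    and u: "u \<in> borel_measurable \<mu>" "\<And>y. \<bar>u y\<bar> \<le> 1"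
  shows "(\<integral>t. (\<integral>y. u y * poisson y (of_real r * circ t) \<partial>\<mu>) * g t \<partial>lebesgue01)
     = (\<integral>y. u y * (\<integral>t. poisson y (of_real r * circ t) * g t \<partial>lebesgue01) \<partial>\<mu>)"
    and "integrable lebesgue01 (\<lambda>t. (\<integral>y. u y * poisson y (of_real r * circ t) \<partial>\<mu>) * g t)"
    and "integrable \<mu> (\<lambda>y. u y * (\<integral>t. poisson y (of_real r * circ t) * g t \<partial>lebesgue01))"
proof -
  interpret P: pair_prob_space \<mu> lebesgue01 ..
  note [measurable] = g(1) u(1)
  have B: "B \<ge> 0" using g(2)[of 0] by linarith
  have bnd: "0 \<le> poisson y (of_real r * circ t)" "poisson y (of_real r * circ t) \<le> 2 / (1 - r)" for y t
    using poisson_le[of "of_real r * circ t" y] poisson_nonneg[of "of_real r * circ t" y] r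
    by (simp_all add: norm_mult)
  have int: "integrable (\<mu> \<Otimes>\<^sub>M lebesgue01) (\<lambda>(y, t). u y * poisson y (of_real r * circ t) * g t)"
  proof (rule P.integrable_const_bound[where B = "1 * (2 / (1 - r)) * B"])
    show "AE z in \<mu> \<Otimes>\<^sub>M lebesgue01. norm (case z of (y, t) \<Rightarrow> u y * poisson y (of_real r * circ t) * g t)
        \<le> 1 * (2 / (1 - r)) * B"
      unfolding split_beta real_norm_def abs_mult
      using bnd u(2) g(2) B r by (intro AE_I2 mult_mono) auto
    have "(\<lambda>z. u (fst z) * poisson (fst z) (of_real r * circ (snd z)) * g (snd z)) \<in> borel_measurable (\<mu> \<Otimes>\<^sub>M lebesgue01)"
      unfolding poisson_def by measurable
    then show "(\<lambda>(y, t). u y * poisson y (of_real r * circ t) * g t) \<in> borel_measurable (\<mu> \<Otimes>\<^sub>M lebesgue01)"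
      by (simp add: split_beta')
  qed
  have inner_y: "(\<integral>y. u y * poisson y (of_real r * circ t) * g t \<partial>\<mu>)
      = (\<integral>y. u y * poisson y (of_real r * circ t) \<partial>\<mu>) * g t" for t
    by (rule integral_mult_left_zero)
  have inner_t: "(\<integral>t. u y * poisson y (of_real r * circ t) * g t \<partial>lebesgue01)
      = u y * (\<integral>t. poisson y (of_real r * circ t) * g t \<partial>lebesgue01)" for y
    unfolding mult.assoc by (rule integral_mult_right_zero)
  show "integrable lebesgue01 (\<lambda>t. (\<integral>y. u y * poisson y (of_real r * circ t) \<partial>\<mu>) * g t)"
    using P.integrable_snd[OF int] unfolding inner_y .
  show "integrable \<mu> (\<lambda>y. u y * (\<integral>t. poisson y (of_real r * circ t) * g t \<partial>lebesgue01))"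
    using P.integrable_fst[OF int] unfolding inner_t .
  show "(\<integral>t. (\<integral>y. u y * poisson y (of_real r * circ t) \<partial>\<mu>) * g t \<partial>lebesgue01)
     = (\<integral>y. u y * (\<integral>t. poisson y (of_real r * circ t) * g t \<partial>lebesgue01) \<partial>\<mu>)"
    using P.Fubini_integral[OF int] unfolding inner_y inner_t .
qed

text \<open>By Fubini's theorem and the symmetric roles of the two variables, smoothing the measure with the
  Poisson kernel amounts to smoothing the Lipschitz function \<open>g\<close>.\<close>

lemma (in circle_prob) poisson_average_diff:
  assumes r: "0 < r" "r < 1" and L: "L \<ge> 0"
    and g: "g \<in> borel_measurable lebesgue01" "g \<in> borel_measurable \<mu>" "\<And>t. \<bar>g t\<bar> \<le> B"
    and lip: "\<And>s t. \<bar>g t - g s\<bar> \<le> L * norm (circ t - circ s)"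
    and u: "u \<in> borel_measurable \<mu>" "\<And>y. \<bar>u y\<bar> \<le> 1"
  shows "\<bar>(\<integral>t. (\<integral>y. u y * poisson y (of_real r * circ t) \<partial>\<mu>) * g t \<partial>lebesgue01) - (\<integral>y. u y * g y \<partial>\<mu>)\<bar>
     \<le> L * sqrt ((1 - r\<^sup>2) / r)"
proof -
  let ?D = "L * sqrt ((1 - r\<^sup>2) / r)"
  let ?G = "\<lambda>y. \<integral>t. poisson y (of_real r * circ t) * g t \<partial>lebesgue01"
  have r': "0 \<le> r" using r by simp
  note F = poisson_fubini[OF r' r(2) g(1,3) u]
  note [measurable] = g(2) u(1)
  have ug: "integrable \<mu> (\<lambda>y. u y * g y)"
  proof (rule integrable_bounded[where B = "1 * B"])
    show "norm (u y * g y) \<le> 1 * B" for y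
      unfolding real_norm_def abs_mult using u(2) g(3) by (intro mult_mono) auto
  qed measurable
  have "(\<integral>y. u y * ?G y \<partial>\<mu>) - (\<integral>y. u y * g y \<partial>\<mu>) = (\<integral>y. u y * ?G y - u y * g y \<partial>\<mu>)"
    by (rule Bochner_Integration.integral_diff[OF F(3) ug, symmetric])
  also have "\<bar>\<dots>\<bar> \<le> (\<integral>y. \<bar>u y * ?G y - u y * g y\<bar> \<partial>\<mu>)"
    by (rule integral_abs_bound)
  also have "\<dots> \<le> (\<integral>y. ?D \<partial>\<mu>)"
  proof (rule integral_mono)
    show "integrable \<mu> (\<lambda>y. \<bar>u y * ?G y - u y * g y\<bar>)"
      using F(3) ug by auto
    show "\<bar>u y * ?G y - u y * g y\<bar> \<le> ?D" for y
    proof -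
      have "\<bar>u y * ?G y - u y * g y\<bar> = \<bar>u y\<bar> * \<bar>?G y - g y\<bar>"
        by (simp add: abs_mult flip: right_diff_distrib)
      also have "\<dots> \<le> 1 * ?D"
        using poisson_integral_lipschitz[OF r L g(1,3) lip] u(2) by (intro mult_mono) auto
      finally show ?thesis by simp
    qed
  qed simp
  finally show ?thesis unfolding F(1) using prob_space by simp
qed

lemma tendsto_poisson_error: "((\<lambda>r. L * sqrt ((1 - r\<^sup>2) / r)) \<longlongrightarrow> 0) (at_left 1)"
proof -
  have "((\<lambda>r::real. L * sqrt ((1 - r\<^sup>2) / r)) \<longlongrightarrow> L * sqrt ((1 - 1\<^sup>2) / 1)) (at_left 1)"
    by (intro tendsto_intros) auto
  then show ?thesis by simp
qed

text \<open>Functions that are Lipschitz in \<open>circ t\<close> and decrease to the indicator of the compact set \<open>K\<close>.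
  For empty \<open>K\<close> the distance is 0 by convention, which is why \<open>K \<noteq> {}\<close> is assumed below.\<close>

definition cutoff :: "real set \<Rightarrow> nat \<Rightarrow> real \<Rightarrow> real" where
  "cutoff K n t = max 0 (1 - real n * infdist (circ t) (circ ` K))"

lemma cutoff_bounds: "0 \<le> cutoff K n t" "cutoff K n t \<le> 1"
  using infdist_nonneg[of "circ t" "circ ` K"] by (auto simp: cutoff_def)

lemma cutoff_lipschitz: "\<bar>cutoff K n t - cutoff K n s\<bar> \<le> real n * norm (circ t - circ s)"
proof -
  have "\<bar>infdist (circ t) (circ ` K) - infdist (circ s) (circ ` K)\<bar> \<le> norm (circ t - circ s)"
    using infdist_triangle_abs[of "circ t" "circ ` K" "circ s"] by (simp add: dist_norm)
  then have "real n * \<bar>infdist (circ t) (circ ` K) - infdist (circ s) (circ ` K)\<bar> \<le> real n * norm (circ t - circ s)"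
    by (rule mult_left_mono) simp
  moreover have "\<bar>cutoff K n t - cutoff K n s\<bar> \<le> \<bar>real n * infdist (circ t) (circ ` K) - real n * infdist (circ s) (circ ` K)\<bar>"
    unfolding cutoff_def by linarith
  ultimately show ?thesis by (simp add: abs_mult flip: right_diff_distrib)
qed

lemma cutoff_measurable [measurable]: "cutoff K n \<in> borel_measurable borel"
proof -
  have "continuous_on UNIV (cutoff K n)"
    unfolding cutoff_def[abs_def] by (intro continuous_intros)
  then show ?thesis by (rule borel_measurable_continuous_onI)
qed

lemma (in circle_prob) cutoff_measurable_circle [measurable]: "cutoff K n \<in> borel_measurable \<mu>"
  using measurable_compose[OF measurable_id_circle cutoff_measurable] by simp

lemma cutoff_eq_1: "t \<in> K \<Longrightarrow> cutoff K n t = 1"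
  by (simp add: cutoff_def)

lemma cutoff_tendsto:
  assumes K: "compact K" "K \<noteq> {}" "K \<subseteq> {0..<1}" and t: "t \<in> {0..<1}"
  shows "(\<lambda>n. cutoff K n t) \<longlonglongrightarrow> indicator K t"
proof (cases "t \<in> K")
  case True
  then show ?thesis by (simp add: cutoff_eq_1)
next
  case False
  have "compact (circ ` K)"
    by (rule compact_continuous_image[OF continuous_on_circ K(1)])
  moreover have "circ t \<notin> circ ` K"
    using inj_on_circ K t False by (auto dest: inj_onD)
  ultimately have pos: "infdist (circ t) (circ ` K) > 0"
    using K(2) by (metis compact_imp_closed image_is_empty in_closed_iff_infdist_zero infdist_nonneg less_eq_real_def)
  have "filterlim (\<lambda>n. real n * infdist (circ t) (circ ` K)) at_top sequentially"
    by (rule filterlim_at_top_mult_tendsto_pos[OF tendsto_const pos filterlim_real_sequentially, THEN filterlim_cong[THEN iffD1, rotated -1]]) (auto simp: mult_ac)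
  then have "\<forall>\<^sub>F n in sequentially. real n * infdist (circ t) (circ ` K) \<ge> 1"
    by (simp add: filterlim_at_top)
  then have "\<forall>\<^sub>F n in sequentially. cutoff K n t = 0"
    by eventually_elim (simp add: cutoff_def)
  then show ?thesis using False by (simp add: tendsto_eventually)
qed

lemma (in circle_prob) integral_cutoff_tendsto:
  assumes K: "compact K" "K \<noteq> {}" "K \<subseteq> {0..<1}"
  shows "(\<lambda>n. \<integral>t. cutoff K n t \<partial>\<mu>) \<longlonglongrightarrow> measure \<mu> K"
proof -
  have KM[measurable]: "K \<in> sets \<mu>"
    using K by (auto simp: sets_circle_iff borel_compact)
  have "(\<lambda>n. \<integral>t. cutoff K n t \<partial>\<mu>) \<longlonglongrightarrow> (\<integral>t. indicator K t \<partial>\<mu>)"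
  proof (rule integral_dominated_convergence[where w = "\<lambda>_. 1"])
    show "AE t in \<mu>. (\<lambda>n. cutoff K n t) \<longlonglongrightarrow> indicator K t"
      using cutoff_tendsto[OF K] by (intro AE_I2) simp
    show "AE t in \<mu>. norm (cutoff K n t) \<le> 1" for n
      using cutoff_bounds by (intro AE_I2) simp
  qed auto
  then show ?thesis using K(3) by (simp add: Int_absorb2)
qed

text \<open>The distribution function at a point of \<open>[0,1)\<close> is the measure of a compact interval.\<close>

lemma circle_prob_eqI:
  assumes "circle_prob \<mu>" "circle_prob \<nu>"
    and eq: "\<And>K. compact K \<Longrightarrow> K \<noteq> {} \<Longrightarrow> K \<subseteq> {0..<1} \<Longrightarrow> measure \<mu> K = measure \<nu> K"
  shows "\<mu> = \<nu>"
proof -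
  interpret m: circle_prob \<mu> by fact
  interpret n: circle_prob \<nu> by fact
  let ?m = "distr \<mu> borel (\<lambda>x. x)" and ?n = "distr \<nu> borel (\<lambda>x. x)"
  have rd: "real_distribution (distr \<kappa> borel (\<lambda>x. x))" if "circle_prob \<kappa>" for \<kappa>
  proof -
    interpret k: circle_prob \<kappa> by fact
    interpret d: prob_space "distr \<kappa> borel (\<lambda>x. x)" by (rule k.prob_space_distr) simp
    show ?thesis by standard simp
  qed
  have "cdf ?m x = cdf ?n x" for x
  proof -
    have *: "cdf ?m x = measure \<mu> ({..x} \<inter> {0..<1})" "cdf ?n x = measure \<nu> ({..x} \<inter> {0..<1})"
      by (simp_all add: cdf_def measure_distr)
    consider "x < 0" | "0 \<le> x" "x < 1" | "1 \<le> x" by linarith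
    then show ?thesis
    proof cases
      case 1
      then have "{..x} \<inter> {0..<1} = {}" by auto
      then show ?thesis by (simp add: *)
    next
      case 2
      then have "{..x} \<inter> {0..<1} = {0..x}" by auto
      moreover have "{0..x} \<subseteq> {0..<1}" using 2 by auto
      ultimately show ?thesis using eq[of "{0..x}"] 2 by (simp add: *)
    next
      case 3
      then have "{..x} \<inter> {0..<1} = {0..<1}" by auto
      then show ?thesis using m.prob_space n.prob_space by (simp add: *)
    qed
  qed
  then have d: "?m = ?n"
    using cdf_unique[OF rd rd] assms by (auto simp: fun_eq_iff)
  show "\<mu> = \<nu>"
  proof (rule measure_eqI)
    show "sets \<mu> = sets \<nu>" using m.sets_circle n.sets_circle by simp
    fix A assume A: "A \<in> sets \<mu>"
    then have "A \<in> sets borel" "A \<inter> {0..<1} = A" by (auto simp: m.sets_circle_iff)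
    then have "emeasure ?m A = emeasure \<mu> A" "emeasure ?n A = emeasure \<nu> A"
      by (simp_all add: emeasure_distr)
    then show "emeasure \<mu> A = emeasure \<nu> A" by (simp add: d)
  qed
qed

lemma (in circle_prob) poisson_average_tendsto:
  assumes L: "L \<ge> 0"
    and g: "g \<in> borel_measurable borel" "\<And>t. \<bar>g t\<bar> \<le> B"
    and lip: "\<And>s t. \<bar>g t - g s\<bar> \<le> L * norm (circ t - circ s)"
  shows "((\<lambda>r. \<integral>t. (2 * Re (cauchy_transform \<mu> (of_real r * circ t)) - 1) * g t \<partial>lebesgue01)
     \<longlongrightarrow> (\<integral>y. g y \<partial>\<mu>)) (at_left 1)"
proof (rule Lim_transform2[OF tendsto_const])
  have gm: "g \<in> borel_measurable lebesgue01" "g \<in> borel_measurable \<mu>"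
    using measurable_compose[OF leb.measurable_id_circle g(1)] measurable_compose[OF measurable_id_circle g(1)] by auto
  have bound: "norm ((\<integral>y. g y \<partial>\<mu>) - (\<integral>t. (2 * Re (cauchy_transform \<mu> (of_real r * circ t)) - 1) * g t \<partial>lebesgue01))
      \<le> L * sqrt ((1 - r\<^sup>2) / r)" if r: "0 < r" "r < 1" for r
  proof -
    have "(\<integral>y. 1 * poisson y (of_real r * circ t) \<partial>\<mu>) = 2 * Re (cauchy_transform \<mu> (of_real r * circ t)) - 1" for t
      using integral_poisson[of "of_real r * circ t"] r by (simp add: norm_mult)
    then show ?thesis
      using poisson_average_diff[OF r L gm g(2) lip, of "\<lambda>_. 1"] by (simp add: abs_minus_commute)
  qed
  show "((\<lambda>r. (\<integral>y. g y \<partial>\<mu>) - (\<integral>t. (2 * Re (cauchy_transform \<mu> (of_real r * circ t)) - 1) * g t \<partial>lebesgue01)) \<longlongrightarrow> 0) (at_left 1)"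
  proof (rule Lim_null_comparison[OF _ tendsto_poisson_error[of L]])
    show "\<forall>\<^sub>F r in at_left 1. norm ((\<integral>y. g y \<partial>\<mu>) - (\<integral>t. (2 * Re (cauchy_transform \<mu> (of_real r * circ t)) - 1) * g t \<partial>lebesgue01))
        \<le> L * sqrt ((1 - r\<^sup>2) / r)"
      using eventually_at_left_real[of 0 "1::real"] by (rule eventually_mono) (use bound in auto)
  qed
qed

text \<open>The Poisson integral of such a measure is constantly 1, as for Lebesgue measure.  Letting
  \<open>r \<longlongrightarrow> 1\<close>, the two measures integrate all cutoffs alike, and hence agree on compact sets.\<close>

lemma (in circle_prob) eq_lebesgue_if_fourier_0:
  assumes "\<And>j. j > 0 \<Longrightarrow> fourier \<mu> (int j) = 0"
  shows "\<mu> = lebesgue01"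
proof (rule circle_prob_eqI[OF circle_prob_axioms leb.circle_prob_axioms])
  fix K :: "real set"
  assume K: "compact K" "K \<noteq> {}" "K \<subseteq> {0..<1}"
  have "(\<integral>y. cutoff K n y \<partial>\<mu>) = (\<integral>y. cutoff K n y \<partial>lebesgue01)" for n
  proof -
    have lim: "((\<lambda>r. \<integral>t. (2 * Re (cauchy_transform \<mu> (of_real r * circ t)) - 1) * cutoff K n t \<partial>lebesgue01)
     \<longlongrightarrow> (\<integral>y. cutoff K n y \<partial>\<mu>)) (at_left 1)"
      by (rule poisson_average_tendsto[where L = "real n" and B = 1])
         (use cutoff_bounds cutoff_lipschitz in auto)
    have "cauchy_transform \<mu> (of_real r * circ t) = 1" if "0 < r" "r < 1" for r t
      using that by (intro cauchy_transform_eq_1 assms) (auto simp: norm_mult)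
    then have "\<forall>\<^sub>F r in at_left 1. (\<integral>t. (2 * Re (cauchy_transform \<mu> (of_real r * circ t)) - 1) * cutoff K n t \<partial>lebesgue01)
        = (\<integral>t. cutoff K n t \<partial>lebesgue01)"
      by (intro eventually_mono[OF eventually_at_left_real[of 0 "1::real"]]) auto
    from tendsto_eventually[OF this] lim show ?thesis
      by (intro tendsto_unique[OF _ lim]) auto
  qed
  then show "measure \<mu> K = measure lebesgue01 K"
    using integral_cutoff_tendsto[OF K] leb.integral_cutoff_tendsto[OF K] LIMSEQ_unique by simp
qed

section \<open>Singular measures and Lebesgue measure\<close>

context circle_prob begin

lemma neg_fourier_poly_bound:
  assumes "norm w \<le> 1"
  shows "norm (neg_fourier_poly \<mu> m w) \<le> real m"
proof -
  have "norm (neg_fourier_poly \<mu> m w) \<le> (\<Sum>n<m. 1)"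
    unfolding neg_fourier_poly_def
  proof (rule sum_norm_le)
    fix n
    show "norm (fourier \<mu> (int n - int m) * w ^ n) \<le> 1"
      using norm_fourier_le_1[of "int n - int m"] assms
      by (simp add: norm_mult norm_power mult_le_one power_le_one)
  qed
  then show ?thesis by simp
qed

lemma neg_fourier_poly_lipschitz:
  assumes "norm w \<le> 1" "norm z \<le> 1"
  shows "norm (neg_fourier_poly \<mu> m w - neg_fourier_poly \<mu> m z) \<le> (real m)\<^sup>2 * norm (w - z)"
proof -
  have "norm (neg_fourier_poly \<mu> m w - neg_fourier_poly \<mu> m z)
      = norm (\<Sum>n<m. fourier \<mu> (int n - int m) * (w ^ n - z ^ n))"
    by (simp add: neg_fourier_poly_def sum_subtractf right_diff_distrib)
  also have "\<dots> \<le> (\<Sum>n<m. real m * norm (w - z))"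
  proof (rule sum_norm_le)
    fix n assume "n \<in> {..<m}"
    then have n: "real n \<le> real m" by simp
    have "norm (fourier \<mu> (int n - int m) * (w ^ n - z ^ n)) \<le> 1 * (real n * norm (w - z))"
      unfolding norm_mult using norm_fourier_le_1 norm_power_diff[OF assms]
      by (intro mult_mono) auto
    also have "\<dots> \<le> real m * norm (w - z)"
      using n by (simp add: mult_right_mono)
    finally show "norm (fourier \<mu> (int n - int m) * (w ^ n - z ^ n)) \<le> real m * norm (w - z)" .
  qed
  finally show ?thesis by (simp add: power2_eq_square mult_ac)
qed

lemma neg_fourier_poly_sq_lipschitz:
  assumes "norm w \<le> 1" "norm z \<le> 1"
  shows "\<bar>(norm (neg_fourier_poly \<mu> m w))\<^sup>2 - (norm (neg_fourier_poly \<mu> m z))\<^sup>2\<bar> \<le> 2 * real m ^ 3 * norm (w - z)"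
proof -
  let ?p = "neg_fourier_poly \<mu> m"
  have "\<bar>(norm (?p w))\<^sup>2 - (norm (?p z))\<^sup>2\<bar> = (norm (?p w) + norm (?p z)) * \<bar>norm (?p w) - norm (?p z)\<bar>"
    by (simp add: power2_eq_square square_diff_square_factored abs_mult)
  also have "\<dots> \<le> (real m + real m) * ((real m)\<^sup>2 * norm (w - z))"
    using neg_fourier_poly_bound assms norm_triangle_ineq3 neg_fourier_poly_lipschitz[OF assms, of m] order_trans
    by (intro mult_mono add_mono) (auto, blast intro: order_trans)
  finally show ?thesis by (simp add: power2_eq_square power3_eq_cube mult_ac)
qed

lemma defect_nonneg: "norm w < 1 \<Longrightarrow> 0 \<le> defect \<mu> m w"
  using Re_cauchy_transform_ge[of w] by (simp add: defect_def)

text \<open>The first bound holds because \<open>\<bar>p\<bar> \<le> m\<close>, the second because moreover \<open>\<bar>C\<bar> \<ge> 1/2\<close>.\<close>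

lemma defect_bounds:
  assumes w: "norm w < 1"
  shows "defect \<mu> m w \<le> (real m)\<^sup>2"
    and "defect \<mu> m w \<le> 4 * (real m)\<^sup>2 * (2 * Re (cauchy_transform \<mu> w) - 1)"
proof -
  let ?C = "cauchy_transform \<mu> w"
  have p: "(norm (neg_fourier_poly \<mu> m w))\<^sup>2 \<le> (real m)\<^sup>2"
    using neg_fourier_poly_bound[of w m] w by (intro power_mono) auto
  show "defect \<mu> m w \<le> (real m)\<^sup>2"
    unfolding defect_eq[OF w] using p by (smt (verit) zero_le_power2)
  have R: "Re ?C \<ge> 1 / 2" by (rule Re_cauchy_transform_ge[OF w])
  then have "norm ?C \<ge> 1 / 2" using complex_Re_le_cmod[of ?C] by linarith
  then have "(norm ?C)\<^sup>2 \<ge> (1 / 2)\<^sup>2" by (intro power_mono) auto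
  then have C: "1 / (norm ?C)\<^sup>2 \<le> 4" by (simp add: power2_eq_square field_simps)
  have "defect \<mu> m w = (norm (neg_fourier_poly \<mu> m w))\<^sup>2 * (2 * Re ?C - 1) * (1 / (norm ?C)\<^sup>2)"
    by (simp add: defect_def)
  also have "\<dots> \<le> (real m)\<^sup>2 * (2 * Re ?C - 1) * 4"
    using p R C by (intro mult_mono) auto
  finally show "defect \<mu> m w \<le> 4 * (real m)\<^sup>2 * (2 * Re ?C - 1)" by simp
qed

lemma cauchy_transform_measurable:
  assumes "0 \<le> r" "r < 1"
  shows "(\<lambda>t. cauchy_transform \<mu> (of_real r * circ t)) \<in> borel_measurable borel"
proof (rule borel_measurable_continuous_onI)
  show "continuous_on UNIV (\<lambda>t. cauchy_transform \<mu> (of_real r * circ t))"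
    by (rule continuous_on_compose2[OF holomorphic_on_imp_continuous_on[OF holomorphic_cauchy_transform]])
       (use assms in \<open>auto intro!: continuous_intros simp: norm_mult\<close>)
qed

lemma neg_fourier_poly_measurable: "(\<lambda>t. neg_fourier_poly \<mu> m (of_real r * circ t)) \<in> borel_measurable borel"
  unfolding neg_fourier_poly_def by measurable

lemma defect_measurable:
  assumes "0 \<le> r" "r < 1"
  shows "(\<lambda>t. defect \<mu> m (of_real r * circ t)) \<in> borel_measurable lebesgue01"
proof -
  note [measurable] = cauchy_transform_measurable[OF assms] neg_fourier_poly_measurable[of m r]
  have "(\<lambda>t. defect \<mu> m (of_real r * circ t)) \<in> borel_measurable borel"
    unfolding defect_def by measurable
  from measurable_compose[OF leb.measurable_id_circle this] show ?thesis by simp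
qed

lemma cauchy_transform_measurable':
  assumes "0 \<le> r" "r < 1"
  shows "(\<lambda>t. cauchy_transform \<mu> (of_real r * circ t)) \<in> borel_measurable lebesgue01"
  using measurable_compose[OF leb.measurable_id_circle cauchy_transform_measurable[OF assms]] by simp

lemma integrable_defect:
  assumes "0 \<le> r" "r < 1"
  shows "integrable lebesgue01 (\<lambda>t. defect \<mu> m (of_real r * circ t))"
  by (rule leb.integrable_bounded[OF defect_measurable[OF assms], where B = "(real m)\<^sup>2"])
     (use assms defect_nonneg defect_bounds(1) in \<open>auto simp: norm_mult\<close>)

lemma poisson_mean_bound:
  assumes "norm w < 1"
  shows "\<bar>2 * Re (cauchy_transform \<mu> w) - 1\<bar> \<le> 2 / (1 - norm w)"
proof -
  have "(\<integral>y. poisson y w \<partial>\<mu>) \<le> (\<integral>y. 2 / (1 - norm w) \<partial>\<mu>)"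
    by (rule integral_mono[OF integrable_poisson[OF assms]]) (use poisson_le[OF assms] in auto)
  then show ?thesis
    using Re_cauchy_transform_ge[OF assms] prob_space unfolding integral_poisson[OF assms] by simp
qed

lemma inner_regular_circle:
  assumes B: "B \<in> sets \<mu>" and e: "0 \<le> e" "e < measure \<mu> B"
  obtains K where "compact K" "K \<subseteq> B" "e < measure \<mu> K"
proof -
  let ?m = "distr \<mu> borel (\<lambda>x. x)"
  interpret d: prob_space ?m by (rule prob_space_distr) simp
  have Bb: "B \<in> sets borel" "B \<subseteq> {0..<1}" using B by (auto simp: sets_circle_iff)
  have em: "emeasure ?m A = emeasure \<mu> A" if "A \<in> sets borel" "A \<subseteq> {0..<1}" for A
    using that by (simp add: emeasure_distr Int_absorb2)
  have "emeasure ?m B = (SUP K \<in> {K. K \<subseteq> B \<and> compact K}. emeasure ?m K)"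
    by (rule inner_regular) (use Bb in auto)
  moreover have "ennreal e < emeasure ?m B"
    using e by (simp add: em[OF Bb] emeasure_eq_measure ennreal_less_iff)
  ultimately obtain K where K: "K \<subseteq> B" "compact K" "ennreal e < emeasure ?m K"
    by (auto simp: less_SUP_iff)
  then have "emeasure ?m K = emeasure \<mu> K"
    using Bb by (intro em) (auto simp: borel_compact)
  with K(3) have "ennreal e < ennreal (measure \<mu> K)" by (simp add: emeasure_eq_measure)
  then have "e < measure \<mu> K"
    using e(1) by (simp add: ennreal_less_iff)
  with K that show thesis by blast
qed

text \<open>Take a compact \<open>K\<close> of Lebesgue measure 0 that carries all but \<open>e\<close> of \<open>\<mu>\<close>, and a cutoff \<open>g\<close> of \<open>K\<close>
  with Lebesgue integral below \<open>e\<close>.  On the part of the defect weighted by \<open>g\<close> use the uniform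
  bound of \<open>defect_bounds\<close>; on the part weighted by \<open>1 - g\<close> use the bound by the Poisson integral,
  whose average against \<open>1 - g\<close> tends to \<open>\<integral> 1 - g d\<mu> < e\<close>.\<close>

lemma singular_imp_coeff_sum:
  assumes sing: "mutually_singular \<mu> lebesgue01"
  shows "suminf (\<lambda>k. (norm (kaczmarz_coeff \<mu> m k))\<^sup>2) = 1"
proof -
  define \<rho> where "\<rho> = 1 - suminf (\<lambda>k. (norm (kaczmarz_coeff \<mu> m k))\<^sup>2)"
  have "suminf (\<lambda>k. (norm (kaczmarz_coeff \<mu> m k))\<^sup>2) \<le> 1"
    by (rule suminf_le_const[OF summable_coeff_sq sum_norm_coeff_le_1])
  then have \<rho>0: "\<rho> \<ge> 0" by (simp add: \<rho>_def)
  \<comment> \<open>\<open>\<rho>\<close> is the limiting squared error; one share \<open>m\<^sup>2 * e\<close> comes from the part of the defect weighted by the cutoff, the other four from the rest\<close>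
  have small: "\<rho> \<le> 5 * (real m)\<^sup>2 * e" if e: "0 < e" "e < 1" for e
  proof -
    obtain A where A: "A \<in> sets \<mu>" "emeasure \<mu> A = 0" "emeasure lebesgue01 ({0..<1} - A) = 0"
      using sing by (auto simp: mutually_singular_def)
    define S where "S = {0..<1} - A"
    have S: "S \<in> sets \<mu>" unfolding S_def using sets.compl_sets[OF A(1)] by simp
    have "measure \<mu> S = 1"
      unfolding S_def using prob_compl[OF A(1)] A(2) by (simp add: emeasure_eq_measure)
    then obtain K where K: "compact K" "K \<subseteq> S" "1 - e < measure \<mu> K"
      using inner_regular_circle[OF S, of "1 - e"] e by auto
    have K2: "K \<noteq> {}" using K(3) e by auto
    have K3: "K \<subseteq> {0..<1}" using K(2) by (auto simp: S_def)
    have "emeasure lebesgue01 K \<le> emeasure lebesgue01 ({0..<1} - A)"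
      using K(2) S by (intro emeasure_mono) (auto simp: S_def leb.sets_circle_iff sets_circle_iff)
    then have "measure lebesgue01 K = 0" using A(3) by (simp add: measure_def)
    then have "(\<lambda>n. \<integral>t. cutoff K n t \<partial>lebesgue01) \<longlonglongrightarrow> 0"
      using leb.integral_cutoff_tendsto[OF K(1) K2 K3] by simp
    then have "\<forall>\<^sub>F n in sequentially. (\<integral>t. cutoff K n t \<partial>lebesgue01) < e"
      using e(1) by (rule order_tendstoD)
    then obtain n where n: "(\<integral>t. cutoff K n t \<partial>lebesgue01) < e"
      by (auto simp: eventually_sequentially)
    let ?g = "cutoff K n"
    have gint: "integrable \<nu> ?g" if "circle_prob \<nu>" for \<nu>
      by (rule circle_prob.integrable_bounded[OF that, where B = 1])
         (use cutoff_bounds in \<open>auto intro: circle_prob.cutoff_measurable_circle that\<close>)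
    have KM: "K \<in> sets \<mu>" using K(1) K3 by (auto simp: sets_circle_iff borel_compact)
    have "measure \<mu> K = (\<integral>t. indicator K t \<partial>\<mu>)"
      using K3 by (simp add: Int_absorb2)
    also have "\<dots> \<le> (\<integral>t. ?g t \<partial>\<mu>)"
    proof (rule integral_mono)
      show "integrable \<mu> (indicator K :: real \<Rightarrow> real)"
        by (rule integrable_bounded[where B = 1]) (use KM in auto)
      show "indicator K t \<le> ?g t" for t
        using cutoff_eq_1[of t K n] cutoff_bounds[where K = K and n = n and t = t] by (auto simp: indicator_def)
    qed (rule gint[OF circle_prob_axioms])
    finally have "(\<integral>t. 1 - ?g t \<partial>\<mu>) < e"
      using K(3) gint[OF circle_prob_axioms] prob_space by simp
    let ?Q = "\<lambda>r t. 2 * Re (cauchy_transform \<mu> (of_real r * circ t)) - 1"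
    have lim1: "((\<lambda>r. \<integral>t. ?Q r t * (1 - ?g t) \<partial>lebesgue01) \<longlongrightarrow> (\<integral>t. 1 - ?g t \<partial>\<mu>)) (at_left 1)"
    proof (rule poisson_average_tendsto[where L = "real n" and B = 1])
      show "\<bar>1 - ?g t\<bar> \<le> 1" for t using cutoff_bounds[where K = K and n = n and t = t] by auto
      show "\<bar>(1 - ?g t) - (1 - ?g s)\<bar> \<le> real n * norm (circ t - circ s)" for s t
        using cutoff_lipschitz[of K n t s] by linarith
    qed auto
    have "\<rho> \<le> (real m)\<^sup>2 * e + 4 * (real m)\<^sup>2 * (\<integral>t. 1 - ?g t \<partial>\<mu>)"
    proof (rule tendsto_le[OF _ _ tendsto_integral_defect[of m, folded \<rho>_def]])
      show "((\<lambda>r. (real m)\<^sup>2 * e + 4 * (real m)\<^sup>2 * (\<integral>t. ?Q r t * (1 - ?g t) \<partial>lebesgue01)) \<longlongrightarrow>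
         (real m)\<^sup>2 * e + 4 * (real m)\<^sup>2 * (\<integral>t. 1 - ?g t \<partial>\<mu>)) (at_left 1)"
        by (intro tendsto_intros lim1)
      have "(\<integral>t. defect \<mu> m (of_real r * circ t) \<partial>lebesgue01)
          \<le> (real m)\<^sup>2 * e + 4 * (real m)\<^sup>2 * (\<integral>t. ?Q r t * (1 - ?g t) \<partial>lebesgue01)" if r: "0 < r" "r < 1" for r
      proof -
        have w: "norm (of_real r * circ t) < 1" for t using r by (simp add: norm_mult)
        have intQ: "integrable lebesgue01 (\<lambda>t. ?Q r t * (1 - ?g t))"
        proof (rule leb.integrable_bounded[where B = "2 / (1 - r) * 1"])
          show "norm (?Q r t * (1 - ?g t)) \<le> 2 / (1 - r) * 1" for t
            unfolding real_norm_def abs_mult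
            using poisson_mean_bound[OF w, of t] cutoff_bounds[where K = K and n = n and t = t] r
            by (intro mult_mono) (auto simp: norm_mult)
          show "(\<lambda>t. ?Q r t * (1 - ?g t)) \<in> borel_measurable lebesgue01"
            using cauchy_transform_measurable'[of r] r by (auto intro!: borel_measurable_times borel_measurable_diff)
        qed
        have pt: "defect \<mu> m (of_real r * circ t) \<le> (real m)\<^sup>2 * ?g t + 4 * (real m)\<^sup>2 * (?Q r t * (1 - ?g t))" for t
        proof -
          have g: "0 \<le> ?g t" "0 \<le> 1 - ?g t" using cutoff_bounds by auto
          have "defect \<mu> m (of_real r * circ t) = defect \<mu> m (of_real r * circ t) * ?g t + defect \<mu> m (of_real r * circ t) * (1 - ?g t)"
            by (simp add: algebra_simps)
          also have "\<dots> \<le> (real m)\<^sup>2 * ?g t + 4 * (real m)\<^sup>2 * ?Q r t * (1 - ?g t)"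
            by (intro add_mono mult_right_mono defect_bounds w g)
          finally show ?thesis by (simp add: mult.assoc)
        qed
        have "(\<integral>t. defect \<mu> m (of_real r * circ t) \<partial>lebesgue01)
            \<le> (\<integral>t. (real m)\<^sup>2 * ?g t + 4 * (real m)\<^sup>2 * (?Q r t * (1 - ?g t)) \<partial>lebesgue01)"
          by (rule integral_mono[OF integrable_defect _ pt])
             (use r intQ gint[OF leb.circle_prob_axioms] in auto)
        also have "\<dots> = (real m)\<^sup>2 * (\<integral>t. ?g t \<partial>lebesgue01) + 4 * (real m)\<^sup>2 * (\<integral>t. ?Q r t * (1 - ?g t) \<partial>lebesgue01)"
          using intQ gint[OF leb.circle_prob_axioms]
          by (subst Bochner_Integration.integral_add) auto
        also have "\<dots> \<le> (real m)\<^sup>2 * e + 4 * (real m)\<^sup>2 * (\<integral>t. ?Q r t * (1 - ?g t) \<partial>lebesgue01)"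
          using n by (intro add_right_mono mult_left_mono) auto
        finally show ?thesis .
      qed
      then show "\<forall>\<^sub>F r in at_left 1. (\<integral>t. defect \<mu> m (of_real r * circ t) \<partial>lebesgue01)
          \<le> (real m)\<^sup>2 * e + 4 * (real m)\<^sup>2 * (\<integral>t. ?Q r t * (1 - ?g t) \<partial>lebesgue01)"
        by (intro eventually_mono[OF eventually_at_left_real[of 0 "1::real"]]) auto
    qed simp
    also have "\<dots> \<le> (real m)\<^sup>2 * e + 4 * (real m)\<^sup>2 * e"
      using \<open>(\<integral>t. 1 - ?g t \<partial>\<mu>) < e\<close> by (intro add_left_mono mult_left_mono) auto
    finally show ?thesis by (simp add: mult_ac)
  qed
  have "((\<lambda>e. 5 * (real m)\<^sup>2 * e) \<longlongrightarrow> 5 * (real m)\<^sup>2 * 0) (at_right 0)"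
    by (intro tendsto_intros)
  moreover have "\<forall>\<^sub>F e in at_right 0. \<rho> \<le> 5 * (real m)\<^sup>2 * e"
    using eventually_at_right_real[of 0 "1::real"] by (rule eventually_mono) (auto intro: small)
  ultimately have "\<rho> \<le> 5 * (real m)\<^sup>2 * 0"
    by (intro tendsto_lowerbound[of _ _ "at_right (0::real)"]) auto
  with \<rho>0 show ?thesis by (simp add: \<rho>_def)
qed

end

text \<open>Here \<open>p = 0\<close>.  (Indeed the functions \<open>e\<^sub>n\<close> are orthonormal.)\<close>

lemma lebesgue_imp_coeff_sum: "suminf (\<lambda>k. (norm (kaczmarz_coeff lebesgue01 m k))\<^sup>2) = 1"
proof -
  have "defect lebesgue01 m w = 0" for w
    by (simp add: defect_def neg_fourier_poly_def fourier_lebesgue)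
  then have "((\<lambda>r::real. 0) \<longlongrightarrow> 1 - suminf (\<lambda>k. (norm (kaczmarz_coeff lebesgue01 m k))\<^sup>2)) (at_left 1)"
    using leb.tendsto_integral_defect[of m] by simp
  then show ?thesis by (simp add: tendsto_const_iff)
qed

section \<open>Measures with an absolutely continuous part\<close>

text \<open>Apply the Hahn decomposition to \<open>\<mu>\<close> and \<open>1/n\<close> times Lebesgue measure for every \<open>n \<ge> 1\<close>, and let
  \<open>Y n\<close> be the set on which \<open>\<mu>\<close> dominates.  If all these sets were Lebesgue null, then so would be
  their union, while \<open>\<mu>\<close> gives its complement at most \<open>1/n\<close> for every \<open>n\<close>.\<close>

lemma (in circle_prob) not_singular_imp_minorant:
  assumes "\<not> mutually_singular \<mu> lebesgue01"
  obtains E \<epsilon> where "E \<in> sets \<mu>" "0 < \<epsilon>" "measure lebesgue01 E > 0"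
    "\<And>X. X \<in> sets \<mu> \<Longrightarrow> X \<subseteq> E \<Longrightarrow> \<epsilon> * measure lebesgue01 X \<le> measure \<mu> X"
proof -
  have sets: "sets lebesgue01 = sets \<mu>" using sets_circle leb.sets_circle by simp
  let ?N = "\<lambda>n. scale_measure (ennreal (1 / real (Suc n))) lebesgue01"
  have N: "emeasure (?N n) X = ennreal (measure lebesgue01 X / real (Suc n))" for n X
    by (simp add: leb.emeasure_eq_measure ennreal_mult[symmetric])
  have fin: "finite_measure (?N n)" for n
    by (rule finite_measureI, subst N) simp
  have "\<forall>n. \<exists>Y\<in>sets \<mu>. (\<forall>X\<in>sets \<mu>. X \<subseteq> Y \<longrightarrow> ?N n X \<le> \<mu> X) \<and> (\<forall>X\<in>sets \<mu>. X \<inter> Y = {} \<longrightarrow> \<mu> X \<le> ?N n X)"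
    by (intro allI finite_unsigned_Hahn_decomposition fin) (simp_all add: sets finite_measure_axioms)
  then obtain Y where Y: "\<And>n. Y n \<in> sets \<mu>"
    and le: "\<And>n X. X \<in> sets \<mu> \<Longrightarrow> X \<subseteq> Y n \<Longrightarrow> ?N n X \<le> \<mu> X"
    and ge: "\<And>n X. X \<in> sets \<mu> \<Longrightarrow> X \<inter> Y n = {} \<Longrightarrow> \<mu> X \<le> ?N n X"
    by metis
  have "\<exists>n. measure lebesgue01 (Y n) > 0"
  proof (rule ccontr)
    assume "\<not> ?thesis"
    then have Y0: "measure lebesgue01 (Y n) = 0" for n
      by (metis less_eq_real_def measure_nonneg)
    define A where "A = (\<Union>n. Y n)"
    have A: "A \<in> sets \<mu>" unfolding A_def using Y by blast
    have "emeasure lebesgue01 A = 0"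
      unfolding A_def using Y Y0 by (intro emeasure_UN_eq_0) (auto simp: leb.emeasure_eq_measure sets)
    have "measure \<mu> (space \<mu> - A) \<le> 1 / real (Suc n)" for n
    proof -
      have X: "space \<mu> - A \<in> sets \<mu>" using A by (rule sets.compl_sets)
      have "\<mu> (space \<mu> - A) \<le> ?N n (space \<mu> - A)"
        by (rule ge[OF X]) (auto simp: A_def)
      then have "measure \<mu> (space \<mu> - A) \<le> measure lebesgue01 (space \<mu> - A) / real (Suc n)"
        unfolding N by (simp add: emeasure_eq_measure del: of_nat_Suc)
      also have "\<dots> \<le> 1 / real (Suc n)"
        by (intro divide_right_mono) auto
      finally show ?thesis .
    qed
    then have "measure \<mu> (space \<mu> - A) \<le> 0"
      by (intro LIMSEQ_le_const[OF LIMSEQ_inverse_real_of_nat]) (auto simp: inverse_eq_divide)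
    then have "emeasure \<mu> (space \<mu> - A) = 0"
      by (simp add: emeasure_eq_measure measure_le_0_iff)
    then have "mutually_singular \<mu> lebesgue01"
      unfolding mutually_singular_def
      using A \<open>emeasure lebesgue01 A = 0\<close> sets.compl_sets[OF A]
      by (intro bexI[of _ "space \<mu> - A"]) (auto simp: sets double_diff Diff_Diff_Int sets.sets_into_space[OF A, simplified] Int_absorb1)
    with assms show False by simp
  qed
  then obtain n where n: "measure lebesgue01 (Y n) > 0" ..
  show thesis
  proof
    show "Y n \<in> sets \<mu>" by (rule Y)
    show "0 < 1 / real (Suc n)" by simp
    show "measure lebesgue01 (Y n) > 0" by (rule n)
    fix X assume X: "X \<in> sets \<mu>" "X \<subseteq> Y n"
    show "1 / real (Suc n) * measure lebesgue01 X \<le> measure \<mu> X"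
      using le[OF X] unfolding N by (simp add: emeasure_eq_measure del: of_nat_Suc)
  qed
qed

lemma (in circle_prob) integral_minorant:
  assumes E: "E \<in> sets \<mu>" and \<epsilon>: "0 < \<epsilon>"
    and min: "\<And>X. X \<in> sets \<mu> \<Longrightarrow> X \<subseteq> E \<Longrightarrow> \<epsilon> * measure lebesgue01 X \<le> measure \<mu> X"
    and f: "f \<in> borel_measurable borel" "\<And>y. 0 \<le> f y" "\<And>y. f y \<le> B"
  shows "\<epsilon> * (\<integral>y. indicator E y * f y \<partial>lebesgue01) \<le> (\<integral>y. f y \<partial>\<mu>)"
proof -
  have sets: "sets lebesgue01 = sets \<mu>" using sets_circle leb.sets_circle by simp
  have El[measurable]: "E \<in> sets lebesgue01" using E sets by simp
  have fm[measurable]: "f \<in> borel_measurable \<mu>" "f \<in> borel_measurable lebesgue01"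
    using measurable_compose[OF leb.measurable_id_circle f(1)] measurable_compose[OF measurable_id_circle f(1)] by auto
  \<comment> \<open>The assumption says that \<open>\<mu>\<close> dominates this measure.\<close>
  let ?D = "density lebesgue01 (\<lambda>y. ennreal \<epsilon> * indicator E y)"
  have "?D \<le> \<mu>"
  proof (rule le_measure[THEN iffD2, rule_format])
    show "sets ?D = sets \<mu>" by (simp add: sets)
    fix X assume "X \<in> sets ?D"
    then have X: "X \<in> sets \<mu>" "X \<in> sets lebesgue01" by (auto simp: sets)
    have "emeasure ?D X = ennreal \<epsilon> * emeasure lebesgue01 (E \<inter> X)"
      using X El by (simp add: emeasure_density mult.assoc nn_integral_cmult sets.Int flip: indicator_inter_arith)
    also have "\<dots> = ennreal (\<epsilon> * measure lebesgue01 (E \<inter> X))"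
      using \<epsilon> by (simp add: leb.emeasure_eq_measure ennreal_mult)
    also have "\<dots> \<le> emeasure \<mu> (E \<inter> X)"
      using min[of "E \<inter> X"] X E by (simp add: emeasure_eq_measure ennreal_leI)
    also have "\<dots> \<le> emeasure \<mu> X" by (rule emeasure_mono) (use X in auto)
    finally show "emeasure ?D X \<le> emeasure \<mu> X" .
  qed
  then have "(\<integral>\<^sup>+y. f y \<partial>?D) \<le> (\<integral>\<^sup>+y. f y \<partial>\<mu>)"
    by (rule nn_integral_mono_measure[rotated]) (simp add: sets)
  also have "(\<integral>\<^sup>+y. f y \<partial>?D) = (\<integral>\<^sup>+y. ennreal (\<epsilon> * (indicator E y * f y)) \<partial>lebesgue01)"
    using \<epsilon> f(2) by (subst nn_integral_density) (auto intro!: nn_integral_cong simp: ennreal_mult indicator_def)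
  also have "\<dots> = ennreal (\<integral>y. \<epsilon> * (indicator E y * f y) \<partial>lebesgue01)"
  proof (rule nn_integral_eq_integral)
    show "integrable lebesgue01 (\<lambda>y. \<epsilon> * (indicator E y * f y))"
      by (intro integrable_mult_right leb.integrable_bounded[where B = B])
         (use f in \<open>auto simp: abs_mult indicator_def intro: order_trans[OF f(2,3)]\<close>)
  qed (use \<epsilon> f in auto)
  also have "(\<integral>\<^sup>+y. f y \<partial>\<mu>) = ennreal (\<integral>y. f y \<partial>\<mu>)"
    by (rule nn_integral_eq_integral[OF integrable_bounded[where B = B]]) (use f in auto)
  finally show ?thesis
    using f(2) by (subst (asm) ennreal_le_iff) (auto intro: integral_nonneg_AE)
qed

text \<open>The function \<open>C / (C + T)\<close> has nonnegative real part, at least \<open>1/4\<close> where \<open>\<bar>C\<bar> \<ge> T\<close>, and its mean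
  over any circle is its value \<open>1 / (1 + T)\<close> at 0.  Hence Chebyshev's inequality applies: the
  factor \<open>1 / \<bar>C\<bar>\<^sup>2\<close> in the defect is small only on a small set.\<close>

lemma (in circle_prob) measure_large_cauchy_transform:
  assumes r: "0 \<le> r" "r < 1" and T: "T > 0"
  shows "measure lebesgue01 {t \<in> {0..<1}. T \<le> norm (cauchy_transform \<mu> (of_real r * circ t))} \<le> 4 / (1 + T)"
proof -
  let ?C = "\<lambda>t. cauchy_transform \<mu> (of_real r * circ t)"
  let ?A = "{t \<in> {0..<1}. T \<le> norm (?C t)}"
  define f where "f w = cauchy_transform \<mu> w / (cauchy_transform \<mu> w + of_real T)" for w
  note [measurable] = cauchy_transform_measurable'[OF r]
  have A: "?A \<in> sets lebesgue01"
  proof -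
    have "{t \<in> space lebesgue01. T \<le> norm (?C t)} \<in> sets lebesgue01" by measurable
    then show ?thesis by simp
  qed
  have ne: "cauchy_transform \<mu> w + of_real T \<noteq> 0" if "norm w < 1" for w
  proof
    assume "cauchy_transform \<mu> w + of_real T = 0"
    then have "Re (cauchy_transform \<mu> w + of_real T) = 0" by simp
    then show False using Re_cauchy_transform_ge[OF that] T by simp
  qed
  have "f holomorphic_on ball 0 1"
    unfolding f_def using ne by (intro holomorphic_intros holomorphic_cauchy_transform) auto
  from mean_value_circle[OF this r]
  have mv: "(\<integral>t. f (of_real r * circ t) \<partial>lebesgue01) = 1 / (1 + of_real T)"
    by (simp add: f_def cauchy_transform_0)
  have key: "0 \<le> Re (c / (c + of_real T))" "norm (c / (c + of_real T)) \<le> 1"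
      "T \<le> norm c \<Longrightarrow> 1 / 4 \<le> Re (c / (c + of_real T))" if c: "Re c \<ge> 1 / 2" for c
  proof -
    have "c + of_real T \<noteq> 0" using c T by (metis Re_complex_of_real add_pos_pos half_gt_zero_iff less_irrefl linorder_not_less order_less_le_trans plus_complex.sel(1) zero_complex.sel(1) zero_less_divide_1_iff zero_less_numeral)
    then have pos: "(norm (c + of_real T))\<^sup>2 > 0" by simp
    have Re: "Re (c / (c + of_real T)) = ((norm c)\<^sup>2 + T * Re c) / (norm (c + of_real T))\<^sup>2"
      unfolding Re_divide cmod_power2 by (simp add: power2_eq_square algebra_simps)
    show "0 \<le> Re (c / (c + of_real T))" unfolding Re using c T by simp
    have eq: "(norm (c + of_real T))\<^sup>2 = (norm c)\<^sup>2 + 2 * T * Re c + T\<^sup>2"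
      unfolding cmod_power2 by (simp add: power2_eq_square algebra_simps)
    have "(norm c)\<^sup>2 \<le> (norm (c + of_real T))\<^sup>2" unfolding eq using c T by simp
    then have "norm c \<le> norm (c + of_real T)" by (rule power2_le_imp_le) simp
    then show "norm (c / (c + of_real T)) \<le> 1"
      using pos by (simp add: norm_divide divide_le_eq_1)
    show "1 / 4 \<le> Re (c / (c + of_real T))" if "T \<le> norm c"
    proof -
      have *: "b + 2 * x + a \<le> 4 * (b + x)" if "a \<le> b" "0 \<le> x" "0 \<le> b" for a b x :: real
        using that by simp
      have "T\<^sup>2 \<le> (norm c)\<^sup>2" using that T by (intro power_mono) auto
      moreover have "0 \<le> T * Re c" using c T by simp
      ultimately have "(norm (c + of_real T))\<^sup>2 \<le> 4 * ((norm c)\<^sup>2 + T * Re c)"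
        unfolding eq mult.assoc by (rule *) simp
      then show ?thesis unfolding Re using pos by (simp add: field_simps)
    qed
  qed
  have Rew: "Re (?C t) \<ge> 1 / 2" for t using r by (intro Re_cauchy_transform_ge) (simp add: norm_mult)
  have int: "integrable lebesgue01 (\<lambda>t. f (of_real r * circ t))"
    unfolding f_def by (rule leb.integrable_bounded[where B = 1]) (use key(2)[OF Rew] in auto)
  have "1 / 4 * measure lebesgue01 ?A = (\<integral>t. 1 / 4 * indicator ?A t \<partial>lebesgue01)"
  proof -
    have "?A \<inter> space lebesgue01 = ?A" by auto
    then show ?thesis
      by (simp only: integral_mult_right_zero Bochner_Integration.integral_indicator)
  qed
  also have "\<dots> \<le> (\<integral>t. Re (f (of_real r * circ t)) \<partial>lebesgue01)"
  proof (rule integral_mono)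
    show "integrable lebesgue01 (\<lambda>t. 1 / 4 * indicator ?A t :: real)"
      by (rule leb.integrable_bounded[where B = 1]) (use A in \<open>auto simp: indicator_def\<close>)
    show "integrable lebesgue01 (\<lambda>t. Re (f (of_real r * circ t)))" by (rule integrable_Re[OF int])
    show "1 / 4 * indicator ?A t \<le> Re (f (of_real r * circ t))" for t
      using key(1,3)[OF Rew, of t] by (auto simp: f_def indicator_def)
  qed
  also have "\<dots> = Re (1 / (1 + of_real T))"
    using integral_Re[OF int] mv by simp
  also have "\<dots> = 1 / (1 + T)"
    by (metis Re_complex_of_real of_real_1 of_real_add of_real_divide)
  finally show ?thesis by simp
qed

text \<open>Suppose that \<open>\<mu>\<close> dominates \<open>\<epsilon>\<close> times Lebesgue measure on a set \<open>E\<close> of positive measure.  Let \<open>V\<close> be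
  the Poisson integral of Lebesgue measure restricted to \<open>E\<close>, so that \<open>\<epsilon> * V \<le> 2 * Re C - 1\<close> and
  \<open>V \<le> 1\<close>.  Where \<open>\<bar>C\<bar> < T\<close>, the product \<open>V * \<bar>p\<bar>\<^sup>2\<close> is at most \<open>T\<^sup>2 / \<epsilon>\<close> times the defect, whose integral
  tends to 0; the remaining set has measure at most \<open>4 / (1 + T)\<close>.  With \<open>r \<longlongrightarrow> 1\<close> and then
  \<open>T \<longlongrightarrow> \<infinity>\<close> it follows that \<open>\<bar>p\<bar>\<^sup>2\<close> has integral 0 over \<open>E\<close>.  But \<open>p\<close> has finitely many zeros, as its
  constant coefficient is the conjugate of \<open>fourier \<mu> m\<close>.\<close>

lemma (in circle_prob) coeff_sum_imp_singular:
  assumes sum: "suminf (\<lambda>k. (norm (kaczmarz_coeff \<mu> m k))\<^sup>2) = 1"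
    and m: "fourier \<mu> (int m) \<noteq> 0" "m > 0"
  shows "mutually_singular \<mu> lebesgue01"
proof (rule ccontr)
  assume "\<not> mutually_singular \<mu> lebesgue01"
  then obtain E \<epsilon> where E: "E \<in> sets \<mu>" "0 < \<epsilon>" "measure lebesgue01 E > 0"
    and min: "\<And>X. X \<in> sets \<mu> \<Longrightarrow> X \<subseteq> E \<Longrightarrow> \<epsilon> * measure lebesgue01 X \<le> measure \<mu> X"
    by (rule not_singular_imp_minorant) blast
  have sets: "sets lebesgue01 = sets \<mu>" using sets_circle leb.sets_circle by simp
  have El[measurable]: "E \<in> sets lebesgue01" using E sets by simp
  let ?p = "neg_fourier_poly \<mu> m"
  define g where "g t = (norm (?p (circ t)))\<^sup>2" for t
  define L where "L = 2 * real m ^ 3"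
  have L: "L \<ge> 0" by (simp add: L_def)
  have gm: "g \<in> borel_measurable lebesgue01"
  proof -
    note [measurable] = neg_fourier_poly_measurable[of m 1, simplified]
    have "g \<in> borel_measurable borel" unfolding g_def[abs_def] by measurable
    from measurable_compose[OF leb.measurable_id_circle this] show ?thesis by simp
  qed
  have g0: "0 \<le> g t" for t by (simp add: g_def)
  have gB: "\<bar>g t\<bar> \<le> (real m)\<^sup>2" for t
    using neg_fourier_poly_bound[of "circ t" m] by (simp add: g_def power_mono)
  have glip: "\<bar>g t - g s\<bar> \<le> L * norm (circ t - circ s)" for s t
    unfolding g_def L_def by (rule neg_fourier_poly_sq_lipschitz) auto
  let ?D = "\<lambda>r. \<integral>t. defect \<mu> m (of_real r * circ t) \<partial>lebesgue01"
  have D: "(?D \<longlongrightarrow> 0) (at_left 1)"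
    using tendsto_integral_defect[of m] sum by simp
  define G where "G = (\<integral>y. indicator E y * g y \<partial>lebesgue01)"
  \<comment> \<open>the terms account for: the set where \<open>\<bar>C\<bar> \<ge> T\<close>; its complement; the passage of \<open>p\<close> from radius 1 to radius \<open>r\<close>; the smoothing of \<open>\<bar>p\<bar>\<^sup>2\<close> by the Poisson kernel\<close>
  have main: "G \<le> 4 * (real m)\<^sup>2 / (1 + T) + T\<^sup>2 / \<epsilon> * ?D r + L * (1 - r) + L * sqrt ((1 - r\<^sup>2) / r)"
    if r: "0 < r" "r < 1" and T: "0 < T" for r T
  proof -
    have r0: "0 \<le> r" using r by simp
    have w: "norm (of_real r * circ t) < 1" for t using r by (simp add: norm_mult)
    let ?C = "\<lambda>t. cauchy_transform \<mu> (of_real r * circ t)"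
    let ?V = "\<lambda>t. \<integral>y. indicator E y * poisson y (of_real r * circ t) \<partial>lebesgue01"
    let ?A = "{t \<in> {0..<1}. T \<le> norm (?C t)}"
    note [measurable] = cauchy_transform_measurable'[OF r0 r(2)]
    have A[measurable]: "?A \<in> sets lebesgue01"
    proof -
      have "{t \<in> space lebesgue01. T \<le> norm (?C t)} \<in> sets lebesgue01" by measurable
      then show ?thesis by simp
    qed
    have um: "(indicator E :: real \<Rightarrow> real) \<in> borel_measurable lebesgue01" by simp
    have ub: "\<bar>indicator E y :: real\<bar> \<le> 1" for y by (simp add: indicator_def)
    note F = leb.poisson_fubini[OF r0 r(2) gm gB um ub]
    have "\<bar>(\<integral>t. ?V t * g t \<partial>lebesgue01) - G\<bar> \<le> L * sqrt ((1 - r\<^sup>2) / r)"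
      unfolding G_def by (rule leb.poisson_average_diff[OF r L gm gm gB glip um ub])
    then have 1: "G \<le> (\<integral>t. ?V t * g t \<partial>lebesgue01) + L * sqrt ((1 - r\<^sup>2) / r)" by linarith
    have V0: "0 \<le> ?V t" for t
      using poisson_nonneg[OF w] by (intro integral_nonneg_AE AE_I2) (simp add: indicator_def)
    have V1: "?V t \<le> 1" for t
    proof -
      have "?V t \<le> (\<integral>y. poisson y (of_real r * circ t) \<partial>lebesgue01)"
      proof (rule integral_mono)
        show "integrable lebesgue01 (\<lambda>y. indicator E y * poisson y (of_real r * circ t))"
          using leb.integrable_poisson[OF w, of t] El
          by (intro integrable_real_mult_indicator[OF El, unfolded mult.commute[of _ "indicator E _"]])
        show "indicator E y * poisson y (of_real r * circ t) \<le> poisson y (of_real r * circ t)" for y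
          using poisson_nonneg[OF w, of y t] by (simp add: indicator_def)
      qed (rule leb.integrable_poisson[OF w])
      also have "\<dots> = 1"
        unfolding leb.integral_poisson[OF w] cauchy_transform_lebesgue[OF w] by simp
      finally show ?thesis .
    qed
    have VQ: "\<epsilon> * ?V t \<le> 2 * Re (?C t) - 1" for t
      unfolding integral_poisson[OF w, symmetric]
      by (rule integral_minorant[OF E(1,2) min poisson_measurable poisson_nonneg[OF w] poisson_le[OF w]])
    have pt: "?V t * g t \<le> (real m)\<^sup>2 * indicator ?A t + T\<^sup>2 / \<epsilon> * defect \<mu> m (of_real r * circ t) + L * (1 - r)"
      if t: "t \<in> {0..<1}" for t
    proof -
      let ?h = "(norm (?p (of_real r * circ t)))\<^sup>2"
      have hm: "?h \<le> (real m)\<^sup>2"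
        using neg_fourier_poly_bound[of "of_real r * circ t" m] w[of t] by (intro power_mono) auto
      have "norm (circ t - of_real r * circ t) = 1 - r"
      proof -
        have "circ t - of_real r * circ t = of_real (1 - r) * circ t" by (simp add: algebra_simps)
        then show ?thesis using r by (simp add: norm_mult del: of_real_diff)
      qed
      then have "\<bar>g t - ?h\<bar> \<le> L * (1 - r)"
        using neg_fourier_poly_sq_lipschitz[of "circ t" "of_real r * circ t" m] w[of t]
        by (simp add: g_def L_def)
      then have "g t \<le> ?h + L * (1 - r)" by linarith
      then have "?V t * g t \<le> ?V t * (?h + L * (1 - r))"
        using V0 by (rule mult_left_mono)
      also have "\<dots> \<le> ?V t * ?h + L * (1 - r)"
        using mult_right_mono[OF V1[of t], of "L * (1 - r)"] L r by (simp add: distrib_left)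
      also have "?V t * ?h \<le> (real m)\<^sup>2 * indicator ?A t + T\<^sup>2 / \<epsilon> * defect \<mu> m (of_real r * circ t)"
      proof (cases "T \<le> norm (?C t)")
        case True
        have "?V t * ?h \<le> 1 * (real m)\<^sup>2"
          using V0 V1 hm by (intro mult_mono) auto
        moreover have "0 \<le> T\<^sup>2 / \<epsilon> * defect \<mu> m (of_real r * circ t)"
          using E(2) defect_nonneg[OF w] by simp
        ultimately show ?thesis using True t by simp
      next
        case False
        have nz: "(norm (?C t))\<^sup>2 > 0" using cauchy_transform_nonzero[OF w] by simp
        have eq: "?h * (2 * Re (?C t) - 1) = (norm (?C t))\<^sup>2 * defect \<mu> m (of_real r * circ t)"
          using nz by (simp add: defect_def)
        have "\<epsilon> * (?V t * ?h) = ?h * (\<epsilon> * ?V t)" by simp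
        also have "\<dots> \<le> ?h * (2 * Re (?C t) - 1)"
          by (rule mult_left_mono[OF VQ]) simp
        also have "\<dots> \<le> T\<^sup>2 * defect \<mu> m (of_real r * circ t)"
          unfolding eq using False defect_nonneg[OF w]
          by (intro mult_right_mono power_mono) auto
        finally have "?V t * ?h \<le> T\<^sup>2 / \<epsilon> * defect \<mu> m (of_real r * circ t)"
          using E(2) by (simp add: field_simps)
        moreover have "indicator ?A t = (0 :: real)"
          using False by simp
        ultimately show ?thesis by (simp only: mult_zero_right add_0_left)
      qed
      finally show ?thesis by simp
    qed
    have intA: "integrable lebesgue01 (\<lambda>t. (real m)\<^sup>2 * indicator ?A t)"
      by (intro integrable_mult_right leb.integrable_bounded[where B = 1]) (use A in auto)
    have intD: "integrable lebesgue01 (\<lambda>t. T\<^sup>2 / \<epsilon> * defect \<mu> m (of_real r * circ t))"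
      by (intro integrable_mult_right integrable_defect) (use r in auto)
    have "(\<integral>t. ?V t * g t \<partial>lebesgue01)
        \<le> (\<integral>t. (real m)\<^sup>2 * indicator ?A t + T\<^sup>2 / \<epsilon> * defect \<mu> m (of_real r * circ t) + L * (1 - r) \<partial>lebesgue01)"
      by (rule integral_mono[OF F(2)]) (use intA intD pt in auto)
    also have "\<dots> = (\<integral>t. (real m)\<^sup>2 * indicator ?A t \<partial>lebesgue01)
        + (\<integral>t. T\<^sup>2 / \<epsilon> * defect \<mu> m (of_real r * circ t) \<partial>lebesgue01) + L * (1 - r)"
      using intA intD leb.prob_space by simp
    also have "(\<integral>t. (real m)\<^sup>2 * indicator ?A t \<partial>lebesgue01) = (real m)\<^sup>2 * measure lebesgue01 ?A"
    proof -
      have "?A \<inter> space lebesgue01 = ?A" by auto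
      then show ?thesis
        by (simp only: integral_mult_right_zero Bochner_Integration.integral_indicator)
    qed
    also have "(\<integral>t. T\<^sup>2 / \<epsilon> * defect \<mu> m (of_real r * circ t) \<partial>lebesgue01) = T\<^sup>2 / \<epsilon> * ?D r"
      by (rule integral_mult_right_zero)
    also have "(real m)\<^sup>2 * measure lebesgue01 ?A \<le> (real m)\<^sup>2 * (4 / (1 + T))"
      by (intro mult_left_mono measure_large_cauchy_transform[OF r0 r(2) T]) simp
    also have "(real m)\<^sup>2 * (4 / (1 + T)) = 4 * (real m)\<^sup>2 / (1 + T)" by simp
    finally show ?thesis using 1 by linarith
  qed
  have GT: "G \<le> 4 * (real m)\<^sup>2 / (1 + T)" if T: "0 < T" for T
  proof -
    have "((\<lambda>r. 4 * (real m)\<^sup>2 / (1 + T) + T\<^sup>2 / \<epsilon> * ?D r + L * (1 - r) + L * sqrt ((1 - r\<^sup>2) / r))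
        \<longlongrightarrow> 4 * (real m)\<^sup>2 / (1 + T) + T\<^sup>2 / \<epsilon> * 0 + L * (1 - 1) + 0) (at_left 1)"
      by (intro tendsto_intros D tendsto_poisson_error)
    moreover have "\<forall>\<^sub>F r in at_left 1. G \<le> 4 * (real m)\<^sup>2 / (1 + T) + T\<^sup>2 / \<epsilon> * ?D r + L * (1 - r) + L * sqrt ((1 - r\<^sup>2) / r)"
      using eventually_at_left_real[OF zero_less_one] by (rule eventually_mono) (rule main[OF _ _ T]; simp)
    ultimately have "G \<le> 4 * (real m)\<^sup>2 / (1 + T) + T\<^sup>2 / \<epsilon> * 0 + L * (1 - 1) + 0"
      by (intro tendsto_lowerbound[of _ _ "at_left (1::real)"]) auto
    then show ?thesis by simp
  qed
  have "((\<lambda>T. 4 * (real m)\<^sup>2 / (1 + T)) \<longlongrightarrow> 0) at_top"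
    by (intro tendsto_divide_0[OF tendsto_const] filterlim_at_top_imp_at_infinity
        filterlim_tendsto_add_at_top[OF tendsto_const] filterlim_ident)
  then have "G \<le> 0"
    by (rule tendsto_lowerbound) (auto intro: eventually_mono[OF eventually_gt_at_top[of 0]] GT)
  have intG: "integrable lebesgue01 (\<lambda>y. indicator E y * g y)"
    by (rule leb.integrable_bounded[where B = "(real m)\<^sup>2"])
       (use gm gB in \<open>auto simp: abs_mult indicator_def intro: order_trans[OF abs_ge_zero gB]\<close>)
  have "G = 0"
    using \<open>G \<le> 0\<close> g0 unfolding G_def by (intro antisym integral_nonneg_AE) auto
  then have AE: "AE y in lebesgue01. indicator E y * g y = 0"
    unfolding G_def using integral_nonneg_eq_0_iff_AE[OF intG] g0 by simp
  define q where "q = (\<Sum>n<m. monom (fourier \<mu> (int n - int m)) n)"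
  have q: "poly q z = ?p z" for z
    by (simp add: q_def neg_fourier_poly_def poly_sum poly_monom)
  have "poly q 0 = fourier \<mu> (- int m)"
    using m(2) unfolding q neg_fourier_poly_def
    by (subst sum.remove[of _ 0]) (auto simp: power_0_left intro!: sum.neutral)
  then have "q \<noteq> 0" using m(1) by (auto simp: fourier_minus)
  then have "finite {z. poly q z = 0}" by (rule poly_roots_finite)
  then have fin: "finite {y \<in> {0..<1}. g y = 0}"
  proof -
    have "circ ` {y \<in> {0..<1}. g y = 0} \<subseteq> {z. poly q z = 0}" by (auto simp: g_def q)
    then have "finite (circ ` {y \<in> {0..<1}. g y = 0})"
      using \<open>finite {z. poly q z = 0}\<close> by (rule finite_subset)
    then show ?thesis
      by (rule finite_imageD) (rule inj_on_subset[OF inj_on_circ], auto)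
  qed
  let ?Z = "{y \<in> {0..<1}. g y = 0}"
  have Zs: "?Z \<in> sets lebesgue01"
    using fin by (auto simp: leb.sets_circle_iff intro: borel_closed finite_imp_closed)
  have "emeasure lebesgue01 ?Z = emeasure lborel ?Z"
    unfolding lebesgue01_def by (rule emeasure_restrict_space) auto
  also have "\<dots> = 0" using fin by (rule emeasure_lborel_countable[OF countable_finite])
  finally have Z: "emeasure lebesgue01 ?Z = 0" .
  have "AE y in lebesgue01. y \<notin> E"
    using AE AE_not_in[of ?Z lebesgue01] Z Zs AE_space
    by (auto elim!: eventually_elim2 simp: null_sets_def)
  then have "measure lebesgue01 E = 0"
    using leb.prob_eq_0[OF El] by simp
  with E(3) show False by simp
qed

text \<open>The theorem of Kwapien and Mycielski on a single measure, stated in terms of the limiting errors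
  of the vectors \<open>e\<^sub>m\<close>.\<close>

lemma (in circle_prob) coeff_sum_iff:
  "(\<forall>m. suminf (\<lambda>k. (norm (kaczmarz_coeff \<mu> m k))\<^sup>2) = 1) \<longleftrightarrow>
     mutually_singular \<mu> lebesgue01 \<or> \<mu> = lebesgue01"
  using singular_imp_coeff_sum lebesgue_imp_coeff_sum coeff_sum_imp_singular eq_lebesgue_if_fourier_0
  by metis

section \<open>Finite trigonometric combinations\<close>

lemma (in circle_prob) integral_Cauchy_Schwarz:
  assumes f: "f \<in> borel_measurable \<mu>" "\<And>y. norm (f y) \<le> F"
    and g: "g \<in> borel_measurable \<mu>" "\<And>y. norm (g y) \<le> G"
  shows "norm (\<integral>y. f y * cnj (g y) \<partial>\<mu>)
    \<le> sqrt (\<integral>y. (norm (f y))\<^sup>2 \<partial>\<mu>) * sqrt (\<integral>y. (norm (g y))\<^sup>2 \<partial>\<mu>)"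
proof -
  note [measurable] = f(1) g(1)
  have F0: "F \<ge> 0" using f(2) norm_ge_zero order_trans by blast
  have intf: "integrable \<mu> (\<lambda>y. (norm (f y))\<^sup>2)" "integrable \<mu> (\<lambda>y. (norm (g y))\<^sup>2)"
    "integrable \<mu> (\<lambda>y. norm (f y) * norm (g y))"
    by (rule integrable_bounded[where B = "F\<^sup>2"] integrable_bounded[where B = "G\<^sup>2"]
          integrable_bounded[where B = "F * G"],
        use f g F0 in \<open>auto intro!: power_mono mult_mono\<close>)+
  have "(\<integral>\<^sup>+y. ennreal (norm (f y)) * ennreal (norm (g y)) \<partial>\<mu>)\<^sup>2
      \<le> (\<integral>\<^sup>+y. (ennreal (norm (f y)))\<^sup>2 \<partial>\<mu>) * (\<integral>\<^sup>+y. (ennreal (norm (g y)))\<^sup>2 \<partial>\<mu>)"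
    by (rule Cauchy_Schwarz_nn_integral) measurable
  then have "(ennreal (\<integral>y. norm (f y) * norm (g y) \<partial>\<mu>))\<^sup>2
      \<le> ennreal (\<integral>y. (norm (f y))\<^sup>2 \<partial>\<mu>) * ennreal (\<integral>y. (norm (g y))\<^sup>2 \<partial>\<mu>)"
    using intf by (simp add: nn_integral_eq_integral ennreal_power flip: ennreal_mult)
  then have "(\<integral>y. norm (f y) * norm (g y) \<partial>\<mu>)\<^sup>2
      \<le> (\<integral>y. (norm (f y))\<^sup>2 \<partial>\<mu>) * (\<integral>y. (norm (g y))\<^sup>2 \<partial>\<mu>)"
    by (simp add: ennreal_power flip: ennreal_mult)
  then have "(\<integral>y. norm (f y) * norm (g y) \<partial>\<mu>)
      \<le> sqrt ((\<integral>y. (norm (f y))\<^sup>2 \<partial>\<mu>) * (\<integral>y. (norm (g y))\<^sup>2 \<partial>\<mu>))"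
    by (rule real_le_rsqrt)
  moreover have "norm (\<integral>y. f y * cnj (g y) \<partial>\<mu>) \<le> (\<integral>y. norm (f y * cnj (g y)) \<partial>\<mu>)"
    by (rule integral_norm_bound)
  ultimately show ?thesis by (simp add: norm_mult real_sqrt_mult)
qed

text \<open>The element of \<open>L\<^sup>2(\<mu> x)\<close> that \<open>c\<close> stands for; all inner products reduce to integrals of such
  functions.\<close>

definition trig_fun :: "'x::topological_space trig \<Rightarrow> 'x \<Rightarrow> real \<Rightarrow> complex" where
  "trig_fun c x y = (\<Sum>n\<in>Poly_Mapping.keys c. apply_bcontfun (Poly_Mapping.lookup c n) x * circ y ^ n)"

abbreviation trig_exp :: "nat \<Rightarrow> 'x::topological_space trig" where
  "trig_exp n \<equiv> Poly_Mapping.single n (const_bcontfun 1)"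

lemma trig_fun_superset:
  assumes "finite A" "Poly_Mapping.keys c \<subseteq> A"
  shows "trig_fun c x y = (\<Sum>n\<in>A. apply_bcontfun (Poly_Mapping.lookup c n) x * circ y ^ n)"
  unfolding trig_fun_def
  by (rule sum.mono_neutral_left) (use assms in \<open>auto simp: in_keys_iff\<close>)

lemma lookup_trig_smult: "Poly_Mapping.lookup (trig_smult u c) n = CX_mult u (Poly_Mapping.lookup c n)"
  by (auto simp: trig_smult_def map.rep_eq when_def intro!: bcontfun_eqI simp: apply_CX_mult)

lemma trig_fun_add: "trig_fun (c + d) x y = trig_fun c x y + trig_fun d x y"
proof -
  let ?A = "Poly_Mapping.keys c \<union> Poly_Mapping.keys d"
  have "Poly_Mapping.keys (c + d) \<subseteq> ?A" by (rule keys_add)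
  then show ?thesis
    by (simp add: trig_fun_superset[of ?A] lookup_add sum.distrib distrib_right)
qed

lemma trig_fun_smult: "trig_fun (trig_smult u c) x y = apply_bcontfun u x * trig_fun c x y"
proof -
  have "Poly_Mapping.keys (trig_smult u c) \<subseteq> Poly_Mapping.keys c"
    by (auto simp: in_keys_iff lookup_trig_smult intro!: bcontfun_eqI simp: apply_CX_mult)
  then show ?thesis
    by (simp add: trig_fun_superset[of "Poly_Mapping.keys c"] lookup_trig_smult apply_CX_mult
        sum_distrib_left mult.assoc)
qed

lemma trig_fun_diff: "trig_fun (c - d) x y = trig_fun c x y - trig_fun d x y"
  using trig_fun_add[of "c - d" d x y] by simp

lemma trig_fun_exp: "trig_fun (trig_exp n) x y = circ y ^ n"
  by (simp add: trig_fun_superset[of "{n}"])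

lemma trig_smult_minus_1: "trig_smult (const_bcontfun (- 1)) c = - c"
  by (rule poly_mapping_eqI) (auto simp: lookup_trig_smult apply_CX_mult uminus_bcontfun.rep_eq intro!: bcontfun_eqI)

lemma trig_smult_distribs:
  "trig_smult u (c + d) = trig_smult u c + trig_smult u d"
  "trig_smult u (c - d) = trig_smult u c - trig_smult u d"
  "trig_smult (u + v) c = trig_smult u c + trig_smult v c"
  "trig_smult (u - v) c = trig_smult u c - trig_smult v c"
  "trig_smult u (trig_smult v c) = trig_smult (CX_mult u v) c"
  by (rule poly_mapping_eqI; rule bcontfun_eqI;
      simp add: lookup_trig_smult apply_CX_mult lookup_add lookup_minus algebra_simps)+

locale circle_family =
  fixes \<mu> :: "'x::topological_space \<Rightarrow> real measure"
  assumes compact_X: "compact (UNIV :: 'x set)"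
    and family: "borel_prob_family \<mu>"
    and weak: "weakly_continuous \<mu>"
begin

lemma circle_prob: "circle_prob (\<mu> x)"
  using family unfolding borel_prob_family_def circle_prob_def circle_prob_axioms_def by blast

lemma trig_fun_measurable [measurable]: "trig_fun c x \<in> borel_measurable (\<mu> x)"
proof -
  interpret circle_prob "\<mu> x" by (rule circle_prob)
  show ?thesis unfolding trig_fun_def[abs_def] by measurable
qed

definition trig_bound :: "'x trig \<Rightarrow> real" where
  "trig_bound c = (\<Sum>n\<in>Poly_Mapping.keys c. norm (Poly_Mapping.lookup c n))"

lemma norm_trig_fun_le: "norm (trig_fun c x y) \<le> trig_bound c"
  unfolding trig_fun_def trig_bound_def
  by (rule sum_norm_le) (simp add: norm_mult norm_power norm_bounded)

lemma trig_bound_nonneg: "0 \<le> trig_bound c"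
  unfolding trig_bound_def by (intro sum_nonneg) simp

lemma integrable_trig_prod: "integrable (\<mu> x) (\<lambda>y. trig_fun c x y * cnj (trig_fun d x y))"
proof -
  interpret circle_prob "\<mu> x" by (rule circle_prob)
  show ?thesis
  proof (rule integrable_bounded[where B = "trig_bound c * trig_bound d"])
    show "norm (trig_fun c x y * cnj (trig_fun d x y)) \<le> trig_bound c * trig_bound d" for y
      unfolding norm_mult complex_mod_cnj
      by (intro mult_mono norm_trig_fun_le trig_bound_nonneg norm_ge_zero)
  qed measurable
qed

lemma integrable_trig_sq: "integrable (\<mu> x) (\<lambda>y. (norm (trig_fun c x y))\<^sup>2)"
proof -
  interpret circle_prob "\<mu> x" by (rule circle_prob)
  show ?thesis
    by (rule integrable_bounded[where B = "(trig_bound c)\<^sup>2"]) (auto intro!: power_mono norm_trig_fun_le)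
qed

lemma apply_trig_inner_integral:
  "apply_bcontfun (trig_inner \<mu> c d) x = (\<integral>y. trig_fun c x y * cnj (trig_fun d x y) \<partial>\<mu> x)"
proof -
  interpret circle_prob "\<mu> x" by (rule circle_prob)
  have e: "circ y ^ n * cnj (circ y ^ k) = cis (2 * pi * (real n - real k) * y)" for y n k
  proof -
    have "circ y ^ n * cnj (circ y ^ k) = circ y powi (int n - int k)"
      by (simp add: power_int_diff divide_inverse inverse_circ flip: power_inverse)
    then show ?thesis by (simp add: circ_powi)
  qed
  have int: "integrable (\<mu> x) (\<lambda>y. circ y ^ n * cnj (circ y ^ k))" for n k
    by (rule integrable_bounded[where B = 1]) (auto simp: norm_mult norm_power)
  have "(\<integral>y. trig_fun c x y * cnj (trig_fun d x y) \<partial>\<mu> x)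
     = (\<integral>y. (\<Sum>n\<in>Poly_Mapping.keys c. \<Sum>k\<in>Poly_Mapping.keys d.
        apply_bcontfun (Poly_Mapping.lookup c n) x * cnj (apply_bcontfun (Poly_Mapping.lookup d k) x) *
        (circ y ^ n * cnj (circ y ^ k))) \<partial>\<mu> x)"
    unfolding trig_fun_def cnj_sum sum_product complex_cnj_mult by (simp add: mult_ac)
  also have "\<dots> = trig_inner_fun \<mu> c d x"
    unfolding trig_inner_fun_def e[symmetric]
  proof -
    have int': "integrable (\<mu> x) (\<lambda>y. a * (circ y ^ n * cnj (circ y ^ k)))" for a n k
      by (rule integrable_mult_right[OF int])
    show "(\<integral>y. (\<Sum>n\<in>Poly_Mapping.keys c. \<Sum>k\<in>Poly_Mapping.keys d.
        apply_bcontfun (Poly_Mapping.lookup c n) x * cnj (apply_bcontfun (Poly_Mapping.lookup d k) x) *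
        (circ y ^ n * cnj (circ y ^ k))) \<partial>\<mu> x)
      = (\<Sum>n\<in>Poly_Mapping.keys c. \<Sum>k\<in>Poly_Mapping.keys d.
        apply_bcontfun (Poly_Mapping.lookup c n) x * cnj (apply_bcontfun (Poly_Mapping.lookup d k) x) *
        (\<integral>y. circ y ^ n * cnj (circ y ^ k) \<partial>\<mu> x))"
      by (subst Bochner_Integration.integral_sum, (intro Bochner_Integration.integrable_sum int')[1],
          intro sum.cong refl, subst Bochner_Integration.integral_sum, rule int',
          simp only: integral_mult_right_zero)
  qed
  finally show ?thesis
    using apply_trig_inner[OF compact_X weak] by simp
qed

definition fibre_norm_sq :: "'x trig \<Rightarrow> 'x \<Rightarrow> real" where
  "fibre_norm_sq c x = (\<integral>y. (norm (trig_fun c x y))\<^sup>2 \<partial>\<mu> x)"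

lemma fibre_norm_sq_nonneg: "0 \<le> fibre_norm_sq c x"
  unfolding fibre_norm_sq_def by simp

lemma apply_trig_inner_self: "apply_bcontfun (trig_inner \<mu> c c) x = of_real (fibre_norm_sq c x)"
  unfolding apply_trig_inner_integral fibre_norm_sq_def
  by (simp flip: complex_norm_square integral_complex_of_real del: of_real_power)

lemma continuous_fibre_norm_sq: "continuous_on UNIV (fibre_norm_sq c)"
proof -
  have "continuous_on UNIV (\<lambda>x. Re (apply_bcontfun (trig_inner \<mu> c c) x))"
    by (intro continuous_intros) auto
  then show ?thesis by (simp add: apply_trig_inner_self)
qed

lemma trig_norm_nonneg: "0 \<le> trig_norm \<mu> c"
  by (simp add: trig_norm_def)

lemma fibre_norm_sq_le: "fibre_norm_sq c x \<le> (trig_norm \<mu> c)\<^sup>2"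
proof -
  have "norm (apply_bcontfun (trig_inner \<mu> c c) x) \<le> norm (trig_inner \<mu> c c)"
    by (rule norm_bounded)
  then show ?thesis
    using fibre_norm_sq_nonneg[of c x] by (simp add: apply_trig_inner_self trig_norm_def)
qed

lemma sqrt_fibre_norm_sq_le: "sqrt (fibre_norm_sq c x) \<le> trig_norm \<mu> c"
  by (rule real_le_lsqrt[OF trig_norm_nonneg fibre_norm_sq_le])

lemma trig_norm_le:
  assumes "0 \<le> B" "\<And>x. fibre_norm_sq c x \<le> B\<^sup>2"
  shows "trig_norm \<mu> c \<le> B"
proof -
  have "norm (trig_inner \<mu> c c) \<le> B\<^sup>2"
    by (rule norm_bound) (use assms fibre_norm_sq_nonneg in \<open>simp add: apply_trig_inner_self\<close>)
  then show ?thesis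
    unfolding trig_norm_def by (rule real_le_lsqrt[OF assms(1)])
qed

lemma fibre_Cauchy_Schwarz:
  "norm (apply_bcontfun (trig_inner \<mu> c d) x) \<le> sqrt (fibre_norm_sq c x) * sqrt (fibre_norm_sq d x)"
  unfolding apply_trig_inner_integral fibre_norm_sq_def
  by (rule circle_prob.integral_Cauchy_Schwarz[OF circle_prob])
     (auto intro: norm_trig_fun_le)

lemma norm_trig_inner_le: "norm (trig_inner \<mu> c d) \<le> trig_norm \<mu> c * trig_norm \<mu> d"
proof (rule norm_bound)
  fix x
  have "sqrt (fibre_norm_sq c x) * sqrt (fibre_norm_sq d x) \<le> trig_norm \<mu> c * trig_norm \<mu> d"
    by (intro mult_mono sqrt_fibre_norm_sq_le) (auto simp: fibre_norm_sq_nonneg trig_norm_nonneg)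
  then show "norm (apply_bcontfun (trig_inner \<mu> c d) x) \<le> trig_norm \<mu> c * trig_norm \<mu> d"
    using fibre_Cauchy_Schwarz[of c d x] by linarith
qed

lemma fibre_norm_sq_add:
  "fibre_norm_sq (c + d) x = fibre_norm_sq c x + fibre_norm_sq d x + 2 * Re (apply_bcontfun (trig_inner \<mu> c d) x)"
proof -
  have pt: "(norm (trig_fun (c + d) x y))\<^sup>2
      = (norm (trig_fun c x y))\<^sup>2 + (norm (trig_fun d x y))\<^sup>2 + 2 * Re (trig_fun c x y * cnj (trig_fun d x y))" for y
    unfolding trig_fun_add cmod_power2 by (simp add: power2_eq_square algebra_simps)
  have "integrable (\<mu> x) (\<lambda>y. 2 * Re (trig_fun c x y * cnj (trig_fun d x y)))"
    by (intro integrable_mult_right integrable_Re integrable_trig_prod)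
  then show ?thesis
    unfolding fibre_norm_sq_def pt apply_trig_inner_integral
    by (simp add: integrable_trig_sq integral_Re[OF integrable_trig_prod] del: times_complex.sel)
qed

lemma trig_norm_triangle: "trig_norm \<mu> (c + d) \<le> trig_norm \<mu> c + trig_norm \<mu> d"
proof (rule trig_norm_le)
  fix x
  have "Re (apply_bcontfun (trig_inner \<mu> c d) x) \<le> norm (trig_inner \<mu> c d)"
    by (rule order_trans[OF complex_Re_le_cmod norm_bounded])
  also have "\<dots> \<le> trig_norm \<mu> c * trig_norm \<mu> d" by (rule norm_trig_inner_le)
  finally show "fibre_norm_sq (c + d) x \<le> (trig_norm \<mu> c + trig_norm \<mu> d)\<^sup>2"
    unfolding fibre_norm_sq_add power2_sum using fibre_norm_sq_le[of c x] fibre_norm_sq_le[of d x] by linarith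
qed (simp add: trig_norm_nonneg)

lemma fibre_norm_sq_smult: "fibre_norm_sq (trig_smult u c) x = (norm (apply_bcontfun u x))\<^sup>2 * fibre_norm_sq c x"
  unfolding fibre_norm_sq_def trig_fun_smult by (simp add: norm_mult power_mult_distrib)

lemma trig_norm_smult: "trig_norm \<mu> (trig_smult u c) \<le> norm u * trig_norm \<mu> c"
proof (rule trig_norm_le)
  fix x
  show "fibre_norm_sq (trig_smult u c) x \<le> (norm u * trig_norm \<mu> c)\<^sup>2"
    unfolding fibre_norm_sq_smult power_mult_distrib
    by (intro mult_mono power_mono norm_bounded fibre_norm_sq_le) (auto simp: fibre_norm_sq_nonneg)
qed (simp add: trig_norm_nonneg)

lemma trig_norm_uminus: "trig_norm \<mu> (- c) = trig_norm \<mu> c"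
proof -
  have "trig_inner \<mu> (- c) (- c) = trig_inner \<mu> c c"
    by (rule bcontfun_eqI) (simp add: apply_trig_inner_integral trig_fun_diff[of 0 c, simplified] trig_fun_def[of 0])
  then show ?thesis by (simp add: trig_norm_def)
qed

lemma trig_norm_minus_commute: "trig_norm \<mu> (c - d) = trig_norm \<mu> (d - c)"
  using trig_norm_uminus[of "c - d"] by simp

lemma trig_norm_0: "trig_norm \<mu> 0 = 0"
  using trig_norm_le[of 0 0] trig_norm_nonneg[of 0]
  by (simp add: fibre_norm_sq_def trig_fun_def)

lemma trig_norm_triangle_diff: "trig_norm \<mu> (a - c) \<le> trig_norm \<mu> (a - b) + trig_norm \<mu> (b - c)"
  using trig_norm_triangle[of "a - b" "b - c"] by simp

lemma trig_norm_le_add_diff: "trig_norm \<mu> a \<le> trig_norm \<mu> b + trig_norm \<mu> (a - b)"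
  using trig_norm_triangle[of b "a - b"] by simp

lemma trig_inner_diff:
  "trig_inner \<mu> (a - b) d = trig_inner \<mu> a d - trig_inner \<mu> b d"
  "trig_inner \<mu> d (a - b) = trig_inner \<mu> d a - trig_inner \<mu> d b"
  by (rule bcontfun_eqI;
      simp add: apply_trig_inner_integral trig_fun_diff left_diff_distrib right_diff_distrib integrable_trig_prod)+

lemma trig_inner_smult: "trig_inner \<mu> (trig_smult u c) d = CX_mult u (trig_inner \<mu> c d)"
  by (rule bcontfun_eqI) (simp add: apply_trig_inner_integral trig_fun_smult apply_CX_mult mult.assoc)

lemma trig_inner_exp_self: "trig_inner \<mu> (trig_exp n) (trig_exp n) = const_bcontfun 1"
proof (rule bcontfun_eqI)
  fix x
  interpret circle_prob "\<mu> x" by (rule circle_prob)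
  show "apply_bcontfun (trig_inner \<mu> (trig_exp n) (trig_exp n)) x = apply_bcontfun (const_bcontfun 1) x"
    using prob_space by (simp add: apply_trig_inner_integral trig_fun_exp power_mult_distrib[symmetric])
qed

lemma trig_norm_exp: "trig_norm \<mu> (trig_exp n) \<le> 1"
  by (rule trig_norm_le) (use apply_trig_inner_self[of "trig_exp n"] trig_inner_exp_self[of n] in \<open>auto simp: of_real_eq_1_iff\<close>)

end

section \<open>The completion and the reduction to fibres\<close>

text \<open>The error \<open>c - f\<^bsub>n-1\<^esub>\<close> before step \<open>n\<close>.  In contrast to the approximations, the errors form a
  linear recursion, and each step is an orthogonal projection in every fibre.\<close>

primrec trig_residual :: "('x::topological_space \<Rightarrow> real measure) \<Rightarrow> 'x trig \<Rightarrow> nat \<Rightarrow> 'x trig" where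
  "trig_residual \<mu> c 0 = c"
| "trig_residual \<mu> c (Suc n) = trig_residual \<mu> c n
     - trig_smult (trig_inner \<mu> (trig_residual \<mu> c n) (trig_exp n)) (trig_exp n)"

definition WC_class :: "('x::topological_space \<Rightarrow> real measure) \<Rightarrow> (nat \<Rightarrow> 'x trig) \<Rightarrow> (nat \<Rightarrow> 'x trig) set" where
  "WC_class \<mu> a = trig_equiv \<mu> `` {a}"

text \<open>Dini's theorem: the open sets \<open>{x. F n x < e}\<close> increase and cover the compact space.\<close>

lemma Dini_compact:
  fixes F :: "nat \<Rightarrow> 'x::topological_space \<Rightarrow> real"
  assumes comp: "compact (UNIV :: 'x set)"
    and cont: "\<And>n. continuous_on UNIV (F n)" and dec: "\<And>n x. F (Suc n) x \<le> F n x"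
    and lim: "\<And>x. (\<lambda>n. F n x) \<longlonglongrightarrow> 0" and e: "0 < e"
  shows "\<exists>N. \<forall>n\<ge>N. \<forall>x. F n x < e"
proof -
  define U where "U n = {x. F n x < e}" for n
  have "open (U n)" for n
    unfolding U_def by (rule open_Collect_less[OF cont continuous_on_const])
  moreover have "UNIV \<subseteq> (\<Union>n\<in>UNIV. U n)"
  proof
    fix x
    have "\<forall>\<^sub>F n in sequentially. F n x < e" using lim e by (rule order_tendstoD)
    then show "x \<in> (\<Union>n\<in>UNIV. U n)" by (auto simp: U_def eventually_sequentially)
  qed
  ultimately obtain I where I: "finite I" "UNIV \<subseteq> (\<Union>n\<in>I. U n)"
    using compactE_image[OF comp, of UNIV U] by metis
  have mono: "F n x \<le> F k x" if "k \<le> n" for n k x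
    using dec that by (rule lift_Suc_antimono_le)
  show ?thesis
  proof (intro exI allI impI)
    fix n x assume n: "Max (insert 0 I) \<le> n"
    obtain k where k: "k \<in> I" "F k x < e" using I(2) by (auto simp: U_def)
    then have "k \<le> n" using n I(1) by (meson Max_ge finite_insert insertCI le_trans)
    with mono k show "F n x < e" by (meson le_less_trans)
  qed
qed

text \<open>A Cauchy sequence converges pointwise, and the convergence to the pointwise limit is uniform.\<close>

lemma Cauchy_bcontfun_convergent:
  fixes f :: "nat \<Rightarrow> 'x::topological_space \<Rightarrow>\<^sub>C 'b::complete_space"
  assumes "Cauchy f"
  shows "convergent f"
proof -
  have "Cauchy (\<lambda>n. apply_bcontfun (f n) x)" for x
    using assms unfolding Cauchy_def by (meson dist_bounded order_le_less_trans)
  then have lim: "(\<lambda>n. apply_bcontfun (f n) x) \<longlonglongrightarrow> lim (\<lambda>n. apply_bcontfun (f n) x)" for x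
    by (simp add: Cauchy_convergent_iff convergent_LIMSEQ_iff)
  have "uniform_limit UNIV (\<lambda>n. apply_bcontfun (f n)) (\<lambda>x. lim (\<lambda>n. apply_bcontfun (f n) x)) sequentially"
  proof (rule uniform_limitI)
    fix e :: real assume "e > 0"
    then have "e / 2 > 0" by simp
    then obtain N where N: "\<And>m n. m \<ge> N \<Longrightarrow> n \<ge> N \<Longrightarrow> dist (f m) (f n) < e / 2"
      using assms unfolding Cauchy_def by blast
    have "dist (apply_bcontfun (f n) x) (lim (\<lambda>n. apply_bcontfun (f n) x)) < e" if "n \<ge> N" for n x
    proof -
      have "dist (apply_bcontfun (f n) x) (lim (\<lambda>n. apply_bcontfun (f n) x)) \<le> e / 2"
      proof (rule tendsto_upperbound)
        show "(\<lambda>m. dist (apply_bcontfun (f n) x) (apply_bcontfun (f m) x))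
            \<longlonglongrightarrow> dist (apply_bcontfun (f n) x) (lim (\<lambda>n. apply_bcontfun (f n) x))"
          by (intro tendsto_intros lim)
        show "\<forall>\<^sub>F m in sequentially. dist (apply_bcontfun (f n) x) (apply_bcontfun (f m) x) \<le> e / 2"
          using eventually_ge_at_top[of N]
        proof eventually_elim
          case (elim m)
          then show ?case
            using N[OF that elim] dist_bounded[of "f n" x "f m"] by linarith
        qed
      qed simp
      with \<open>e > 0\<close> show ?thesis by simp
    qed
    then show "\<forall>\<^sub>F n in sequentially. \<forall>x\<in>UNIV. dist (apply_bcontfun (f n) x) (lim (\<lambda>n. apply_bcontfun (f n) x)) < e"
      by (auto simp: eventually_sequentially)
  qed
  then obtain l where "f \<longlonglongrightarrow> l"
    by (rule uniform_limit_bcontfunE) simp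
  then show ?thesis by (rule convergentI)
qed

context circle_family begin

lemma trig_CauchyD:
  assumes "a \<in> trig_Cauchy \<mu>" "e > 0"
  obtains N where "\<And>m n. m \<ge> N \<Longrightarrow> n \<ge> N \<Longrightarrow> trig_norm \<mu> (a m - a n) < e"
  using assms unfolding trig_Cauchy_def by blast

lemma trig_CauchyI:
  assumes a: "a \<in> trig_Cauchy \<mu>" and le: "\<And>m n. trig_norm \<mu> (b m - b n) \<le> K * trig_norm \<mu> (a m - a n)"
  shows "b \<in> trig_Cauchy \<mu>"
  unfolding trig_Cauchy_def
proof (intro CollectI allI impI)
  fix \<epsilon> :: real assume \<epsilon>: "\<epsilon> > 0"
  \<comment> \<open>\<open>K\<close> may be 0 or negative, but is used as a divisor\<close>
  define K' where "K' = max 1 K"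
  have K': "K' > 0" "K \<le> K'" by (auto simp: K'_def)
  then have "\<epsilon> / K' > 0" using \<epsilon> by simp
  then obtain N where N: "\<And>m n. m \<ge> N \<Longrightarrow> n \<ge> N \<Longrightarrow> trig_norm \<mu> (a m - a n) < \<epsilon> / K'"
    using trig_CauchyD[OF a] by metis
  have "trig_norm \<mu> (b m - b n) < \<epsilon>" if "m \<ge> N" "n \<ge> N" for m n
  proof -
    have "trig_norm \<mu> (b m - b n) \<le> K' * trig_norm \<mu> (a m - a n)"
      using le[of m n] mult_right_mono[OF K'(2) trig_norm_nonneg[of "a m - a n"]] by linarith
    also have "\<dots> < \<epsilon>"
      using N[OF that] K' by (simp add: field_simps)
    finally show ?thesis .
  qed
  then show "\<exists>N. \<forall>m\<ge>N. \<forall>n\<ge>N. trig_norm \<mu> (b m - b n) < \<epsilon>" by blast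
qed

lemma const_Cauchy: "(\<lambda>_. c) \<in> trig_Cauchy \<mu>"
  by (auto simp: trig_Cauchy_def trig_norm_0)

lemma add_Cauchy:
  assumes "a \<in> trig_Cauchy \<mu>" "b \<in> trig_Cauchy \<mu>"
  shows "(\<lambda>k. a k + b k) \<in> trig_Cauchy \<mu>"
  unfolding trig_Cauchy_def
proof (intro CollectI allI impI)
  fix \<epsilon> :: real assume "\<epsilon> > 0"
  then have "\<epsilon> / 2 > 0" by simp
  then obtain N1 N2 where N: "\<And>m n. m \<ge> N1 \<Longrightarrow> n \<ge> N1 \<Longrightarrow> trig_norm \<mu> (a m - a n) < \<epsilon> / 2"
    "\<And>m n. m \<ge> N2 \<Longrightarrow> n \<ge> N2 \<Longrightarrow> trig_norm \<mu> (b m - b n) < \<epsilon> / 2"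
    using trig_CauchyD[OF assms(1)] trig_CauchyD[OF assms(2)] by metis
  have "trig_norm \<mu> ((a m + b m) - (a n + b n)) < \<epsilon>" if "m \<ge> max N1 N2" "n \<ge> max N1 N2" for m n
  proof -
    have eq: "(a m + b m) - (a n + b n) = (a m - a n) + (b m - b n)" by simp
    have "trig_norm \<mu> (a m - a n) < \<epsilon> / 2" "trig_norm \<mu> (b m - b n) < \<epsilon> / 2"
      using N that by auto
    then show ?thesis
      unfolding eq using trig_norm_triangle[of "a m - a n" "b m - b n"] by linarith
  qed
  then show "\<exists>N. \<forall>m\<ge>N. \<forall>n\<ge>N. trig_norm \<mu> ((a m + b m) - (a n + b n)) < \<epsilon>" by blast
qed

lemma smult_Cauchy:
  assumes "a \<in> trig_Cauchy \<mu>"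
  shows "(\<lambda>k. trig_smult u (a k)) \<in> trig_Cauchy \<mu>"
  by (rule trig_CauchyI[OF assms, where K = "norm u"])
     (simp add: trig_norm_smult flip: trig_smult_distribs)

lemma null_plus_Cauchy:
  assumes "a \<in> trig_Cauchy \<mu>" "(\<lambda>k. trig_norm \<mu> (a k - b k)) \<longlonglongrightarrow> 0"
  shows "b \<in> trig_Cauchy \<mu>"
  unfolding trig_Cauchy_def
proof (intro CollectI allI impI)
  fix \<epsilon> :: real assume "\<epsilon> > 0"
  then have e: "\<epsilon> / 3 > 0" by simp
  obtain N1 where N1: "\<And>m n. m \<ge> N1 \<Longrightarrow> n \<ge> N1 \<Longrightarrow> trig_norm \<mu> (a m - a n) < \<epsilon> / 3"
    using trig_CauchyD[OF assms(1) e] by blast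
  obtain N2 where N2: "\<And>k. k \<ge> N2 \<Longrightarrow> trig_norm \<mu> (a k - b k) < \<epsilon> / 3"
    using order_tendstoD(2)[OF assms(2) e] by (auto simp: eventually_sequentially)
  have "trig_norm \<mu> (b m - b n) < \<epsilon>" if "m \<ge> max N1 N2" "n \<ge> max N1 N2" for m n
    using trig_norm_triangle_diff[of "b m" "b n" "a m"] trig_norm_triangle_diff[of "a m" "b n" "a n"]
      trig_norm_minus_commute[of "b m" "a m"] N1[of m n] N2[of m] N2[of n] that by simp
  then show "\<exists>N. \<forall>m\<ge>N. \<forall>n\<ge>N. trig_norm \<mu> (b m - b n) < \<epsilon>" by blast
qed

lemma null_trig_sandwich:
  assumes "(\<lambda>k. s k) \<longlonglongrightarrow> 0" "\<And>k. trig_norm \<mu> (a k) \<le> s k"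
  shows "(\<lambda>k. trig_norm \<mu> (a k)) \<longlonglongrightarrow> 0"
  by (rule tendsto_sandwich[OF _ _ tendsto_const assms(1)]) (use assms(2) trig_norm_nonneg in auto)

lemma equiv_trig_equiv: "equiv (trig_Cauchy \<mu>) (trig_equiv \<mu>)"
proof (rule equivI)
  show "trig_equiv \<mu> \<subseteq> trig_Cauchy \<mu> \<times> trig_Cauchy \<mu>" by (auto simp: trig_equiv_def)
  show "refl_on (trig_Cauchy \<mu>) (trig_equiv \<mu>)"
    by (auto simp: refl_on_def trig_equiv_def trig_norm_0)
  show "sym (trig_equiv \<mu>)"
    by (auto simp: sym_def trig_equiv_def trig_norm_minus_commute)
  show "trans (trig_equiv \<mu>)"
  proof (rule transI)
    fix a b c assume "(a, b) \<in> trig_equiv \<mu>" "(b, c) \<in> trig_equiv \<mu>"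
    then have *: "(\<lambda>k. trig_norm \<mu> (a k - b k) + trig_norm \<mu> (b k - c k)) \<longlonglongrightarrow> 0"
      and ac: "a \<in> trig_Cauchy \<mu>" "c \<in> trig_Cauchy \<mu>"
      by (auto simp: trig_equiv_def intro: tendsto_add_zero)
    have "(\<lambda>k. trig_norm \<mu> (a k - c k)) \<longlonglongrightarrow> 0"
      by (rule null_trig_sandwich[OF *]) (rule trig_norm_triangle_diff)
    with ac show "(a, c) \<in> trig_equiv \<mu>" by (simp add: trig_equiv_def)
  qed
qed

lemma WC_class_eqI:
  assumes "a \<in> trig_Cauchy \<mu>" "(\<lambda>k. trig_norm \<mu> (a k - b k)) \<longlonglongrightarrow> 0"
  shows "WC_class \<mu> a = WC_class \<mu> b"
  unfolding WC_class_def
  by (rule equiv_class_eq[OF equiv_trig_equiv])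
     (use assms null_plus_Cauchy[OF assms] in \<open>simp add: trig_equiv_def\<close>)

lemma carrier_WC: "A \<in> hcarrier (WC \<mu>) \<longleftrightarrow> (\<exists>a\<in>trig_Cauchy \<mu>. A = WC_class \<mu> a)"
  by (auto simp: WC_def WC_class_def quotient_def)

lemma hadd_WC:
  assumes "a \<in> trig_Cauchy \<mu>" "b \<in> trig_Cauchy \<mu>"
  shows "hadd (WC \<mu>) (WC_class \<mu> a) (WC_class \<mu> b) = WC_class \<mu> (\<lambda>k. a k + b k)"
proof -
  have "congruent2 (trig_equiv \<mu>) (trig_equiv \<mu>) (\<lambda>a b. WC_class \<mu> (\<lambda>k. a k + b k))"
  proof (rule congruent2I')
    fix a a' b b' assume "(a, a') \<in> trig_equiv \<mu>" "(b, b') \<in> trig_equiv \<mu>"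
    then have C: "a \<in> trig_Cauchy \<mu>" "b \<in> trig_Cauchy \<mu>"
      and *: "(\<lambda>k. trig_norm \<mu> (a k - a' k) + trig_norm \<mu> (b k - b' k)) \<longlonglongrightarrow> 0"
      by (auto simp: trig_equiv_def intro: tendsto_add_zero)
    show "WC_class \<mu> (\<lambda>k. a k + b k) = WC_class \<mu> (\<lambda>k. a' k + b' k)"
    proof (rule WC_class_eqI[OF add_Cauchy[OF C] null_trig_sandwich[OF *]])
      fix k
      have eq: "(a k + b k) - (a' k + b' k) = (a k - a' k) + (b k - b' k)" by simp
      show "trig_norm \<mu> ((a k + b k) - (a' k + b' k)) \<le> trig_norm \<mu> (a k - a' k) + trig_norm \<mu> (b k - b' k)"
        unfolding eq by (rule trig_norm_triangle)
    qed
  qed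
  from UN_equiv_class2[OF equiv_trig_equiv equiv_trig_equiv this assms]
  show ?thesis by (simp add: WC_def WC_class_def)
qed

lemma hsmult_WC:
  assumes "a \<in> trig_Cauchy \<mu>"
  shows "hsmult (WC \<mu>) u (WC_class \<mu> a) = WC_class \<mu> (\<lambda>k. trig_smult u (a k))"
proof -
  have "(\<lambda>a. WC_class \<mu> (\<lambda>k. trig_smult u (a k))) respects (trig_equiv \<mu>)"
  proof (rule congruentI)
    fix a a' assume "(a, a') \<in> trig_equiv \<mu>"
    then have C: "a \<in> trig_Cauchy \<mu>" and *: "(\<lambda>k. norm u * trig_norm \<mu> (a k - a' k)) \<longlonglongrightarrow> 0"
      by (auto simp: trig_equiv_def intro: tendsto_mult_right_zero)
    show "WC_class \<mu> (\<lambda>k. trig_smult u (a k)) = WC_class \<mu> (\<lambda>k. trig_smult u (a' k))"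
      by (rule WC_class_eqI[OF smult_Cauchy[OF C] null_trig_sandwich[OF *]])
         (simp add: trig_norm_smult flip: trig_smult_distribs)
  qed
  from UN_equiv_class[OF equiv_trig_equiv this assms]
  show ?thesis by (simp add: WC_def WC_class_def)
qed

lemma hminus_WC:
  assumes "a \<in> trig_Cauchy \<mu>" "b \<in> trig_Cauchy \<mu>"
  shows "hminus (WC \<mu>) (WC_class \<mu> a) (WC_class \<mu> b) = WC_class \<mu> (\<lambda>k. a k - b k)"
  using hadd_WC[OF assms(1) smult_Cauchy[OF assms(2), of "const_bcontfun (- 1)"]] assms(2)
  by (simp add: hminus_def hsmult_WC trig_smult_minus_1)

lemma Cauchy_bounded:
  assumes "a \<in> trig_Cauchy \<mu>"
  obtains N B where "\<And>k. k \<ge> N \<Longrightarrow> trig_norm \<mu> (a k) \<le> B"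
proof -
  obtain N where N: "\<And>m n. m \<ge> N \<Longrightarrow> n \<ge> N \<Longrightarrow> trig_norm \<mu> (a m - a n) < 1"
    using trig_CauchyD[OF assms zero_less_one] by blast
  have "trig_norm \<mu> (a k) \<le> trig_norm \<mu> (a N) + 1" if "k \<ge> N" for k
    using trig_norm_le_add_diff[of "a k" "a N"] N[of k N] that by simp
  then show thesis using that by blast
qed

lemma trig_inner_diff_le:
  "norm (trig_inner \<mu> a b - trig_inner \<mu> a' b')
    \<le> trig_norm \<mu> (a - a') * trig_norm \<mu> b + trig_norm \<mu> a' * trig_norm \<mu> (b - b')"
proof -
  have "trig_inner \<mu> a b - trig_inner \<mu> a' b' = trig_inner \<mu> (a - a') b + trig_inner \<mu> a' (b - b')"
    by (simp add: trig_inner_diff)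
  then have "norm (trig_inner \<mu> a b - trig_inner \<mu> a' b')
      \<le> norm (trig_inner \<mu> (a - a') b) + norm (trig_inner \<mu> a' (b - b'))"
    by (simp only: norm_triangle_ineq)
  also have "\<dots> \<le> trig_norm \<mu> (a - a') * trig_norm \<mu> b + trig_norm \<mu> a' * trig_norm \<mu> (b - b')"
    by (intro add_mono norm_trig_inner_le)
  finally show ?thesis .
qed

lemma convergent_trig_inner:
  assumes a: "a \<in> trig_Cauchy \<mu>" and b: "b \<in> trig_Cauchy \<mu>"
  shows "convergent (\<lambda>k. trig_inner \<mu> (a k) (b k))"
proof -
  obtain N1 A where A: "\<And>k. k \<ge> N1 \<Longrightarrow> trig_norm \<mu> (a k) \<le> A" using Cauchy_bounded[OF a] by blast
  obtain N2 B where B: "\<And>k. k \<ge> N2 \<Longrightarrow> trig_norm \<mu> (b k) \<le> B" using Cauchy_bounded[OF b] by blast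
  define K where "K = max 1 (max A B)"
  have K: "K > 0" "A \<le> K" "B \<le> K" by (auto simp: K_def)
  have "Cauchy (\<lambda>k. trig_inner \<mu> (a k) (b k))"
  proof (rule CauchyI)
    fix e :: real assume "0 < e"
    then have e: "e / (2 * K) > 0" using K by simp
    obtain M1 where M1: "\<And>m n. m \<ge> M1 \<Longrightarrow> n \<ge> M1 \<Longrightarrow> trig_norm \<mu> (a m - a n) < e / (2 * K)"
      using trig_CauchyD[OF a e] by blast
    obtain M2 where M2: "\<And>m n. m \<ge> M2 \<Longrightarrow> n \<ge> M2 \<Longrightarrow> trig_norm \<mu> (b m - b n) < e / (2 * K)"
      using trig_CauchyD[OF b e] by blast
    have "norm (trig_inner \<mu> (a m) (b m) - trig_inner \<mu> (a n) (b n)) < e"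
      if mn: "m \<ge> max (max N1 N2) (max M1 M2)" "n \<ge> max (max N1 N2) (max M1 M2)" for m n
    proof -
      have "trig_norm \<mu> (a m - a n) * trig_norm \<mu> (b m) \<le> trig_norm \<mu> (a m - a n) * K"
        using B[of m] K mn by (intro mult_left_mono trig_norm_nonneg) auto
      also have "\<dots> < e / (2 * K) * K"
        using M1[of m n] K mn by (intro mult_strict_right_mono) auto
      finally have 1: "trig_norm \<mu> (a m - a n) * trig_norm \<mu> (b m) < e / 2" using K by simp
      have "trig_norm \<mu> (a n) * trig_norm \<mu> (b m - b n) \<le> K * trig_norm \<mu> (b m - b n)"
        using A[of n] K mn by (intro mult_right_mono trig_norm_nonneg) auto
      also have "\<dots> < K * (e / (2 * K))"
        using M2[of m n] K mn by (intro mult_strict_left_mono) auto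
      finally have 2: "trig_norm \<mu> (a n) * trig_norm \<mu> (b m - b n) < e / 2" using K by simp
      show ?thesis
        using trig_inner_diff_le[of "a m" "b m" "a n" "b n"] 1 2 by linarith
    qed
    then show "\<exists>M. \<forall>m\<ge>M. \<forall>n\<ge>M. norm (trig_inner \<mu> (a m) (b m) - trig_inner \<mu> (a n) (b n)) < e" by blast
  qed
  then show ?thesis by (rule Cauchy_bcontfun_convergent)
qed

lemma trig_inner_limit_cong:
  assumes a: "(a, a') \<in> trig_equiv \<mu>" and b: "(b, b') \<in> trig_equiv \<mu>"
    and z: "(\<lambda>k. trig_inner \<mu> (a k) (b k)) \<longlonglongrightarrow> z"
  shows "(\<lambda>k. trig_inner \<mu> (a' k) (b' k)) \<longlonglongrightarrow> z"
proof -
  have ab: "a' \<in> trig_Cauchy \<mu>" "b \<in> trig_Cauchy \<mu>"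
    and lim: "(\<lambda>k. trig_norm \<mu> (a k - a' k)) \<longlonglongrightarrow> 0" "(\<lambda>k. trig_norm \<mu> (b k - b' k)) \<longlonglongrightarrow> 0"
    using a b by (auto simp: trig_equiv_def)
  obtain N1 A where A: "\<And>k. k \<ge> N1 \<Longrightarrow> trig_norm \<mu> (a' k) \<le> A" using Cauchy_bounded[OF ab(1)] by blast
  obtain N2 B where B: "\<And>k. k \<ge> N2 \<Longrightarrow> trig_norm \<mu> (b k) \<le> B" using Cauchy_bounded[OF ab(2)] by blast
  have "(\<lambda>k. trig_inner \<mu> (a k) (b k) - trig_inner \<mu> (a' k) (b' k)) \<longlonglongrightarrow> 0"
  proof (rule Lim_null_comparison)
    show "\<forall>\<^sub>F k in sequentially. norm (trig_inner \<mu> (a k) (b k) - trig_inner \<mu> (a' k) (b' k))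
        \<le> trig_norm \<mu> (a k - a' k) * B + A * trig_norm \<mu> (b k - b' k)"
      using eventually_ge_at_top[of "max N1 N2"]
    proof eventually_elim
      case (elim k)
      have "trig_norm \<mu> (a k - a' k) * trig_norm \<mu> (b k) + trig_norm \<mu> (a' k) * trig_norm \<mu> (b k - b' k)
          \<le> trig_norm \<mu> (a k - a' k) * B + A * trig_norm \<mu> (b k - b' k)"
        using A[of k] B[of k] elim
        by (intro add_mono mult_left_mono mult_right_mono trig_norm_nonneg) auto
      then show ?case using trig_inner_diff_le[of "a k" "b k" "a' k" "b' k"] by linarith
    qed
    show "(\<lambda>k. trig_norm \<mu> (a k - a' k) * B + A * trig_norm \<mu> (b k - b' k)) \<longlonglongrightarrow> 0"
      by (rule tendsto_eq_intros lim refl)+ simp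
  qed
  from tendsto_diff[OF z this] show ?thesis by simp
qed

lemma hinner_WC:
  assumes a: "a \<in> trig_Cauchy \<mu>" and b: "b \<in> trig_Cauchy \<mu>"
    and z: "(\<lambda>k. trig_inner \<mu> (a k) (b k)) \<longlonglongrightarrow> z"
  shows "hinner (WC \<mu>) (WC_class \<mu> a) (WC_class \<mu> b) = z"
proof -
  have "(THE z. \<forall>a'\<in>WC_class \<mu> a. \<forall>b'\<in>WC_class \<mu> b. (\<lambda>k. trig_inner \<mu> (a' k) (b' k)) \<longlonglongrightarrow> z) = z"
  proof (rule the_equality)
    show "\<forall>a'\<in>WC_class \<mu> a. \<forall>b'\<in>WC_class \<mu> b. (\<lambda>k. trig_inner \<mu> (a' k) (b' k)) \<longlonglongrightarrow> z"
      using trig_inner_limit_cong[OF _ _ z] by (auto simp: WC_class_def)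
    fix z' assume z': "\<forall>a'\<in>WC_class \<mu> a. \<forall>b'\<in>WC_class \<mu> b. (\<lambda>k. trig_inner \<mu> (a' k) (b' k)) \<longlonglongrightarrow> z'"
    have "a \<in> WC_class \<mu> a" "b \<in> WC_class \<mu> b"
      using a b by (auto simp: WC_class_def trig_equiv_def trig_norm_0)
    with z' have "(\<lambda>k. trig_inner \<mu> (a k) (b k)) \<longlonglongrightarrow> z'" by blast
    then show "z' = z" using z by (rule LIMSEQ_unique)
  qed
  then show ?thesis by (simp add: WC_def)
qed

lemma hnorm_WC:
  assumes a: "a \<in> trig_Cauchy \<mu>"
  shows "(\<lambda>k. trig_norm \<mu> (a k)) \<longlonglongrightarrow> hnorm (WC \<mu>) (WC_class \<mu> a)"
proof -
  obtain z where z: "(\<lambda>k. trig_inner \<mu> (a k) (a k)) \<longlonglongrightarrow> z"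
    using convergent_trig_inner[OF a a] by (auto simp: convergent_def)
  have "(\<lambda>k. sqrt (norm (trig_inner \<mu> (a k) (a k)))) \<longlonglongrightarrow> sqrt (norm z)"
    by (intro tendsto_intros z)
  then show ?thesis
    by (simp add: hnorm_def hinner_WC[OF a a z] trig_norm_def)
qed

lemma WC_exp_class: "WC_exp \<mu> n = WC_class \<mu> (\<lambda>_. trig_exp n)"
  by (simp add: WC_exp_def WC_embed_def WC_class_def)

text \<open>The inner product on the left is a limit over \<open>k\<close>, the one on the right varies with \<open>k\<close>.  The
  two sequences differ by a null sequence, so a step of the algorithm in the completion may be
  carried out on the members of a representing sequence.\<close>

lemma projection_WC:
  assumes b: "b \<in> trig_Cauchy \<mu>"
  shows "hsmult (WC \<mu>) (hinner (WC \<mu>) (WC_class \<mu> b) (WC_exp \<mu> n)) (WC_exp \<mu> n)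
    = WC_class \<mu> (\<lambda>k. trig_smult (trig_inner \<mu> (b k) (trig_exp n)) (trig_exp n))"
proof -
  obtain z where z: "(\<lambda>k. trig_inner \<mu> (b k) (trig_exp n)) \<longlonglongrightarrow> z"
    using convergent_trig_inner[OF b const_Cauchy] by (auto simp: convergent_def)
  have "(\<lambda>k. norm (z - trig_inner \<mu> (b k) (trig_exp n))) \<longlonglongrightarrow> 0"
    using tendsto_norm_zero[OF tendsto_diff[OF tendsto_const[of z] z, simplified]] by simp
  then have "(\<lambda>k. trig_norm \<mu> (trig_smult z (trig_exp n) - trig_smult (trig_inner \<mu> (b k) (trig_exp n)) (trig_exp n))) \<longlonglongrightarrow> 0"
  proof (rule null_trig_sandwich)
    fix k
    let ?u = "z - trig_inner \<mu> (b k) (trig_exp n)"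
    have "trig_norm \<mu> (trig_smult ?u (trig_exp n)) \<le> norm ?u * 1"
      using trig_norm_smult[of ?u "trig_exp n"] mult_left_mono[OF trig_norm_exp[of n] norm_ge_zero[of ?u]]
      by linarith
    then show "trig_norm \<mu> (trig_smult z (trig_exp n) - trig_smult (trig_inner \<mu> (b k) (trig_exp n)) (trig_exp n)) \<le> norm ?u"
      by (simp add: trig_smult_distribs)
  qed
  from WC_class_eqI[OF const_Cauchy this] show ?thesis
    unfolding WC_exp_class hinner_WC[OF b const_Cauchy z] hsmult_WC[OF const_Cauchy] .
qed

lemma residual_diff: "trig_residual \<mu> (c - d) n = trig_residual \<mu> c n - trig_residual \<mu> d n"
proof (induction n)
  case (Suc n)
  show ?case
    unfolding trig_residual.simps Suc trig_inner_diff trig_smult_distribs by simp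
qed simp

lemma residual_smult: "trig_residual \<mu> (trig_smult u c) n = trig_smult u (trig_residual \<mu> c n)"
proof (induction n)
  case (Suc n)
  show ?case
    unfolding trig_residual.simps Suc trig_inner_smult trig_smult_distribs ..
qed simp

text \<open>In the fibre over \<open>x\<close> the old error is the orthogonal sum of the new error and the component that
  the step removes.\<close>

lemma fibre_norm_sq_residual_Suc:
  "fibre_norm_sq (trig_residual \<mu> c (Suc n)) x = fibre_norm_sq (trig_residual \<mu> c n) x
     - (norm (apply_bcontfun (trig_inner \<mu> (trig_residual \<mu> c n) (trig_exp n)) x))\<^sup>2"
proof -
  let ?r = "trig_residual \<mu> c n" and ?e = "trig_exp n :: 'x trig"
  let ?u = "trig_inner \<mu> ?r ?e"
  have e: "fibre_norm_sq ?e x = 1"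
  proof -
    have "complex_of_real (fibre_norm_sq ?e x) = 1"
      using apply_trig_inner_self[of ?e x] by (simp add: trig_inner_exp_self)
    then show ?thesis by simp
  qed
  have "trig_residual \<mu> c n = trig_residual \<mu> c (Suc n) + trig_smult ?u ?e" by simp
  then have "fibre_norm_sq ?r x = fibre_norm_sq (trig_residual \<mu> c (Suc n) + trig_smult ?u ?e) x" by simp
  also have "\<dots> = fibre_norm_sq (trig_residual \<mu> c (Suc n)) x + (norm (apply_bcontfun ?u x))\<^sup>2
      + 2 * Re (apply_bcontfun (trig_inner \<mu> (trig_residual \<mu> c (Suc n)) (trig_smult ?u ?e)) x)"
    unfolding fibre_norm_sq_add fibre_norm_sq_smult e by simp
  also have "apply_bcontfun (trig_inner \<mu> (trig_residual \<mu> c (Suc n)) (trig_smult ?u ?e)) x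
      = cnj (apply_bcontfun ?u x) * apply_bcontfun (trig_inner \<mu> (trig_residual \<mu> c (Suc n)) ?e) x"
  proof -
    have "trig_fun d x y * cnj (apply_bcontfun ?u x * trig_fun ?e x y)
        = cnj (apply_bcontfun ?u x) * (trig_fun d x y * cnj (trig_fun ?e x y))" for d y by simp
    then show ?thesis
      unfolding apply_trig_inner_integral trig_fun_smult by (simp only: integral_mult_right_zero)
  qed
  also have "trig_inner \<mu> (trig_residual \<mu> c (Suc n)) ?e = 0"
    by (rule bcontfun_eqI) (simp add: trig_inner_diff trig_inner_smult apply_CX_mult trig_inner_exp_self)
  finally show ?thesis by simp
qed

lemma residual_contraction: "trig_norm \<mu> (trig_residual \<mu> c n) \<le> trig_norm \<mu> c"
proof -
  have "fibre_norm_sq (trig_residual \<mu> c n) x \<le> fibre_norm_sq c x" for x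
  proof (induction n)
    case (Suc n)
    then show ?case
      unfolding fibre_norm_sq_residual_Suc by (smt (verit) zero_le_power2)
  qed simp
  then show ?thesis
    using fibre_norm_sq_le[of c] by (intro trig_norm_le trig_norm_nonneg) (meson order_trans)
qed

lemma residual_Cauchy: "a \<in> trig_Cauchy \<mu> \<Longrightarrow> (\<lambda>k. trig_residual \<mu> (a k) n) \<in> trig_Cauchy \<mu>"
  by (erule trig_CauchyI[where K = 1])
     (simp only: residual_diff[symmetric] mult_1, rule residual_contraction)

lemma diff_Cauchy:
  assumes "a \<in> trig_Cauchy \<mu>" "b \<in> trig_Cauchy \<mu>"
  shows "(\<lambda>k. a k - b k) \<in> trig_Cauchy \<mu>"
  using add_Cauchy[OF assms(1) smult_Cauchy[OF assms(2), of "const_bcontfun (- 1)"]]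
  by (simp add: trig_smult_minus_1)

lemma eff_approx_WC:
  assumes a: "a \<in> trig_Cauchy \<mu>"
  shows "eff_approx (WC \<mu>) (WC_exp \<mu>) (WC_class \<mu> a) n = WC_class \<mu> (\<lambda>k. a k - trig_residual \<mu> (a k) (Suc n))"
proof (induction n)
  case 0
  show ?case using projection_WC[OF a, of 0] by simp
next
  case (Suc n)
  have R: "(\<lambda>k. trig_residual \<mu> (a k) (Suc n)) \<in> trig_Cauchy \<mu>" "(\<lambda>k. trig_residual \<mu> (a k) (Suc (Suc n))) \<in> trig_Cauchy \<mu>"
    by (rule residual_Cauchy[OF a])+
  have A: "(\<lambda>k. a k - trig_residual \<mu> (a k) (Suc n)) \<in> trig_Cauchy \<mu>"
    by (rule diff_Cauchy[OF a R(1)])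
  have P: "(\<lambda>k. trig_smult (trig_inner \<mu> (trig_residual \<mu> (a k) (Suc n)) (trig_exp (Suc n))) (trig_exp (Suc n))) \<in> trig_Cauchy \<mu>"
    using diff_Cauchy[OF R] by simp
  have "hminus (WC \<mu>) (WC_class \<mu> a) (eff_approx (WC \<mu>) (WC_exp \<mu>) (WC_class \<mu> a) n)
      = WC_class \<mu> (\<lambda>k. trig_residual \<mu> (a k) (Suc n))"
    unfolding Suc hminus_WC[OF a A] by simp
  then have "eff_approx (WC \<mu>) (WC_exp \<mu>) (WC_class \<mu> a) (Suc n)
      = WC_class \<mu> (\<lambda>k. (a k - trig_residual \<mu> (a k) (Suc n))
          + trig_smult (trig_inner \<mu> (trig_residual \<mu> (a k) (Suc n)) (trig_exp (Suc n))) (trig_exp (Suc n)))"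
    unfolding eff_approx.simps(2) by (simp only: projection_WC[OF R(1)] Suc hadd_WC[OF A P])
  also have "(\<lambda>k. (a k - trig_residual \<mu> (a k) (Suc n))
          + trig_smult (trig_inner \<mu> (trig_residual \<mu> (a k) (Suc n)) (trig_exp (Suc n))) (trig_exp (Suc n)))
      = (\<lambda>k. a k - trig_residual \<mu> (a k) (Suc (Suc n)))"
    by (simp only: trig_residual.simps(2)[of \<mu> _ "Suc n"] diff_diff_eq2 diff_add_eq)
  finally show ?case .
qed

lemma hnorm_error_WC:
  assumes a: "a \<in> trig_Cauchy \<mu>"
  shows "(\<lambda>k. trig_norm \<mu> (trig_residual \<mu> (a k) (Suc n)))
     \<longlonglongrightarrow> hnorm (WC \<mu>) (hminus (WC \<mu>) (eff_approx (WC \<mu>) (WC_exp \<mu>) (WC_class \<mu> a) n) (WC_class \<mu> a))"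
proof -
  have R: "(\<lambda>k. trig_residual \<mu> (a k) (Suc n)) \<in> trig_Cauchy \<mu>" by (rule residual_Cauchy[OF a])
  have A: "(\<lambda>k. a k - trig_residual \<mu> (a k) (Suc n)) \<in> trig_Cauchy \<mu>" by (rule diff_Cauchy[OF a R])
  have "trig_norm \<mu> ((a k - trig_residual \<mu> (a k) (Suc n)) - a k) = trig_norm \<mu> (trig_residual \<mu> (a k) (Suc n))" for k
    by (simp add: trig_norm_uminus del: trig_residual.simps)
  then show ?thesis
    unfolding eff_approx_WC[OF a] hminus_WC[OF A a] using hnorm_WC[OF diff_Cauchy[OF A a]]
    by (simp only:)
qed

text \<open>The error maps are linear over \<open>C(X)\<close>, which reduces arbitrary finite combinations to the vectors
  \<open>e\<^sub>m\<close>, and they are contractions, which extends the convergence to the completion.\<close>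

lemma effective_iff_residual:
  "effective (WC \<mu>) (WC_exp \<mu>) \<longleftrightarrow> (\<forall>m. (\<lambda>n. trig_norm \<mu> (trig_residual \<mu> (trig_exp m) n)) \<longlonglongrightarrow> 0)"
proof
  assume eff: "effective (WC \<mu>) (WC_exp \<mu>)"
  show "\<forall>m. (\<lambda>n. trig_norm \<mu> (trig_residual \<mu> (trig_exp m) n)) \<longlonglongrightarrow> 0"
  proof
    fix m
    let ?a = "WC_class \<mu> (\<lambda>_. trig_exp m)"
    have "?a \<in> hcarrier (WC \<mu>)" using const_Cauchy by (auto simp: carrier_WC)
    then have "(\<lambda>n. hnorm (WC \<mu>) (hminus (WC \<mu>) (eff_approx (WC \<mu>) (WC_exp \<mu>) ?a n) ?a)) \<longlonglongrightarrow> 0"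
      using eff by (simp add: effective_def)
    moreover have "hnorm (WC \<mu>) (hminus (WC \<mu>) (eff_approx (WC \<mu>) (WC_exp \<mu>) ?a n) ?a)
        = trig_norm \<mu> (trig_residual \<mu> (trig_exp m) (Suc n))" for n
      using hnorm_error_WC[OF const_Cauchy[of "trig_exp m"], of n] LIMSEQ_unique tendsto_const by blast
    ultimately have "(\<lambda>n. trig_norm \<mu> (trig_residual \<mu> (trig_exp m) (Suc n))) \<longlonglongrightarrow> 0" by (simp only:)
    then show "(\<lambda>n. trig_norm \<mu> (trig_residual \<mu> (trig_exp m) n)) \<longlonglongrightarrow> 0"
      by (rule LIMSEQ_imp_Suc)
  qed
next
  assume res: "\<forall>m. (\<lambda>n. trig_norm \<mu> (trig_residual \<mu> (trig_exp m) n)) \<longlonglongrightarrow> 0"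
  have monomial: "(\<lambda>n. trig_norm \<mu> (trig_residual \<mu> (Poly_Mapping.single m u) n)) \<longlonglongrightarrow> 0" for m u
  proof -
    have eq: "Poly_Mapping.single m u = trig_smult u (trig_exp m)"
      by (rule poly_mapping_eqI) (auto simp: lookup_trig_smult lookup_single when_def apply_CX_mult intro!: bcontfun_eqI)
    have "(\<lambda>n. norm u * trig_norm \<mu> (trig_residual \<mu> (trig_exp m) n)) \<longlonglongrightarrow> 0"
      by (intro tendsto_mult_right_zero res[rule_format])
    then show ?thesis
      unfolding eq residual_smult by (rule null_trig_sandwich) (rule trig_norm_smult)
  qed
  have dense: "(\<lambda>n. trig_norm \<mu> (trig_residual \<mu> c n)) \<longlonglongrightarrow> 0" for c
  proof (induction c rule: update_induct)
    case const
    have "trig_residual \<mu> 0 n = 0" for n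
      using residual_diff[of 0 0 n] by simp
    then show ?case by (simp add: trig_norm_0)
  next
    case (update c m u)
    have eq: "Poly_Mapping.update m u c = c + Poly_Mapping.single m u"
      using update(1) by (intro poly_mapping_eqI) (auto simp: lookup_update lookup_add lookup_single in_keys_iff)
    have "trig_residual \<mu> (c + d) n = trig_residual \<mu> c n + trig_residual \<mu> d n" for d n
      using residual_diff[of "c + d" d n] by (simp add: algebra_simps)
    then have le: "trig_norm \<mu> (trig_residual \<mu> (c + d) n)
        \<le> trig_norm \<mu> (trig_residual \<mu> c n) + trig_norm \<mu> (trig_residual \<mu> d n)" for d n
      using trig_norm_triangle by simp
    show ?case
      unfolding eq by (rule null_trig_sandwich[OF tendsto_add_zero[OF update(3) monomial] le])
  qed
  have carrier: "WC_exp \<mu> n \<in> hcarrier (WC \<mu>)" for n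
    using const_Cauchy by (auto simp: carrier_WC WC_exp_class)
  have unit: "hinner (WC \<mu>) (WC_exp \<mu> n) (WC_exp \<mu> n) = const_bcontfun 1" for n
    unfolding WC_exp_class by (rule hinner_WC[OF const_Cauchy const_Cauchy]) (simp add: trig_inner_exp_self)
  have conv: "(\<lambda>n. hnorm (WC \<mu>) (hminus (WC \<mu>) (eff_approx (WC \<mu>) (WC_exp \<mu>) f n) f)) \<longlonglongrightarrow> 0"
    if f_in: "f \<in> hcarrier (WC \<mu>)" for f
  proof -
    obtain a where a: "a \<in> trig_Cauchy \<mu>" and f: "f = WC_class \<mu> a" using f_in by (auto simp: carrier_WC)
    let ?h = "\<lambda>n. hnorm (WC \<mu>) (hminus (WC \<mu>) (eff_approx (WC \<mu>) (WC_exp \<mu>) f n) f)"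
    show ?thesis
    proof (rule LIMSEQ_I)
      fix e :: real assume "0 < e"
      then have e: "e / 3 > 0" by simp
      obtain K where K: "\<And>k l. k \<ge> K \<Longrightarrow> l \<ge> K \<Longrightarrow> trig_norm \<mu> (a k - a l) < e / 3"
        using trig_CauchyD[OF a e] by blast
      obtain N where N: "\<And>n. n \<ge> N \<Longrightarrow> trig_norm \<mu> (trig_residual \<mu> (a K) n) < e / 3"
        using order_tendstoD(2)[OF dense[of "a K"] e] by (auto simp: eventually_sequentially)
      have "norm (?h n - 0) < e" if n: "n \<ge> N" for n
      proof -
        have "trig_norm \<mu> (trig_residual \<mu> (a k) (Suc n)) \<le> 2 * e / 3" if "k \<ge> K" for k
        proof -
          have "trig_norm \<mu> (trig_residual \<mu> (a k - a K) (Suc n)) \<le> trig_norm \<mu> (a k - a K)"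
            by (rule residual_contraction)
          then show ?thesis
            using trig_norm_le_add_diff[of "trig_residual \<mu> (a k) (Suc n)" "trig_residual \<mu> (a K) (Suc n)"]
              K[of k K] N[of "Suc n"] n that unfolding residual_diff by simp
        qed
        then have "?h n \<le> 2 * e / 3"
          using hnorm_error_WC[OF a, of n] unfolding f
          by (intro LIMSEQ_le_const2) auto
        moreover have "?h n \<ge> 0" by (simp add: hnorm_def)
        ultimately show ?thesis using \<open>0 < e\<close> by simp
      qed
      then show "\<exists>no. \<forall>n\<ge>no. norm (?h n - 0) < e" by blast
    qed
  qed
  show "effective (WC \<mu>) (WC_exp \<mu>)"
    unfolding effective_def using carrier unit conv by blast
qed

lemma trig_fun_residual: "trig_fun (trig_residual \<mu> (trig_exp m) n) x y = kaczmarz_residual (\<mu> x) m n y"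
proof (induction n arbitrary: y)
  case 0
  show ?case by (simp add: trig_fun_exp kaczmarz_residual_def)
next
  case (Suc n)
  interpret circle_prob "\<mu> x" by (rule circle_prob)
  have "apply_bcontfun (trig_inner \<mu> (trig_residual \<mu> (trig_exp m) n) (trig_exp n)) x = kaczmarz_coeff (\<mu> x) m n"
    unfolding apply_trig_inner_integral Suc trig_fun_exp by (rule integral_residual_cnj)
  then show ?case
    by (simp add: trig_fun_diff trig_fun_smult trig_fun_exp Suc residual_Suc)
qed

lemma fibre_norm_sq_residual:
  "fibre_norm_sq (trig_residual \<mu> (trig_exp m) n) x = 1 - (\<Sum>k<n. (norm (kaczmarz_coeff (\<mu> x) m k))\<^sup>2)"
  unfolding fibre_norm_sq_def trig_fun_residual
  by (rule circle_prob.integral_residual_sq[OF circle_prob])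

text \<open>In every fibre the squared error is \<open>1 - (\<Sum>k<n. \<bar>d\<^sub>k\<bar>\<^sup>2)\<close>.  As a function of \<open>x\<close> it is continuous,
  and it decreases with \<open>n\<close>; so Dini's theorem upgrades its pointwise convergence to uniform
  convergence, which is convergence in the norm of the module.\<close>

lemma residual_tendsto_iff:
  "(\<lambda>n. trig_norm \<mu> (trig_residual \<mu> (trig_exp m) n)) \<longlonglongrightarrow> 0 \<longleftrightarrow>
     (\<forall>x. suminf (\<lambda>k. (norm (kaczmarz_coeff (\<mu> x) m k))\<^sup>2) = 1)"
proof -
  let ?F = "\<lambda>n. fibre_norm_sq (trig_residual \<mu> (trig_exp m) n)"
  have F: "(\<lambda>n. ?F n x) \<longlonglongrightarrow> 1 - suminf (\<lambda>k. (norm (kaczmarz_coeff (\<mu> x) m k))\<^sup>2)" for x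
    unfolding fibre_norm_sq_residual
    by (intro tendsto_intros summable_LIMSEQ circle_prob.summable_coeff_sq[OF circle_prob])
  show ?thesis
  proof
    assume lim: "(\<lambda>n. trig_norm \<mu> (trig_residual \<mu> (trig_exp m) n)) \<longlonglongrightarrow> 0"
    show "\<forall>x. suminf (\<lambda>k. (norm (kaczmarz_coeff (\<mu> x) m k))\<^sup>2) = 1"
    proof
      fix x
      have sq: "(\<lambda>n. (trig_norm \<mu> (trig_residual \<mu> (trig_exp m) n))\<^sup>2) \<longlonglongrightarrow> 0"
        using tendsto_power[OF lim, of 2] by (simp only: zero_power2)
      have "(\<lambda>n. ?F n x) \<longlonglongrightarrow> 0"
      proof (rule tendsto_sandwich[OF _ _ tendsto_const sq])
        show "\<forall>\<^sub>F n in sequentially. 0 \<le> ?F n x"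
          by (intro always_eventually allI fibre_norm_sq_nonneg)
        show "\<forall>\<^sub>F n in sequentially. ?F n x \<le> (trig_norm \<mu> (trig_residual \<mu> (trig_exp m) n))\<^sup>2"
          by (intro always_eventually allI fibre_norm_sq_le)
      qed
      from LIMSEQ_unique[OF F[of x] this] show "suminf (\<lambda>k. (norm (kaczmarz_coeff (\<mu> x) m k))\<^sup>2) = 1" by simp
    qed
  next
    assume "\<forall>x. suminf (\<lambda>k. (norm (kaczmarz_coeff (\<mu> x) m k))\<^sup>2) = 1"
    with F have F0: "\<And>x. (\<lambda>n. ?F n x) \<longlonglongrightarrow> 0" by simp
    show "(\<lambda>n. trig_norm \<mu> (trig_residual \<mu> (trig_exp m) n)) \<longlonglongrightarrow> 0"
    proof (rule LIMSEQ_I)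
      fix e :: real assume e: "0 < e"
      have dec: "?F (Suc n) x \<le> ?F n x" for n x
        unfolding fibre_norm_sq_residual_Suc by simp
      obtain N where N: "\<And>n x. n \<ge> N \<Longrightarrow> ?F n x < (e / 2)\<^sup>2"
      proof -
        have "(e / 2)\<^sup>2 > 0" using e by simp
        from Dini_compact[of ?F, OF compact_X continuous_fibre_norm_sq dec F0 this] that
        show thesis by blast
      qed
      have "trig_norm \<mu> (trig_residual \<mu> (trig_exp m) n) \<le> e / 2" if "n \<ge> N" for n
        using e by (intro trig_norm_le less_imp_le[OF N] that) simp
      then have "norm (trig_norm \<mu> (trig_residual \<mu> (trig_exp m) n) - 0) < e" if "n \<ge> N" for n
        using that e trig_norm_nonneg[of "trig_residual \<mu> (trig_exp m) n"]
        unfolding diff_0_right real_norm_def by (smt (verit) field_sum_of_halves)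
      then show "\<exists>N. \<forall>n\<ge>N. norm (trig_norm \<mu> (trig_residual \<mu> (trig_exp m) n) - 0) < e" by blast
    qed
  qed
qed

end

theorem corollary4p3:
  fixes \<mu> :: "'x::t2_space \<Rightarrow> real measure"
  assumes "compact (UNIV :: 'x set)"
    and "borel_prob_family \<mu>"
    and "weakly_continuous \<mu>"
  shows "effective (WC \<mu>) (WC_exp \<mu>) \<longleftrightarrow>
    (\<forall>x. mutually_singular (\<mu> x) lebesgue01 \<or> \<mu> x = lebesgue01)"
proof -
  interpret circle_family \<mu> by unfold_locales (use assms in auto)
  show ?thesis
    unfolding effective_iff_residual residual_tendsto_iff
    using circle_prob.coeff_sum_iff[OF circle_prob] by blast
qed

end
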